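(* Let $a\in\mathbb{N}$ be a positive integer. Then there is $n_0=n_0(a)$ such that for every $n\ge n_0$ the $(a:a)$ Maker-Breaker Hamilton cycle game $\mathcal{H}_n$ on $E(K_n)$ satisfies $$\tau_{\mathcal{H}_n}(a:a)=\begin{cases}\frac{n}{a}+1, & \text{if } a=1 \text{ or } (a=2 \text{ and } n \text{ is even}),\\ \left\lceil \frac{n}{a}\right\rceil, & \text{otherwise.}\end{cases}$$
   Context: In the $(a:a)$ Maker-Breaker game with board $X=E(K_n)$ (the edge set of the complete graph on $n$ vertices) and family of winning sets $\mathcal{F}\subseteq 2^X$, Breaker and Maker alternately claim $a$ previously unclaimed elements of $X$ per move (fewer if fewer remain), and Breaker moves first. Maker wins at the moment she has claimed all elements of some $F\in\mathcal{F}$ (this may happen before she has used all $a$ steps of her move); if she has not done so by the time all of $X$ is claimed, Breaker wins. $\tau_{\mathcal{F}}(a:a)$ denotes the least number of moves $t$ such that Maker has a strategy to win the $(a:a)$ game $\mathcal{F}$ within $t$ of her moves, against any strategy of Breaker ($\tau_{\mathcal F}(a:a)=\infty$ if Breaker has a winning strategy). In the Hamilton cycle game $\mathcal{H}_n$ the winning sets are the edge sets of all Hamilton cycles of $K_n$. *)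

theory Defs
  imports Complex_Main "HOL-Library.Extended_Nat"
begin

text \<open>
  A history is the chronological list of the moves made so far, a move being the set of elements
  claimed in it; both players' moves are recorded. A strategy maps histories to moves. Requiring
  legality on all lists of sets, and not only on histories that can actually arise, costs nothing
  on a finite board, since a legal move then always exists.
\<close>

definition free :: "'e set \<Rightarrow> 'e set list \<Rightarrow> 'e set" where
  "free X h = X - \<Union> (set h)"

definition legal_move :: "'e set \<Rightarrow> nat \<Rightarrow> 'e set list \<Rightarrow> 'e set \<Rightarrow> bool" where
  "legal_move X a h m \<longleftrightarrow> m \<subseteq> free X h \<and> card m = min a (card (free X h))"

definition strategy :: "'e set \<Rightarrow> nat \<Rightarrow> ('e set list \<Rightarrow> 'e set) \<Rightarrow> bool" where
  "strategy X a \<sigma> \<longleftrightarrow> (\<forall>h. legal_move X a h (\<sigma> h))"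

text \<open>
  \<open>play \<beta> \<sigma> k\<close> is the history after \<open>k\<close> moves in total, Breaker using \<open>\<beta>\<close> and Maker using \<open>\<sigma>\<close>.
  Breaker moves first, so his moves have the even indices.
\<close>

primrec play :: "('e set list \<Rightarrow> 'e set) \<Rightarrow> ('e set list \<Rightarrow> 'e set) \<Rightarrow> nat \<Rightarrow> 'e set list" where
  "play \<beta> \<sigma> 0 = []"
| "play \<beta> \<sigma> (Suc k) = play \<beta> \<sigma> k @ [(if even k then \<beta> else \<sigma>) (play \<beta> \<sigma> k)]"

definition maker_claimed ::
    "('e set list \<Rightarrow> 'e set) \<Rightarrow> ('e set list \<Rightarrow> 'e set) \<Rightarrow> nat \<Rightarrow> 'e set" where
  "maker_claimed \<beta> \<sigma> t = (\<Union>i<t. play \<beta> \<sigma> (2 * t) ! (2 * i + 1))"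

text \<open>
  The play is formally continued after a winning set has been completed, possibly in the middle of
  a move. As Maker never loses elements, she has won within her first \<open>t\<close> moves iff the set claimed
  in these moves contains a winning set.
\<close>

definition maker_wins_within :: "'e set \<Rightarrow> 'e set set \<Rightarrow> nat \<Rightarrow> nat \<Rightarrow> bool" where
  "maker_wins_within X \<F> a t \<longleftrightarrow>
     (\<exists>\<sigma>. strategy X a \<sigma> \<and>
       (\<forall>\<beta>. strategy X a \<beta> \<longrightarrow> (\<exists>F\<in>\<F>. F \<subseteq> maker_claimed \<beta> \<sigma> t)))"

text \<open>If no \<open>t\<close> is good, the value is \<open>Inf {} = \<infinity>\<close>.\<close>

definition tau :: "'e set \<Rightarrow> 'e set set \<Rightarrow> nat \<Rightarrow> enat" where
  "tau X \<F> a = Inf (enat ` {t. maker_wins_within X \<F> a t})"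

definition complete_edges :: "nat \<Rightarrow> nat set set" where
  "complete_edges n = {e. e \<subseteq> {..<n} \<and> card e = 2}"

definition cycle_edges :: "'v list \<Rightarrow> 'v set set" where
  "cycle_edges vs = {{vs ! i, vs ! (Suc i mod length vs)} | i. i < length vs}"

definition hamilton_cycles :: "nat \<Rightarrow> nat set set set" where
  "hamilton_cycles n =
     {cycle_edges vs | vs. distinct vs \<and> set vs = {..<n} \<and> length vs \<ge> 3}"

end

theory Submission imports Defs begin

text \<open>
  Maker keeps a system of vertex-disjoint paths covering all vertices and merges them. Only those
  edges of Breaker hinder her that join ends of paths, so merging two paths at ends where Breaker
  has edges makes these edges harmless. The quantity that decides the game is the number \<open>e\<close> of
  harmful edges compared with the number \<open>k\<close> of nontrivial paths: while there are many isolated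
  vertices, Maker can bring about that \<open>e\<close> is behind \<open>k\<close> by \<open>min a 3\<close> after her moves, and this
  lead can be kept until at most three paths are left, where it suffices to complete a Hamilton
  cycle without wasting an edge if \<open>a \<ge> 3\<close>, and with one spare edge if \<open>a = 2\<close>.

  For \<open>a = 1\<close> Maker may waste one edge. She first grows a single long path until only a bounded
  number of vertices is left. If she can close it to a cycle, she makes a second path of all
  remaining vertices and inserts it between two neighbours on the cycle. Otherwise Breaker's edges
  are tied to preventing this, and Maker gains enough tempo to reach two paths with at most one
  harmful edge; she then hangs the shorter one on an inner vertex of the longer one, which leaves
  too many ways to complete a Hamilton cycle.

  Conversely, Maker needs at least \<open>n\<close> edges. If she has to use each of them, then before her
  last move only one edge (\<open>a = 1\<close>) or two pairs of edges (\<open>a = 2\<close>, \<open>n\<close> even) complete a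
  Hamilton cycle, and Breaker claims an edge from each of them.
\<close>

section \<open>A relaxed game\<close>

text \<open>The lead is k + \<rho> - e, where \<rho> counts the edges left in Maker's current move.
  A move of Breaker lowers it by at most a, and Maker's new move gives \<rho> = a in return. Joining
  two isolated vertices is free, as k grows while \<rho> falls; lengthening a path costs one unit
  and joining two paths costs two, to be repaid by harmful edges at ends that become inner vertices.
  The lead required is k + \<rho> at the start of the endgame minus the number of harmful edges the
  endgame tolerates: 2 + 2 - 1 for a \<ge> 3, 3 + 2 - 3 for a = 2; for a = 1 it is 2 + 1 - 2 beside
  a closed cycle and 2 + 1 - 1 with two open paths.

  A general argument produces a lead of at most a from any bounded disadvantage. For a = 1 the open
  endgame, which wants 2, is out of its reach; hence the single long path and the permanent threat
  to close it. A spare edge is spent by breaking an edge inside a path or cycle, which fails if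
  Breaker owns too many edges at an end; hence the degree bounds carried along for a \<le>
  2.\<close>

text \<open>
  In contrast to the game of the theorem, moves of fewer than \<open>a\<close> elements are allowed, and Maker
  may claim elements that she already owns.
\<close>

primrec wins :: "'e set \<Rightarrow> 'e set set \<Rightarrow> nat \<Rightarrow> nat \<Rightarrow> 'e set \<Rightarrow> 'e set \<Rightarrow> bool" where
  "wins X \<F> a 0 M B \<longleftrightarrow> (\<exists>F\<in>\<F>. F \<subseteq> M)"
| "wins X \<F> a (Suc t) M B \<longleftrightarrow>
     (\<forall>b. b \<subseteq> X - (M \<union> B) \<and> card b \<le> a \<longrightarrow>
       (\<exists>r. r \<subseteq> X - (B \<union> b) \<and> card r \<le> a \<and> wins X \<F> a t (M \<union> r) (B \<union> b)))"

text \<open>A position in the middle of Maker's move, with up to \<open>\<rho>\<close> edges still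
  to be claimed before Breaker's turn. It allows moves to be analysed edge by edge.\<close>

definition mwin :: "'e set \<Rightarrow> 'e set set \<Rightarrow> nat \<Rightarrow> nat \<Rightarrow> nat \<Rightarrow> 'e set \<Rightarrow> 'e set \<Rightarrow> bool" where
  "mwin X \<F> a \<rho> t M B \<longleftrightarrow>
     (\<exists>r. r \<subseteq> X - B \<and> card r \<le> \<rho> \<and> wins X \<F> a t (M \<union> r) B)"

lemma mwin_mono: "mwin X \<F> a \<rho> t M B \<Longrightarrow> \<rho> \<le> \<rho>' \<Longrightarrow> mwin X \<F> a \<rho>' t M B"
  unfolding mwin_def by (meson le_trans)

lemma mwin_0: "wins X \<F> a t M B \<Longrightarrow> mwin X \<F> a \<rho> t M B"
  unfolding mwin_def by (intro exI[of _ "{}"]) auto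

lemma mwin_insert:
  assumes "mwin X \<F> a \<rho> t (insert e M) B" "e \<in> X - B"
  shows "mwin X \<F> a (Suc \<rho>) t M B"
proof -
  obtain r where r: "r \<subseteq> X - B" "card r \<le> \<rho>" "wins X \<F> a t (insert e M \<union> r) B"
    using assms(1) by (auto simp: mwin_def)
  have "card (insert e r) \<le> Suc \<rho>"
    using r(2) by (metis Suc_le_mono card.infinite card_insert_le_m1 diff_Suc_1 le0 finite_insert zero_less_Suc)
  then show ?thesis unfolding mwin_def using r assms(2)
    by (intro exI[of _ "insert e r"]) auto
qed

lemma wins_Suc_iff:
  "wins X \<F> a (Suc t) M B \<longleftrightarrow>
     (\<forall>b. b \<subseteq> X - (M \<union> B) \<and> card b \<le> a \<longrightarrow> mwin X \<F> a a t M (B \<union> b))"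
  by (simp add: mwin_def)

section \<open>Playing a relaxed strategy in the actual game\<close>

definition brk :: "nat \<Rightarrow> 'e set list \<Rightarrow> 'e set" where
  "brk j h = (\<Union>i<j. h ! (2 * i))"

text \<open>
  Maker's strategy in the actual game: she imagines a relaxed game in which Breaker makes his actual
  moves and she claims only \<open>virt\<close>. Elements that she has to claim in addition are ignored; should
  the relaxed strategy ask for them later, she gets them for free.
\<close>

primrec virt :: "'e set \<Rightarrow> 'e set set \<Rightarrow> nat \<Rightarrow> nat \<Rightarrow> nat \<Rightarrow> 'e set list \<Rightarrow> 'e set" where
  "virt X \<F> a t 0 h = {}"
| "virt X \<F> a t (Suc j) h = virt X \<F> a t j h \<union>
     (SOME r. r \<subseteq> X - brk (Suc j) h \<and> card r \<le> a \<and>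
        wins X \<F> a (t - Suc j) (virt X \<F> a t j h \<union> r) (brk (Suc j) h))"

text \<open>\<open>virt\<close> looks only at Breaker's moves, at the even indices. Hence the set
  computed during the game agrees with the one computed from the final history.\<close>

lemma virt_cong:
  "(\<And>i. i < j \<Longrightarrow> h ! (2 * i) = h' ! (2 * i)) \<Longrightarrow> virt X \<F> a t j h = virt X \<F> a t j h'"
proof (induction j)
  case (Suc j)
  moreover have "brk (Suc j) h = brk (Suc j) h'"
    using Suc.prems by (auto simp: brk_def)
  ultimately show ?case by simp
qed simp

lemma legal_superset:
  assumes "finite X" "T \<subseteq> free X h" "card T \<le> a"
  shows "\<exists>m. legal_move X a h m \<and> T \<subseteq> m"
proof -
  have fin: "finite (free X h)" using assms(1) by (auto simp: free_def)
  have "card T \<le> min a (card (free X h))"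
    using assms card_mono[OF fin assms(2)] by auto
  then obtain m where "T \<subseteq> m" "m \<subseteq> free X h" "card m = min a (card (free X h))"
    using exists_subset_between[of T "min a (card (free X h))" "free X h"] assms(2) fin by auto
  then show ?thesis by (auto simp: legal_move_def)
qed

lemma legal_exists: "finite X \<Longrightarrow> \<exists>m. legal_move X a h m"
  using legal_superset[of X "{}"] by auto

lemma play_conv_map:
  "play \<beta> \<sigma> k = map (\<lambda>i. (if even i then \<beta> else \<sigma>) (play \<beta> \<sigma> i)) [0..<k]"
  by (induction k) auto

lemma length_play [simp]: "length (play \<beta> \<sigma> k) = k"
  by (induction k) auto

lemma nth_play: "i < k \<Longrightarrow> play \<beta> \<sigma> k ! i = (if even i then \<beta> else \<sigma>) (play \<beta> \<sigma> i)"
  by (subst play_conv_map) (simp del: play.simps)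

lemma set_play: "set (play \<beta> \<sigma> k) = (\<lambda>i. (if even i then \<beta> else \<sigma>) (play \<beta> \<sigma> i)) ` {..<k}"
  by (subst play_conv_map) (auto simp del: play.simps)

lemma play_legal:
  assumes "strategy X a \<sigma>" "strategy X a \<beta>"
  shows "legal_move X a (play \<beta> \<sigma> i) ((if even i then \<beta> else \<sigma>) (play \<beta> \<sigma> i))"
  using assms by (auto simp: strategy_def)

lemma play_disjoint:
  assumes "strategy X a \<sigma>" "strategy X a \<beta>" "i < j"
  shows "(if even i then \<beta> else \<sigma>) (play \<beta> \<sigma> i) \<inter> (if even j then \<beta> else \<sigma>) (play \<beta> \<sigma> j) = {}"
proof -
  have "(if even i then \<beta> else \<sigma>) (play \<beta> \<sigma> i) \<in> set (play \<beta> \<sigma> j)"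
    using assms(3) unfolding set_play by blast
  then show ?thesis
    using play_legal[OF assms(1,2), of j] unfolding legal_move_def free_def by fastforce
qed

lemma disjoint_Un_mono: "b \<inter> A = {} \<Longrightarrow> V \<subseteq> A \<Longrightarrow> b \<inter> K = {} \<Longrightarrow> b \<inter> (V \<union> K) = {}"
  by blast

theorem maker_wins_within_if_wins:
  assumes fin: "finite X" and win: "wins X \<F> a t {} {}"
  shows "maker_wins_within X \<F> a t"
proof -
  \<comment> \<open>At Maker's turn number \<open>j + 1\<close> the history has length
    \<open>2 * j + 1\<close>, so \<open>Suc (length h div 2)\<close> is the number of Breaker's
    moves seen so far. Elements already claimed are taken off to keep the move legal.\<close>
  define T where "T h = virt X \<F> a t (Suc (length h div 2)) h - \<Union>(set h)" for h
  define \<sigma> where "\<sigma> h = (if \<exists>m. legal_move X a h m \<and> T h \<subseteq> m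
      then SOME m. legal_move X a h m \<and> T h \<subseteq> m else SOME m. legal_move X a h m)" for h
  have \<sigma>T: "legal_move X a h (\<sigma> h) \<and> T h \<subseteq> \<sigma> h" if "\<exists>m. legal_move X a h m \<and> T h \<subseteq> m" for h
    using someI_ex[OF that] that by (simp add: \<sigma>_def)
  have strat: "strategy X a \<sigma>"
    unfolding strategy_def
  proof
    fix h show "legal_move X a h (\<sigma> h)"
    proof (cases "\<exists>m. legal_move X a h m \<and> T h \<subseteq> m")
      case False
      then have "\<sigma> h = (SOME m. legal_move X a h m)" unfolding \<sigma>_def by (rule if_not_P)
      then show ?thesis using someI_ex[OF legal_exists[OF fin, of a h]] by simp
    qed (use \<sigma>T in blast)
  qed
  show ?thesis unfolding maker_wins_within_def
  proof (intro exI conjI allI impI)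
    fix \<beta> assume \<beta>: "strategy X a \<beta>"
    define mv where "mv i = (if even i then \<beta> else \<sigma>) (play \<beta> \<sigma> i)" for i
    define h where "h = play \<beta> \<sigma> (2 * t)"
    have nth: "play \<beta> \<sigma> k ! i = mv i" if "i < k" for i k
      using nth_play[OF that, of \<beta> \<sigma>] by (simp add: mv_def)
    have legal: "legal_move X a (play \<beta> \<sigma> i) (mv i)" for i
      unfolding mv_def by (rule play_legal[OF strat \<beta>])
    have disj: "mv i \<inter> mv j = {}" if "i \<noteq> j" for i j
      using play_disjoint[OF strat \<beta>, of i j] play_disjoint[OF strat \<beta>, of j i] that
      unfolding mv_def by (metis Int_commute nat_neq_iff)
    have setp: "\<Union>(set (play \<beta> \<sigma> k)) = (\<Union>i<k. mv i)" for k
      unfolding set_play mv_def by auto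
    have sub: "mv i \<subseteq> X" "card (mv i) \<le> a" for i
      using legal[of i] by (auto simp: legal_move_def free_def)
    have brk: "brk j h = (\<Union>i<j. mv (2 * i))" if "j \<le> t" for j
      using that by (auto simp: brk_def h_def nth)
    have inv: "wins X \<F> a (t - j) (virt X \<F> a t j h) (brk j h)
        \<and> virt X \<F> a t j h \<subseteq> (\<Union>i<j. mv (2 * i + 1))" if "j \<le> t" for j
      using that
    proof (induction j)
      case 0
      then show ?case using win by (simp add: brk_def)
    next
      case (Suc j)
      define V where "V = virt X \<F> a t j h"
      define b where "b = mv (2 * j)"
      have IH: "wins X \<F> a (Suc (t - Suc j)) V (brk j h)" "V \<subseteq> (\<Union>i<j. mv (2 * i + 1))"
        using Suc by (auto simp: V_def Suc_diff_Suc)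
      have brkS: "brk (Suc j) h = brk j h \<union> b"
        using Suc.prems by (auto simp: brk b_def lessThan_Suc)
      have "b \<inter> mv (2 * i + 1) = {}" for i
        unfolding b_def by (rule disj) presburger
      moreover have "b \<inter> mv (2 * i) = {}" if "i < j" for i
        unfolding b_def by (rule disj) (use that in simp)
      ultimately have "b \<inter> (\<Union>i<j. mv (2 * i + 1)) = {}" "b \<inter> brk j h = {}"
        unfolding brk[OF Suc_leD[OF Suc.prems]] by (simp_all add: Int_UN_distrib)
      then have "b \<inter> (V \<union> brk j h) = {}"
        using disjoint_Un_mono[OF _ IH(2)] by simp
      then have "b \<subseteq> X - (V \<union> brk j h)" "card b \<le> a" using sub b_def by auto
      then have ex: "\<exists>r. r \<subseteq> X - brk (Suc j) h \<and> card r \<le> a \<and>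
          wins X \<F> a (t - Suc j) (V \<union> r) (brk (Suc j) h)"
        using IH(1) brkS by auto
      define r where "r = (SOME r. r \<subseteq> X - brk (Suc j) h \<and> card r \<le> a \<and>
          wins X \<F> a (t - Suc j) (V \<union> r) (brk (Suc j) h))"
      have r: "r \<subseteq> X - brk (Suc j) h" "card r \<le> a"
        "wins X \<F> a (t - Suc j) (V \<union> r) (brk (Suc j) h)"
        using someI_ex[OF ex] unfolding r_def by blast+
      have virtS: "virt X \<F> a t (Suc j) h = V \<union> r" by (simp add: V_def r_def)
      define g where "g = play \<beta> \<sigma> (2 * j + 1)"
      have "virt X \<F> a t (Suc j) g = virt X \<F> a t (Suc j) h"
        by (rule virt_cong) (use Suc.prems in \<open>auto simp: g_def h_def nth simp del: play.simps\<close>)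
      then have Tg: "T g = (V \<union> r) - \<Union>(set g)"
        using virtS by (simp add: T_def g_def del: virt.simps play.simps)
      have setg: "\<Union>(set g) = (\<Union>i<2*j+1. mv i)" unfolding g_def by (rule setp)
      have "mv (2 * i + 1) \<subseteq> (\<Union>i<2*j+1. mv i)" if "i < j" for i
        using that by (intro UN_upper) auto
      then have "(\<Union>i<j. mv (2 * i + 1)) \<subseteq> (\<Union>i<2*j+1. mv i)" by (intro UN_least) simp
      then have "V \<subseteq> \<Union>(set g)" unfolding setg by (rule subset_trans[OF IH(2)])
      then have "T g \<subseteq> r" using Tg by auto
      moreover have "finite r" using r(1) fin finite_subset by blast
      ultimately have "card (T g) \<le> a" using r(2) card_mono by (meson le_trans)
      moreover have "T g \<subseteq> free X g" using \<open>T g \<subseteq> r\<close> r(1) Tg by (auto simp: free_def)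
      ultimately have "T g \<subseteq> \<sigma> g" using \<sigma>T legal_superset[OF fin] by metis
      then have Tmv: "T g \<subseteq> mv (2 * j + 1)" by (simp add: mv_def g_def)
      have "r \<subseteq> (\<Union>i<Suc j. mv (2 * i + 1))"
      proof
        fix x assume x: "x \<in> r"
        show "x \<in> (\<Union>i<Suc j. mv (2 * i + 1))"
        proof (cases "x \<in> \<Union>(set g)")
          case True
          then obtain i where i: "i < 2 * j + 1" "x \<in> mv i" unfolding setg by (elim UN_E) simp
          \<comment> \<open>A requested element that is already claimed cannot be Breaker's, as
            \<open>r\<close> avoids all his moves so far; so Maker owns it.\<close>
          have "odd i"
          proof
            assume "even i"
            then obtain i' where "i = 2 * i'" by blast
            then have "x \<in> brk (Suc j) h" using i Suc.prems by (auto simp: brk)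
            then show False using x r(1) by auto
          qed
          then obtain i' where "i = 2 * i' + 1" by (metis oddE)
          then have i': "i' \<in> {..<Suc j}" "x \<in> mv (2 * i' + 1)" using i by auto
          show ?thesis using i' by (intro UN_I[of i'])
        next
          case False
          then have "x \<in> T g" using x Tg by simp
          then have "x \<in> mv (2 * j + 1)" using Tmv by (rule subsetD[rotated])
          then show ?thesis by (intro UN_I[of j]) auto
        qed
      qed
      moreover have "V \<subseteq> (\<Union>i<Suc j. mv (2 * i + 1))"
        by (rule subset_trans[OF IH(2)]) (intro UN_mono, auto)
      ultimately show ?case unfolding virtS using r(3) by (simp only: Un_least simp_thms)
    qed
    have "\<exists>F\<in>\<F>. F \<subseteq> virt X \<F> a t t h" using inv[of t] by simp
    moreover have "(\<Union>i<t. mv (2 * i + 1)) = maker_claimed \<beta> \<sigma> t"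
      by (auto simp: maker_claimed_def nth)
    ultimately show "\<exists>F\<in>\<F>. F \<subseteq> maker_claimed \<beta> \<sigma> t"
      using inv[of t] by (metis le_refl subset_trans)
  qed (rule strat)
qed

section \<open>Path systems\<close>

definition walk :: "'v set set \<Rightarrow> 'v list \<Rightarrow> bool" where
  "walk M xs \<longleftrightarrow> successively (\<lambda>u v. {u, v} \<in> M) xs"

lemma walk_simps [simp]: "walk M []" "walk M [x]"
  by (auto simp: walk_def)

lemma walk_Cons: "walk M (x # xs) \<longleftrightarrow> xs = [] \<or> {x, hd xs} \<in> M \<and> walk M xs"
  by (auto simp: walk_def successively_Cons)

lemma walk_append:
  "walk M (xs @ ys) \<longleftrightarrow> walk M xs \<and> walk M ys \<and> (xs = [] \<or> ys = [] \<or> {last xs, hd ys} \<in> M)"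
  by (auto simp: walk_def successively_append_iff)

lemma walk_rev [simp]: "walk M (rev xs) \<longleftrightarrow> walk M xs"
  by (simp add: walk_def insert_commute)

lemma walk_mono: "walk M xs \<Longrightarrow> M \<subseteq> M' \<Longrightarrow> walk M' xs"
  unfolding walk_def by (erule successively_mono) auto

lemma walk_nth: "walk M xs \<Longrightarrow> Suc i < length xs \<Longrightarrow> {xs ! i, xs ! Suc i} \<in> M"
proof (induction xs arbitrary: i)
  case (Cons x xs)
  then show ?case by (cases i) (auto simp: walk_Cons hd_conv_nth)
qed simp

lemma cycle_edges_subset:
  assumes "walk M vs" "vs \<noteq> []" "{last vs, hd vs} \<in> M"
  shows "cycle_edges vs \<subseteq> M"
proof
  fix e assume "e \<in> cycle_edges vs"
  then obtain i where i: "i < length vs" "e = {vs ! i, vs ! (Suc i mod length vs)}"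
    by (auto simp: cycle_edges_def)
  show "e \<in> M"
  proof (cases "Suc i < length vs")
    case False
    then have "Suc i = length vs" "i = length vs - 1" using i by auto
    then show ?thesis using assms i by (simp add: last_conv_nth hd_conv_nth)
  qed (use i assms walk_nth in auto)
qed

lemma hamilton_cycle_if_closed_walk:
  assumes "walk M vs" "distinct vs" "set vs = {..<n}" "n \<ge> 3" "{last vs, hd vs} \<in> M"
  shows "\<exists>F\<in>hamilton_cycles n. F \<subseteq> M"
proof -
  have "length vs = n" using assms(2,3) distinct_card by fastforce
  then have "cycle_edges vs \<in> hamilton_cycles n" "vs \<noteq> []"
    unfolding hamilton_cycles_def using assms(2-4) by (blast, force)
  then show ?thesis using cycle_edges_subset[OF assms(1) _ assms(5)] by blast
qed

definition path_system :: "'v set set \<Rightarrow> 'v set \<Rightarrow> 'v list set \<Rightarrow> bool" where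
  "path_system M U P \<longleftrightarrow> (\<forall>xs\<in>P. xs \<noteq> [] \<and> distinct xs \<and> walk M xs) \<and>
     (\<forall>xs\<in>P. \<forall>ys\<in>P. xs \<noteq> ys \<longrightarrow> set xs \<inter> set ys = {}) \<and> (\<Union>xs\<in>P. set xs) = U"

definition ends_mate :: "'v list set \<Rightarrow> 'v set \<Rightarrow> ('v \<Rightarrow> 'v) \<Rightarrow> bool" where
  "ends_mate P V m \<longleftrightarrow> V = (\<Union>xs\<in>P. {hd xs, last xs}) \<and>
     (\<forall>xs\<in>P. m (hd xs) = last xs \<and> m (last xs) = hd xs)"

text \<open>The paths are hidden behind an existential: the strategy sees only the set of ends and
  the involution pairing them, whose fixed points are the one-vertex paths. Lists are recovered only
  for the endgames.\<close>

definition realizes :: "'v set set \<Rightarrow> 'v set \<Rightarrow> 'v set \<Rightarrow> ('v \<Rightarrow> 'v) \<Rightarrow> bool" where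
  "realizes M U V m \<longleftrightarrow> (\<exists>P. path_system M U P \<and> ends_mate P V m)"

text \<open>Reversing the path that ends in \<open>u\<close> keeps ends and mates. The last two
  clauses allow a second path to be turned without disturbing the first.\<close>

lemma orient:
  assumes "path_system M U P" "ends_mate P V m" "u \<in> V"
  shows "\<exists>P' xs. path_system M U P' \<and> ends_mate P' V m \<and> xs \<in> P' \<and> last xs = u \<and> hd xs = m u
    \<and> (\<forall>ys\<in>P'. hd ys \<noteq> u \<longrightarrow> last ys \<noteq> u \<longrightarrow> ys \<in> P)
    \<and> (\<forall>ys\<in>P. hd ys \<noteq> u \<longrightarrow> last ys \<noteq> u \<longrightarrow> ys \<in> P')"
proof -
  obtain xs where xs: "xs \<in> P" "u = hd xs \<or> u = last xs"
    using assms by (auto simp: ends_mate_def)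
  have ne: "xs \<noteq> []" using assms(1) xs by (auto simp: path_system_def)
  show ?thesis
  proof (cases "u = last xs")
    case True
    then show ?thesis using assms xs by (intro exI[of _ P] exI[of _ xs]) (auto simp: ends_mate_def)
  next
    case False
    then have u: "u = hd xs" using xs by auto
    let ?P = "insert (rev xs) (P - {xs})"
    have other: "set ys \<inter> set xs = {}" if "ys \<in> P" "ys \<noteq> xs" for ys
      using assms(1) xs that by (auto simp: path_system_def)
    have "path_system M U ?P"
      unfolding path_system_def
    proof (intro conjI ballI impI)
      fix ys assume "ys \<in> ?P"
      then show "ys \<noteq> []" "distinct ys" "walk M ys"
        using assms(1) xs by (auto simp: path_system_def)
    next
      fix ys zs assume "ys \<in> ?P" "zs \<in> ?P" "ys \<noteq> zs"
      then show "set ys \<inter> set zs = {}"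
        using other assms(1) by (auto simp: path_system_def) blast+
    next
      show "(\<Union>xs\<in>?P. set xs) = U" using assms(1) xs by (auto simp: path_system_def)
    qed
    moreover have "ends_mate ?P V m"
      using assms(2) xs ne by (auto simp: ends_mate_def hd_rev last_rev)
    ultimately show ?thesis using u xs ne assms(2)
      by (intro exI[of _ ?P] exI[of _ "rev xs"]) (auto simp: ends_mate_def hd_rev last_rev)
  qed
qed

lemma ends_unique:
  assumes "path_system M U P" "xs \<in> P" "ys \<in> P" "x \<in> {hd xs, last xs}" "x \<in> {hd ys, last ys}"
  shows "xs = ys"
proof -
  have "xs \<noteq> []" "ys \<noteq> []" using assms by (auto simp: path_system_def)
  then have "x \<in> set xs \<inter> set ys" using assms(4,5) by (metis IntI hd_in_set insertE last_in_set singletonD)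
  then show ?thesis using assms(1-3) unfolding path_system_def by blast
qed

text \<open>One formula covers all cases: \<open>u\<close> becomes an inner vertex unless its path
  is a single vertex; then \<open>m u = u\<close> and it stays an end, whence the correction by
  \<open>{m u, m v}\<close>. The condition \<open>v \<noteq> m u\<close> excludes closing a path to
  a cycle.\<close>

lemma realizes_link:
  assumes "realizes M U V m" "u \<in> V" "v \<in> V" "v \<noteq> u" "v \<noteq> m u"
  shows "realizes (insert {u, v} M) U (V - ({u, v} - {m u, m v})) (m(m u := m v, m v := m u))"
proof -
  obtain P where "path_system M U P" "ends_mate P V m"
    using assms(1) by (auto simp: realizes_def)
  from orient[OF this assms(2)] obtain P1 xs where P1: "path_system M U P1" "ends_mate P1 V m"
    "xs \<in> P1" "last xs = u" "hd xs = m u" by blast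
  from orient[OF P1(1,2) assms(3)] obtain P2 ys where P2: "path_system M U P2" "ends_mate P2 V m"
    "ys \<in> P2" "last ys = v" "hd ys = m v"
    "\<forall>ys\<in>P1. hd ys \<noteq> v \<longrightarrow> last ys \<noteq> v \<longrightarrow> ys \<in> P2" by blast
  have xs: "xs \<in> P2" using P2(6) P1(3-5) assms(4,5) by auto
  have ne: "xs \<noteq> ys" using P1(4) P2(4) assms(4) by auto
  have nil: "xs \<noteq> []" "ys \<noteq> []" using P2(1,3) xs by (auto simp: path_system_def)
  define zs where "zs = xs @ rev ys"
  define P3 where "P3 = insert zs (P2 - {xs, ys})"
  have disj: "set ws \<inter> set ws' = {}" if "ws \<in> P2" "ws' \<in> P2" "ws \<noteq> ws'" for ws ws'
    using P2(1) that by (auto simp: path_system_def)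
  have zs: "hd zs = m u" "last zs = m v"
    using nil P1(5) P2(5) by (auto simp: zs_def last_rev)
  have ps: "path_system (insert {u, v} M) U P3"
    unfolding path_system_def
  proof (intro conjI ballI impI)
    have "walk M xs" "walk M ys" "distinct xs" "distinct ys"
      using P2(1,3) xs by (auto simp: path_system_def)
    then have "walk (insert {u,v} M) zs" "distinct zs"
      using disj[OF xs P2(3) ne] P1(4) P2(4) nil
      by (auto simp: zs_def walk_append hd_rev elim: walk_mono)
    moreover fix ws assume "ws \<in> P3"
    ultimately show "ws \<noteq> []" "distinct ws" "walk (insert {u,v} M) ws"
      using P2(1) nil by (auto simp: path_system_def P3_def zs_def elim: walk_mono)
  next
    fix ws ws' assume "ws \<in> P3" "ws' \<in> P3" "ws \<noteq> ws'"
    then show "set ws \<inter> set ws' = {}"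
      using disj xs P2(3) by (auto simp: P3_def zs_def) blast+
  next
    show "(\<Union>ws\<in>P3. set ws) = U" using P2(1,3) xs by (auto simp: path_system_def P3_def zs_def)
  qed
  have hl: "ws \<in> P2 \<Longrightarrow> ws' \<in> P2 \<Longrightarrow> ws \<noteq> ws' \<Longrightarrow> {hd ws, last ws} \<inter> {hd ws', last ws'} = {}" for ws ws'
    using ends_unique[OF P2(1)] by blast
  have oth: "{hd ws, last ws} \<inter> {u, v, m u, m v} = {}" if "ws \<in> P2 - {xs, ys}" for ws
    using hl[of ws xs] hl[of ws ys] that xs P2(3-5) P1(4,5) by auto
  have xy: "{u, m u} \<inter> {v, m v} = {}"
    using hl[OF xs P2(3) ne] P2(4,5) P1(4,5) by auto
  have V: "V = {u, m u} \<union> {v, m v} \<union> (\<Union>ws\<in>P2 - {xs, ys}. {hd ws, last ws})"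
    using P2(2-5) xs P1(4,5) by (auto simp: ends_mate_def)
  have "ends_mate P3 (V - ({u, v} - {m u, m v})) (m(m u := m v, m v := m u))"
    unfolding ends_mate_def
  proof (intro conjI ballI)
    show "V - ({u, v} - {m u, m v}) = (\<Union>xs\<in>P3. {hd xs, last xs})"
      using oth by (subst V) (auto simp: P3_def zs)
    fix ws assume ws: "ws \<in> P3"
    have *: "(m(m u := m v, m v := m u)) (hd ws) = last ws \<and> (m(m u := m v, m v := m u)) (last ws) = hd ws"
    proof (cases "ws = zs")
      case True
      then show ?thesis using zs xy by auto
    next
      case False
      then have "ws \<in> P2 - {xs, ys}" using ws by (auto simp: P3_def)
      then show ?thesis using oth[of ws] P2(2) by (auto simp: ends_mate_def)
    qed
    then show "(m(m u := m v, m v := m u)) (hd ws) = last ws"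
      "(m(m u := m v, m v := m u)) (last ws) = hd ws" by auto
  qed
  then show ?thesis using ps by (auto simp: realizes_def)
qed

lemma realizes_single:
  assumes "realizes M U {u, v} m" "m u = v" "m v = u"
  shows "\<exists>xs. xs \<noteq> [] \<and> distinct xs \<and> walk M xs \<and> set xs = U \<and> hd xs = u \<and> last xs = v"
proof -
  obtain P where P: "path_system M U P" "ends_mate P {u, v} m"
    using assms(1) by (auto simp: realizes_def)
  obtain P' xs where P': "path_system M U P'" "ends_mate P' {u, v} m" "xs \<in> P'" "last xs = v" "hd xs = u"
    using orient[OF P, of v] assms by auto
  have "ys = xs" if "ys \<in> P'" for ys
  proof (rule ends_unique[OF P'(1) that P'(3), of "hd ys"])
    have "hd ys \<in> {u, v}" using P'(2) that by (auto simp: ends_mate_def)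
    then show "hd ys \<in> {hd xs, last xs}" using P' by auto
  qed auto
  then have "P' = {xs}" using P'(3) by blast
  then show ?thesis using P'(1,4,5) by (intro exI[of _ xs]) (simp add: path_system_def)
qed

lemma realizes_two:
  assumes "realizes M U {u, u', v, v'} m" "m u = u'" "m u' = u" "m v = v'" "m v' = v" "v \<noteq> u" "v \<noteq> u'"
  shows "\<exists>xs ys. xs \<noteq> [] \<and> ys \<noteq> [] \<and> distinct (xs @ ys) \<and> walk M xs \<and> walk M ys \<and> set xs \<union> set ys = U
    \<and> hd xs = u \<and> last xs = u' \<and> hd ys = v \<and> last ys = v'"
proof -
  obtain P where P: "path_system M U P" "ends_mate P {u, u', v, v'} m"
    using assms(1) by (auto simp: realizes_def)
  obtain P1 xs where P1: "path_system M U P1" "ends_mate P1 {u, u', v, v'} m" "xs \<in> P1" "last xs = u'" "hd xs = u"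
    using orient[OF P, of u'] assms by auto
  obtain P2 ys where P2: "path_system M U P2" "ends_mate P2 {u, u', v, v'} m" "ys \<in> P2" "last ys = v'" "hd ys = v"
    "\<forall>ys\<in>P1. hd ys \<noteq> v' \<longrightarrow> last ys \<noteq> v' \<longrightarrow> ys \<in> P2"
    using orient[OF P1(1,2), of v'] assms by auto
  have "u \<noteq> v'" "u' \<noteq> v'" using assms by metis+
  then have xs: "xs \<in> P2" using P2(6) P1 by auto
  have ne: "xs \<noteq> ys" using P1(5) P2(5) assms(6) by auto
  have "ws \<in> {xs, ys}" if "ws \<in> P2" for ws
  proof -
    have "hd ws \<in> {u, u', v, v'}" using P2(2) that by (auto simp: ends_mate_def)
    then have "hd ws \<in> {hd xs, last xs} \<or> hd ws \<in> {hd ys, last ys}" using P1 P2 by auto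
    then show ?thesis
      using ends_unique[OF P2(1) that xs, of "hd ws"] ends_unique[OF P2(1) that P2(3), of "hd ws"] by auto
  qed
  then have "P2 = {xs, ys}" using P2(3) xs by auto
  then show ?thesis using P2(1,4,5) P1(4,5) ne
    by (intro exI[of _ xs] exI[of _ ys]) (auto simp: path_system_def)
qed

section \<open>Positions\<close>

text \<open>
  In a position, the paths in \<open>M\<close> cover \<open>U\<close>; \<open>I\<close> is the set of one-vertex paths, \<open>E\<close> the set of
  ends of the other paths, and \<open>m\<close> maps an end to the other end of its path. The edges \<open>M0\<close> form
  a cycle on the vertices outside \<open>U\<close>, if there are any. The harmful edges \<open>hh\<close> of Breaker include
  those joining the two ends of a path only if \<open>fl\<close> is set.
\<close>

locale phase =
  fixes n a :: nat and fl :: bool and U :: "nat set" and M0 :: "nat set set"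
begin

abbreviation "X \<equiv> complete_edges n"
abbreviation "W \<equiv> wins X (hamilton_cycles n) a"
abbreviation "MW \<equiv> mwin X (hamilton_cycles n) a"

definition st :: "nat set set \<Rightarrow> nat set set \<Rightarrow> nat set \<Rightarrow> nat set \<Rightarrow> (nat \<Rightarrow> nat) \<Rightarrow> bool" where
  "st M B I E m \<longleftrightarrow> realizes M U (I \<union> E) m \<and> M0 \<subseteq> M \<and> M \<inter> B = {} \<and> B \<subseteq> X \<and> U \<subseteq> {..<n} \<and> I \<union> E \<subseteq> U \<and>
     (\<forall>x\<in>I. m x = x) \<and> (\<forall>x\<in>E. m x \<in> E \<and> m x \<noteq> x \<and> m (m x) = x)"

definition hh :: "nat set set \<Rightarrow> nat set \<Rightarrow> nat set \<Rightarrow> (nat \<Rightarrow> nat) \<Rightarrow> nat set set" where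
  "hh B I E m = {h \<in> B. h \<subseteq> I \<union> E \<and> (fl \<or> (\<forall>u\<in>I \<union> E. h \<noteq> {u, m u}))}"

lemma finite_X [simp]: "finite X"
  unfolding complete_edges_def by (rule finite_subset[of _ "Pow {..<n}"]) auto

lemma edge_in_X: "u < n \<Longrightarrow> v < n \<Longrightarrow> u \<noteq> v \<Longrightarrow> {u, v} \<in> X"
  by (auto simp: complete_edges_def)

lemma X_edge: "h \<in> X \<Longrightarrow> \<exists>u v. h = {u, v} \<and> u \<noteq> v \<and> u < n \<and> v < n"
  by (auto simp: complete_edges_def card_2_iff)

context
  fixes M B I E m
  assumes st: "st M B I E m"
begin

lemma st_finite: "finite I" "finite E" "finite B" "finite (hh B I E m)" "finite (I \<union> E)"
proof -
  have "I \<union> E \<subseteq> {..<n}" using st by (auto simp: st_def)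
  then have *: "finite (I \<union> E)" by (rule finite_subset) simp
  show "finite B" using st finite_X finite_subset unfolding st_def by metis
  then show "finite (hh B I E m)" by (auto simp: hh_def)
  show "finite I" "finite E" "finite (I \<union> E)" using * by auto
qed

lemma st_disj: "I \<inter> E = {}" using st by (fastforce simp: st_def)

lemma st_I: "x \<in> I \<Longrightarrow> m x = x" and st_E: "x \<in> E \<Longrightarrow> m x \<in> E" "x \<in> E \<Longrightarrow> m x \<noteq> x"
  "x \<in> E \<Longrightarrow> m (m x) = x" using st by (auto simp: st_def)

lemma st_mm: "x \<in> I \<union> E \<Longrightarrow> m (m x) = x" using st by (auto simp: st_def)

lemma st_lt: "x \<in> I \<union> E \<Longrightarrow> x < n" using st by (auto simp: st_def)

lemma hh_edge: "h \<in> hh B I E m \<Longrightarrow> \<exists>u v. h = {u, v} \<and> u \<noteq> v \<and> u \<in> I \<union> E \<and> v \<in> I \<union> E"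
proof -
  assume h: "h \<in> hh B I E m"
  then have "h \<in> X" "h \<subseteq> I \<union> E" using st by (auto simp: hh_def st_def)
  then obtain u v where "h = {u, v}" "u \<noteq> v" using X_edge by metis
  then show ?thesis using \<open>h \<subseteq> I \<union> E\<close> by (intro exI[of _ u] exI[of _ v]) simp
qed

lemma hh_cross: "\<not> fl \<Longrightarrow> {u, v} \<in> hh B I E m \<Longrightarrow> v \<noteq> m u \<and> u \<noteq> m v"
  unfolding hh_def by (simp add: insert_commute) blast

lemma free_edge:
  assumes "u \<in> I \<union> E" "v \<in> I \<union> E" "v \<noteq> m u" "{u, v} \<notin> hh B I E m"
  shows "{u, v} \<notin> B"
proof
  assume "{u, v} \<in> B"
  then obtain w where "w \<in> I \<union> E" "{u, v} = {w, m w}"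
    using assms by (auto simp: hh_def)
  then show False using assms(3) st_mm by (auto simp: doubleton_eq_iff)
qed

lemma link_MW:
  assumes "u \<in> I \<union> E" "v \<in> I \<union> E" "u \<noteq> v" "v \<noteq> m u" "{u, v} \<notin> hh B I E m"
    "MW \<rho> t (insert {u, v} M) B"
  shows "MW (Suc \<rho>) t M B"
  using assms free_edge edge_in_X st_lt by (intro mwin_insert[OF assms(6)]) auto

text \<open>Both vertices stay ends, and the only pair whose status changes is
  \<open>{u, v}\<close>, which Breaker does not own. So there is one more nontrivial path at no
  price.\<close>

lemma st_ii:
  assumes "u \<in> I" "v \<in> I" "u \<noteq> v" "{u, v} \<notin> hh B I E m"
  shows "st (insert {u, v} M) B (I - {u, v}) (E \<union> {u, v}) (m(u := v, v := u))"
    and "hh B (I - {u, v}) (E \<union> {u, v}) (m(u := v, v := u)) \<subseteq> hh B I E m"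
    and "hh B I E m \<subseteq> hh B (I - {u, v}) (E \<union> {u, v}) (m(u := v, v := u))"
proof -
  have m: "m u = u" "m v = v" using assms st_I by auto
  have nB: "{u, v} \<notin> B" using assms m by (intro free_edge) auto
  have V: "I - {u, v} \<union> (E \<union> {u, v}) = I \<union> E" using assms by auto
  have "realizes (insert {u, v} M) U (I \<union> E) (m(u := v, v := u))"
    using realizes_link[of M U "I \<union> E" m u v] st assms m by (auto simp: st_def fun_upd_twist)
  then show "st (insert {u, v} M) B (I - {u, v}) (E \<union> {u, v}) (m(u := v, v := u))"
    using st assms m nB st_disj unfolding st_def V by auto
  show "hh B (I - {u, v}) (E \<union> {u, v}) (m(u := v, v := u)) \<subseteq> hh B I E m"
  proof
    fix h assume h: "h \<in> hh B (I - {u, v}) (E \<union> {u, v}) (m(u := v, v := u))"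
    then have 1: "h \<in> B" "h \<subseteq> I \<union> E" "\<not> fl \<Longrightarrow> w \<in> I \<union> E \<Longrightarrow> h \<noteq> {w, (m(u := v, v := u)) w}" for w
      unfolding hh_def V by auto
    have card2: "card h = 2" using 1(1) st by (auto simp: st_def complete_edges_def)
    have "h \<noteq> {w, m w}" if "\<not> fl" "w \<in> I \<union> E" for w
    proof (cases "w = u \<or> w = v")
      case True
      then show ?thesis using m card2 by auto
    next
      case False
      then show ?thesis using 1(3)[OF that(1), of w] that(2) by auto
    qed
    then show "h \<in> hh B I E m" using 1(1,2) by (auto simp: hh_def)
  qed
  show "hh B I E m \<subseteq> hh B (I - {u, v}) (E \<union> {u, v}) (m(u := v, v := u))"
  proof
    fix h assume h: "h \<in> hh B I E m"
    then have 1: "h \<in> B" "h \<subseteq> I \<union> E" "\<not> fl \<Longrightarrow> w \<in> I \<union> E \<Longrightarrow> h \<noteq> {w, m w}" for w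
      unfolding hh_def by auto
    have "h \<noteq> {w, (m(u := v, v := u)) w}" if "\<not> fl" "w \<in> I \<union> E" for w
    proof (cases "w = u \<or> w = v")
      case True
      then show ?thesis using 1(1) nB assms(3) by (auto simp: insert_commute)
    next
      case False
      then show ?thesis using 1(3)[OF that] by auto
    qed
    then show "h \<in> hh B (I - {u, v}) (E \<union> {u, v}) (m(u := v, v := u))"
      unfolding hh_def V using 1(1,2) by blast
  qed
qed

text \<open>\<open>u\<close> becomes an inner vertex and its edges become harmless; \<open>v\<close>
  replaces it as the mate of \<open>m u\<close>, so without \<open>fl\<close> an edge
  \<open>{v, m u}\<close> is neutralised as well. That nothing else is lost is needed where harmful
  edges at a new end are wanted.\<close>

lemma st_ei:
  assumes "u \<in> E" "v \<in> I" "{u, v} \<notin> hh B I E m"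
  shows "st (insert {u, v} M) B (I - {v}) (insert v (E - {u})) (m(m u := v, v := m u))"
    and "hh B (I - {v}) (insert v (E - {u})) (m(m u := v, v := m u)) \<subseteq>
       {h \<in> hh B I E m. u \<notin> h \<and> (fl \<or> h \<noteq> {v, m u})}"
    and "h \<in> hh B I E m \<Longrightarrow> u \<notin> h \<Longrightarrow> h \<noteq> {v, m u} \<Longrightarrow>
       h \<in> hh B (I - {v}) (insert v (E - {u})) (m(m u := v, v := m u))"
proof -
  have m: "m v = v" "m u \<in> E" "m u \<noteq> u" "m (m u) = u" "u \<noteq> v" "m u \<noteq> v" "u \<notin> I" "v \<notin> E" "m u \<notin> I"
    using assms st_I st_E st_disj by auto
  have nB: "{u, v} \<notin> B" using assms m by (intro free_edge) auto
  have V: "I - {v} \<union> (insert v (E - {u})) = I \<union> E - {u}" using assms m by auto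
  have "I \<union> E - ({u, v} - {m u, m v}) = I \<union> E - {u}" using m by auto
  then have r: "realizes (insert {u, v} M) U (I \<union> E - {u}) (m(m u := v, v := m u))"
    using realizes_link[of M U "I \<union> E" m u v] st assms m by (auto simp: st_def)
  have e: "x \<in> E \<Longrightarrow> x \<noteq> u \<Longrightarrow> x \<noteq> m u \<Longrightarrow> m x \<noteq> u \<and> m x \<noteq> m u" for x
    using st_E m by metis
  show "st (insert {u, v} M) B (I - {v}) (insert v (E - {u})) (m(m u := v, v := m u))"
    using st r nB m e st_E st_I unfolding st_def V by auto
  show "hh B (I - {v}) (insert v (E - {u})) (m(m u := v, v := m u)) \<subseteq>
       {h \<in> hh B I E m. u \<notin> h \<and> (fl \<or> h \<noteq> {v, m u})}"
  proof
    fix h assume h: "h \<in> hh B (I - {v}) (insert v (E - {u})) (m(m u := v, v := m u))"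
    then have 1: "h \<in> B" "h \<subseteq> I \<union> E - {u}" "\<not> fl \<Longrightarrow> w \<in> I \<union> E - {u} \<Longrightarrow> h \<noteq> {w, (m(m u := v, v := m u)) w}" for w
      unfolding hh_def V by auto
    have card2: "card h = 2" using 1(1) st by (auto simp: st_def complete_edges_def)
    have "h \<noteq> {w, m w}" if "\<not> fl" "w \<in> I \<union> E" for w
    proof (cases "w = u \<or> w = m u \<or> w = v")
      case True
      then show ?thesis using 1(2) m card2 by auto
    next
      case False
      then show ?thesis using 1(3)[OF that(1), of w] that(2) by auto
    qed
    moreover have "h \<noteq> {v, m u}" if "\<not> fl" using 1(3)[OF that, of v] assms m by auto
    ultimately show "h \<in> {h \<in> hh B I E m. u \<notin> h \<and> (fl \<or> h \<noteq> {v, m u})}" using 1(1,2)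
      by (auto simp: hh_def)
  qed
  assume h: "h \<in> hh B I E m" "u \<notin> h" "h \<noteq> {v, m u}"
  have "h \<noteq> {w, (m(m u := v, v := m u)) w}" if "\<not> fl" "w \<in> I \<union> E - {u}" for w
    using h that unfolding hh_def by (auto simp: insert_commute)
  then show "h \<in> hh B (I - {v}) (insert v (E - {u})) (m(m u := v, v := m u))"
    using h unfolding hh_def V by auto
qed

lemma st_ee:
  assumes "u \<in> E" "v \<in> E" "u \<noteq> v" "v \<noteq> m u" "{u, v} \<notin> hh B I E m"
  shows "st (insert {u, v} M) B I (E - {u, v}) (m(m u := m v, m v := m u))"
    and "hh B I (E - {u, v}) (m(m u := m v, m v := m u)) \<subseteq> {h \<in> hh B I E m. u \<notin> h \<and> v \<notin> h}"
proof -
  have m: "m v \<in> E" "m v \<noteq> v" "m (m v) = v" "m u \<in> E" "m u \<noteq> u" "m (m u) = u" "m u \<noteq> m v" "m v \<noteq> u"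
    using assms st_E by metis+
  have nB: "{u, v} \<notin> B" using assms m by (intro free_edge) auto
  have I: "u \<notin> I" "v \<notin> I" "m u \<notin> I" "m v \<notin> I" using assms m st_disj by auto
  have V: "I \<union> (E - {u, v}) = I \<union> E - {u, v}" using I by auto
  have "I \<union> E - ({u, v} - {m u, m v}) = I \<union> E - {u, v}" using m assms by auto
  then have r: "realizes (insert {u, v} M) U (I \<union> E - {u, v}) (m(m u := m v, m v := m u))"
    using realizes_link[of M U "I \<union> E" m u v] st assms m by (auto simp: st_def)
  have e: "x \<in> E \<Longrightarrow> x \<notin> {u, v, m u, m v} \<Longrightarrow> m x \<notin> {u, v, m u, m v}" for x
    using st_E m by (metis insert_iff empty_iff)
  have e': "x \<in> I \<Longrightarrow> x \<notin> {u, v, m u, m v}" for x using I by auto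
  show "st (insert {u, v} M) B I (E - {u, v}) (m(m u := m v, m v := m u))"
    using st r nB m e e' st_E st_I assms(4) unfolding st_def V by auto
  show "hh B I (E - {u, v}) (m(m u := m v, m v := m u)) \<subseteq> {h \<in> hh B I E m. u \<notin> h \<and> v \<notin> h}"
  proof
    fix h assume h: "h \<in> hh B I (E - {u, v}) (m(m u := m v, m v := m u))"
    then have 1: "h \<in> B" "h \<subseteq> I \<union> E - {u, v}" "\<not> fl \<Longrightarrow> w \<in> I \<union> E - {u, v} \<Longrightarrow> h \<noteq> {w, (m(m u := m v, m v := m u)) w}" for w
      unfolding hh_def V by auto
    have "h \<noteq> {w, m w}" if "\<not> fl" "w \<in> I \<union> E" for w
    proof (cases "w \<in> {u, v, m u, m v}")
      case True
      then show ?thesis using 1(2) m by auto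
    next
      case False
      then show ?thesis using 1(3)[OF that(1), of w] that(2) by auto
    qed
    then show "h \<in> {h \<in> hh B I E m. u \<notin> h \<and> v \<notin> h}" using 1(1,2) by (auto simp: hh_def)
  qed
qed

lemma st_brk:
  assumes "b \<subseteq> X - (M \<union> B)"
  shows "st M (B \<union> b) I E m"
    and "hh B I E m \<subseteq> hh (B \<union> b) I E m" "hh (B \<union> b) I E m \<subseteq> hh B I E m \<union> b"
    and "card (hh (B \<union> b) I E m) \<le> card (hh B I E m) + card b"
proof -
  show "st M (B \<union> b) I E m" using st assms by (auto simp: st_def)
  show "hh B I E m \<subseteq> hh (B \<union> b) I E m" by (auto simp: hh_def)
  show *: "hh (B \<union> b) I E m \<subseteq> hh B I E m \<union> b" by (auto simp: hh_def)
  have "finite b" using assms finite_X by (metis finite_Diff finite_subset)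
  then have "card (hh (B \<union> b) I E m) \<le> card (hh B I E m \<union> b)"
    using * st_finite by (intro card_mono) auto
  then show "card (hh (B \<union> b) I E m) \<le> card (hh B I E m) + card b"
    using card_Un_le le_trans by blast
qed

end

end

section \<open>Merging the paths\<close>

definition deg :: "'v set set \<Rightarrow> 'v \<Rightarrow> nat" where
  "deg H u = card {h \<in> H. u \<in> h}"

lemma deg_le_card: "finite H \<Longrightarrow> deg H u \<le> card H"
  unfolding deg_def by (rule card_mono) auto

lemma deg_mono: "finite H' \<Longrightarrow> H \<subseteq> H' \<Longrightarrow> deg H u \<le> deg H' u"
  unfolding deg_def by (rule card_mono) auto

lemma deg_pos_iff: "finite H \<Longrightarrow> 0 < deg H u \<longleftrightarrow> u \<in> \<Union>H"
  unfolding deg_def by (auto simp: card_gt_0_iff)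

lemma card_remove_vertex: "finite H \<Longrightarrow> card {h \<in> H. u \<notin> h} + deg H u = card H"
  unfolding deg_def
  by (subst card_Un_disjoint[symmetric]) (auto intro: arg_cong[of _ _ card])

text \<open>An edge counted at both vertices would be \<open>{u, v}\<close>, so the degrees add up
  without overlap.\<close>

lemma card_remove_two:
  assumes "finite H" "\<And>h. h \<in> H \<Longrightarrow> card h = 2" "{u, v} \<notin> H" "u \<noteq> v"
  shows "card {h \<in> H. u \<notin> h \<and> v \<notin> h} + deg H u + deg H v = card H"
proof -
  have "\<not> (u \<in> h \<and> v \<in> h)" if "h \<in> H" for h
    using assms(2)[OF that] assms(3,4) that by (metis card_2_iff doubleton_eq_iff insertE singletonD)
  then have "deg H v = deg {h \<in> H. u \<notin> h} v" unfolding deg_def by (intro arg_cong[of _ _ card]) auto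
  moreover have "{h \<in> {h \<in> H. u \<notin> h}. v \<notin> h} = {h \<in> H. u \<notin> h \<and> v \<notin> h}" by auto
  ultimately show ?thesis
    using card_remove_vertex[OF assms(1), of u] card_remove_vertex[of "{h \<in> H. u \<notin> h}" v] assms(1) by simp
qed

lemma deg_le_1_unique:
  assumes "finite H" "deg H u \<le> 1" "h \<in> H" "u \<in> h" "h' \<in> H" "u \<in> h'"
  shows "h = h'"
proof (rule ccontr)
  assume "h \<noteq> h'"
  then have "card {h, h'} = 2" by simp
  moreover have "card {h, h'} \<le> deg H u"
    unfolding deg_def using assms by (intro card_mono) auto
  ultimately show False using assms(2) by simp
qed

lemma two_le_deg:
  assumes "finite H" "h \<in> H" "h' \<in> H" "h \<noteq> h'" "u \<in> h" "u \<in> h'"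
  shows "2 \<le> deg H u"
proof -
  have "card {h, h'} \<le> deg H u"
    unfolding deg_def using assms by (intro card_mono) auto
  then show ?thesis using assms(4) by simp
qed

lemma exists_free_partner:
  assumes "finite H" "finite S" "card H < card S" "x \<notin> S"
  shows "\<exists>v\<in>S. {x, v} \<notin> H"
proof (rule ccontr)
  assume "\<not> ?thesis"
  then have "(\<lambda>v. {x, v}) ` S \<subseteq> H" by auto
  moreover have "inj_on (\<lambda>v. {x, v}) S" using assms(4) by (auto simp: inj_on_def doubleton_eq_iff)
  ultimately have "card S \<le> card H" using assms(1) card_inj_on_le by blast
  then show False using assms(3) by simp
qed

context phase
begin

lemma hh_card2: "st M B I E m \<Longrightarrow> h \<in> hh B I E m \<Longrightarrow> card h = 2"
  using hh_edge by fastforce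

lemma exists_free_end:
  assumes "st M B I E m" "x \<in> E" "card (hh B I E m) + 2 < card E"
  shows "\<exists>v\<in>E. v \<noteq> x \<and> v \<noteq> m x \<and> {x, v} \<notin> hh B I E m"
proof -
  have "card (E - {x, m x}) = card E - 2"
    using st_E[OF assms(1,2)] assms(2) st_finite(2)[OF assms(1)] by (subst card_Diff_subset) auto
  then show ?thesis
    using exists_free_partner[of "hh B I E m" "E - {x, m x}" x] assms st_finite[OF assms(1)] by force
qed

end

text \<open>
  Maker has \<open>\<rho>\<close> edges left in her current move and \<open>t\<close> further moves. There are \<open>k\<close> nontrivial
  paths, and \<open>a * t + \<rho> = k + card I + s\<close> says how many edges remain beyond those that merge paths.
  She aims at a lead \<open>k + \<rho> - card hh\<close> of at least \<open>\<phi>\<close>. The game is given by \<open>FIN\<close> from the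
  moment when \<open>kf\<close> paths are left; \<open>Q\<close> is an invariant bounding the degrees of Breaker's graph.
\<close>

locale late = phase +
  fixes \<phi> s kf \<rho>f tf :: nat and Q :: "nat \<Rightarrow> nat set set \<Rightarrow> nat set \<Rightarrow> bool"
  assumes Q_mono: "Q t B V \<Longrightarrow> V' \<subseteq> V \<Longrightarrow> Q t B V'"
    and Q_brk: "Q (Suc t) B V \<Longrightarrow> B \<subseteq> X \<Longrightarrow> b \<subseteq> X - B \<Longrightarrow> card b \<le> a \<Longrightarrow> Q t (B \<union> b) V"
    and FIN: "st M B {} E m \<Longrightarrow> card E = 2 * kf \<Longrightarrow> card (hh B {} E m) + \<phi> \<le> kf + \<rho>f \<Longrightarrow>
      Q tf B E \<Longrightarrow> MW \<rho>f tf M B"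
    and arith: "1 \<le> \<rho> \<Longrightarrow> \<rho> \<le> a \<Longrightarrow> a * t + \<rho> = k + s \<Longrightarrow> kf < k \<Longrightarrow>
      \<rho> + 3 \<le> k + \<phi> \<and> \<phi> + 2 \<le> k + \<rho>"
    and fin_consts: "kf + s = a * tf + \<rho>f" "1 \<le> \<rho>f" "\<rho>f \<le> a" "kf \<le> 3" "\<phi> \<le> 3"
begin

text \<open>
  In the second alternative one unit of the lead is missing; any link using the end of degree 3
  recovers it.
\<close>

definition good :: "nat \<Rightarrow> nat \<Rightarrow> nat set set \<Rightarrow> nat set \<Rightarrow> nat set \<Rightarrow> bool" where
  "good \<rho> k H I E \<longleftrightarrow>
     (card H + \<phi> \<le> k + \<rho> \<and> (I = {} \<or> card I + a + 12 \<le> k)) \<or>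
     (card H + \<phi> \<le> k + \<rho> + 1 \<and> (\<exists>x\<in>E. 3 \<le> deg H x) \<and> card I + a + 13 \<le> k)"

text \<open>Every link lowers both sides of the edge count by one: two isolated vertices turn into
  one path, an isolated vertex is absorbed, or two paths become one.\<close>

abbreviation goal :: "nat \<Rightarrow> nat \<Rightarrow> bool" where
  "goal t \<rho> \<equiv> (\<forall>M B I E m k. st M B I E m \<longrightarrow> card E = 2 * k \<longrightarrow> good \<rho> k (hh B I E m) I E \<longrightarrow>
     a * t + \<rho> = k + card I + s \<longrightarrow> kf \<le> k \<longrightarrow> Q t B (I \<union> E) \<longrightarrow> MW \<rho> t M B)"

text \<open>Both \<open>k\<close> and the edges left drop by one, so the lead survives if
  \<open>u\<close> and \<open>v\<close> together meet two harmful edges.\<close>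

lemma goal_ee:
  assumes IH: "goal t r" and st: "st M B I E m" and E: "card E = 2 * k"
    and uv: "u \<in> E" "v \<in> E" "u \<noteq> v" "v \<noteq> m u" "{u, v} \<notin> hh B I E m"
    and tot: "a * t + Suc r = k + card I + s" "kf < k" and Q: "Q t B (I \<union> E)"
    and e: "card (hh B I E m) - (deg (hh B I E m) u + deg (hh B I E m) v) + \<phi> \<le> (k - 1) + r"
    and i: "I = {} \<or> card I + a + 13 \<le> k"
  shows "MW (Suc r) t M B"
proof (rule link_MW[OF st _ _ uv(3-5)])
  let ?E = "E - {u, v}" and ?m = "m(m u := m v, m v := m u)"
  note st' = st_ee[OF st uv]
  have fin: "finite (hh B I E m)" "finite E" using st_finite[OF st] by auto
  have "card (hh B I ?E ?m) \<le> card {h \<in> hh B I E m. u \<notin> h \<and> v \<notin> h}"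
    using st'(2) fin by (intro card_mono) auto
  also have "\<dots> = card (hh B I E m) - (deg (hh B I E m) u + deg (hh B I E m) v)"
    using card_remove_two[OF fin(1) hh_card2[OF st] uv(5,3)] by simp
  finally have "good r (k - 1) (hh B I ?E ?m) I ?E" using e i by (auto simp: good_def)
  moreover have "card ?E = 2 * (k - 1)" using E uv fin by (subst card_Diff_subset) auto
  moreover have "Q t B (I \<union> ?E)" using Q by (rule Q_mono) auto
  ultimately show "MW r t (insert {u, v} M) B" using IH st'(1) tot by auto
qed (use uv in auto)

text \<open>\<open>k\<close> is unchanged, so one harmful edge at \<open>u\<close> pays for the
  link. The other option joins a clean end \<open>u\<close> to an isolated \<open>v\<close> of
  degree at least 3: one unit is lost, but \<open>v\<close> is now an end from which it can be
  recovered.\<close>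

lemma goal_ei:
  assumes IH: "goal t r" and st: "st M B I E m" and E: "card E = 2 * k"
    and uv: "u \<in> E" "v \<in> I" "{u, v} \<notin> hh B I E m"
    and tot: "a * t + Suc r = k + card I + s" "kf \<le> k" and Q: "Q t B (I \<union> E)"
    and good: "card (hh B I E m) - deg (hh B I E m) u + \<phi> \<le> k + r \<or>
      card (hh B I E m) + \<phi> \<le> k + r + 1 \<and> 3 \<le> deg (hh B I E m) v \<and> u \<notin> \<Union>(hh B I E m)"
    and i: "card I + a + 12 \<le> k"
  shows "MW (Suc r) t M B"
proof (rule link_MW[OF st _ _ _ _ uv(3)])
  let ?I = "I - {v}" and ?E = "insert v (E - {u})" and ?m = "m(m u := v, v := m u)"
  let ?H = "hh B I E m" and ?H' = "hh B ?I ?E ?m"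
  note st' = st_ei[OF st uv]
  have fin: "finite ?H" "finite E" "finite I" using st_finite[OF st] by auto
  have vE: "v \<notin> E" "u \<noteq> v" "m u \<noteq> v" using st_disj[OF st] uv st_E[OF st uv(1)] by auto
  then show "u \<noteq> v" "v \<noteq> m u" by auto
  have "card ?H' \<le> card {h \<in> ?H. u \<notin> h}"
    using st'(2) fin by (intro card_mono) auto
  also have "\<dots> = card ?H - deg ?H u"
    using card_remove_vertex[OF fin(1), of u] by simp
  finally have le: "card ?H' \<le> card ?H - deg ?H u" .
  have cI: "card ?I + 1 = card I" using uv fin
    by (metis Suc_eq_plus1 card_Suc_Diff1)
  have "good r k ?H' ?I ?E"
  proof (cases "card ?H - deg ?H u + \<phi> \<le> k + r")
    case True
    then show ?thesis using le i cI by (auto simp: good_def)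
  next
    case False
    then have d: "card ?H + \<phi> \<le> k + r + 1" "3 \<le> deg ?H v" "u \<notin> \<Union>?H" using good by auto
    \<comment> \<open>\<open>{v, m u}\<close> is the only edge at \<open>v\<close> that could be
      neutralised. If it is, the lead is not damaged; otherwise all edges at \<open>v\<close> remain
      harmful.\<close>
    show ?thesis
    proof (cases "\<not> fl \<and> {v, m u} \<in> ?H")
      case True
      then have "card ?H' \<le> card (?H - {{v, m u}})"
        using st'(2) fin by (intro card_mono) auto
      then have "Suc (card ?H') \<le> card ?H" using True fin
        by (metis Suc_le_mono card_Suc_Diff1)
      then show ?thesis using d(1) i cI by (auto simp: good_def)
    next
      case False
      have "h \<in> ?H'" if h: "h \<in> ?H" for h
      proof (cases fl)
        case True
        have "h \<in> B" "h \<subseteq> I \<union> E" "u \<notin> h" using h d(3) by (auto simp: hh_def)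
        then show ?thesis unfolding hh_def using True uv vE by auto
      qed (use False h d(3) st'(3)[OF h] in auto)
      moreover have "finite ?H'" using st_finite(4)[OF st'(1)] .
      ultimately have "3 \<le> deg ?H' v" using d(2) deg_mono[of ?H' ?H v] by (meson le_trans subsetI)
      moreover have "card ?H' \<le> card ?H" using le by simp
      ultimately show ?thesis using d(1) i cI by (auto simp: good_def)
    qed
  qed
  moreover have "card ?E = 2 * k" using E uv(1) vE fin by (metis (no_types, lifting) Diff_iff card_Suc_Diff1 card_insert_disjoint finite_Diff)
  moreover have "Q t B (?I \<union> ?E)" using Q by (rule Q_mono) (use uv in auto)
  moreover have "a * t + r = k + card ?I + s" using tot cI by simp
  ultimately show "MW r t (insert {u, v} M) B" using IH st'(1) tot(2) by blast
qed (use uv in auto)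

lemma goal_ii:
  assumes IH: "goal t r" and st: "st M B I E m" and E: "card E = 2 * k"
    and uv: "u \<in> I" "v \<in> I" "u \<noteq> v" "{u, v} \<notin> hh B I E m"
    and tot: "a * t + Suc r = k + card I + s" "kf \<le> k" and Q: "Q t B (I \<union> E)"
    and e: "card (hh B I E m) + \<phi> \<le> k + Suc r"
    and i: "card I + a + 12 \<le> k"
  shows "MW (Suc r) t M B"
proof (rule link_MW[OF st _ _ uv(3) _ uv(4)])
  let ?I = "I - {u, v}" and ?E = "E \<union> {u, v}" and ?m = "m(u := v, v := u)"
  note st' = st_ii[OF st uv]
  have fin: "finite (hh B I E m)" "finite E" "finite I" using st_finite[OF st] by auto
  show "v \<noteq> m u" using st_I[OF st uv(1)] uv(3) by simp
  have "card (hh B ?I ?E ?m) \<le> card (hh B I E m)"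
    using st'(2) fin by (intro card_mono) auto
  moreover have "card {u, v} \<le> card I" using uv fin by (intro card_mono) auto
  then have cI: "card ?I + 2 = card I" using uv fin by (subst card_Diff_subset) auto
  ultimately have "good r (Suc k) (hh B ?I ?E ?m) ?I ?E" using e i by (auto simp: good_def)
  moreover have "card ?E = 2 * Suc k" using E uv fin st_disj[OF st] by (subst card_Un_disjoint) auto
  moreover have "Q t B (?I \<union> ?E)" using Q by (rule Q_mono) (use uv in auto)
  moreover have "a * t + r = Suc k + card ?I + s" using tot cI by simp
  ultimately show "MW r t (insert {u, v} M) B" using IH st'(1) tot(2) by (metis le_SucI)
qed (use uv in auto)

lemma goal_isolated:
  assumes IH: "goal t r" and st: "st M B I E m" and E: "card E = 2 * k"
    and tot: "a * t + Suc r = k + card I + s" "kf \<le> k" "Suc r \<le> a" and Q: "Q t B (I \<union> E)"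
    and e: "card (hh B I E m) + \<phi> \<le> k + Suc r"
    and i: "card I + a + 12 \<le> k" and "I \<noteq> {}"
  shows "MW (Suc r) t M B"
proof -
  let ?H = "hh B I E m"
  have fin: "finite ?H" "finite E" "finite I" using st_finite[OF st] by auto
  consider (A) u v where "u \<in> I" "v \<in> I" "u \<noteq> v" "{u, v} \<notin> ?H"
    | (B) x u where "x \<in> I" "u \<in> E" "u \<in> \<Union>?H" "{u, x} \<notin> ?H"
    | (C) "\<And>u v. u \<in> I \<Longrightarrow> v \<in> I \<Longrightarrow> u \<noteq> v \<Longrightarrow> {u, v} \<in> ?H"
          "\<And>x u. x \<in> I \<Longrightarrow> u \<in> E \<Longrightarrow> u \<in> \<Union>?H \<Longrightarrow> {u, x} \<in> ?H" by blast
  then show ?thesis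
  proof cases
    case A
    then show ?thesis using goal_ii[OF IH st E A tot(1,2) Q e i] by simp
  next
    case B
    then have "0 < deg ?H u" using deg_pos_iff[OF fin(1), of u] by simp
    moreover have "deg ?H u \<le> card ?H" by (rule deg_le_card[OF fin(1)])
    ultimately have "card ?H - deg ?H u + \<phi> \<le> k + r" using e by linarith
    then show ?thesis by (intro goal_ei[OF IH st E B(2,1,4) tot(1,2) Q _ i]) auto
  next
    \<comment> \<open>Breaker owns every pair of isolated vertices, and every pair of an isolated
      vertex and an end that meets a harmful edge. So all vertices on harmful edges are
      \<open>x\<close> or neighbours of \<open>x\<close>; they are fewer than the ends, and some end
      \<open>u\<close> is clean.\<close>
    case C
    obtain x where x: "x \<in> I" using \<open>I \<noteq> {}\<close> by blast
    let ?D = "\<Union>?H - {x}"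
    have D: "{x, y} \<in> ?H" if "y \<in> ?D" for y
    proof -
      have "y \<in> I \<union> E" using that by (auto simp: hh_def)
      moreover have "y \<in> \<Union>?H" "y \<noteq> x" using that by auto
      ultimately show ?thesis using C(1)[OF x, of y] C(2)[OF x, of y] by (metis UnE insert_commute)
    qed
    have sub: "(\<lambda>y. {x, y}) ` ?D \<subseteq> {h \<in> ?H. x \<in> h}" using D by auto
    have inj: "inj_on (\<lambda>y. {x, y}) ?D" by (auto simp: inj_on_def doubleton_eq_iff)
    have cD: "card ?D \<le> deg ?H x" unfolding deg_def
      by (rule card_inj_on_le[OF inj sub]) (use fin in simp)
    have finD: "finite ?D" using inj_on_finite[OF inj sub] fin by simp
    have "card ?D < card E" using cD deg_le_card[OF fin(1), of x] e E i tot(3) by linarith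
    then obtain u where u: "u \<in> E" "u \<notin> ?D" using finD fin by (meson card_mono linorder_not_le subsetI)
    have ux: "u \<noteq> x" using u x st_disj[OF st] by auto
    then have uH: "u \<notin> \<Union>?H" using u by auto
    then have nux: "{u, x} \<notin> ?H" by blast
    show ?thesis
    \<comment> \<open>If \<open>x\<close> has degree at least 3, it becomes an end from which the
      lost unit is recovered. Otherwise the harmful edges lie on at most three vertices, so there
      are at most three, and \<open>k\<close> is large enough without any repayment.\<close>
    proof (cases "3 \<le> deg ?H x")
      case True
      then show ?thesis using uH e by (intro goal_ei[OF IH st E u(1) x nux tot(1,2) Q _ i]) auto
    next
      case False
      then have c3: "card (insert x ?D) \<le> 3" using cD card_insert_le_m1[of 3 ?D x] by simp
      have "?H \<subseteq> {h. h \<subseteq> insert x ?D \<and> card h = 2}" using hh_card2[OF st] by auto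
      moreover have "finite {h. h \<subseteq> insert x ?D \<and> card h = 2}"
        by (rule finite_subset[of _ "Pow (insert x ?D)"]) (use finD in auto)
      ultimately have "card ?H \<le> card {h. h \<subseteq> insert x ?D \<and> card h = 2}" by (intro card_mono)
      also have "\<dots> = card (insert x ?D) choose 2" by (rule n_subsets) (use finD in simp)
      also have "\<dots> \<le> 3 choose 2" using c3 by (rule binomial_right_mono)
      finally have "card ?H \<le> 3" by (simp add: choose_two)
      then have "card ?H - deg ?H u + \<phi> \<le> k + r" using i fin_consts(5) by linarith
      then show ?thesis by (intro goal_ei[OF IH st E u(1) x nux tot(1,2) Q _ i]) auto
    qed
  qed
qed

lemma goal_paths:
  assumes IH: "goal t r" and st: "st M B {} E m" and E: "card E = 2 * k"
    and tot: "a * t + Suc r = k + s" "kf < k" "Suc r \<le> a" and Q: "Q t B E"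
    and e: "card (hh B {} E m) + \<phi> \<le> k + Suc r"
  shows "MW (Suc r) t M B"
proof -
  let ?H = "hh B {} E m"
  have fin: "finite ?H" "finite E" using st_finite[OF st] by auto
  \<comment> \<open>The first bound leaves fewer than \<open>2 * k - 2\<close> harmful edges, so
    every end has a free partner. The second is for the case that at most one harmful edge is left
    to pay for the link.\<close>
  have ar: "Suc r + 3 \<le> k + \<phi>" "\<phi> + 2 \<le> k + Suc r" using arith[OF _ tot(3) tot(1,2)] by auto
  have "\<exists>u v. u \<in> E \<and> v \<in> E \<and> u \<noteq> v \<and> v \<noteq> m u \<and> {u, v} \<notin> ?H \<and>
      card ?H - (deg ?H u + deg ?H v) + \<phi> \<le> (k - 1) + r"
  proof -
    have part: "\<exists>v\<in>E. v \<noteq> x \<and> v \<noteq> m x \<and> {x, v} \<notin> ?H" if "x \<in> E" for x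
      using exists_free_end[OF st that] e E ar by simp
    have HE: "\<exists>u v. h = {u, v} \<and> u \<noteq> v \<and> u \<in> E \<and> v \<in> E" if "h \<in> ?H" for h
      using hh_edge[OF st that] by auto
    have "E \<noteq> {}" using E tot(2) by auto
    show ?thesis
    proof (cases "card ?H \<le> 1")
      case True
      obtain x where x: "x \<in> E" "card ?H \<le> deg ?H x"
      proof (cases "?H = {}")
        case False
        then obtain h where h: "h \<in> ?H" by blast
        then obtain u v where "h = {u, v}" "u \<in> E" using HE by metis
        then have "u \<in> \<Union>?H" using h by blast
        then show ?thesis using that[of u] True deg_pos_iff[OF fin(1)] \<open>u \<in> E\<close>
          by (metis One_nat_def Suc_leI le_trans)
      qed (use \<open>E \<noteq> {}\<close> that in auto)
      then obtain v where v: "v \<in> E" "v \<noteq> x" "v \<noteq> m x" "{x, v} \<notin> ?H" using part by metis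
      show ?thesis
        by (rule exI[of _ x], rule exI[of _ v]) (use x v ar tot in auto)
    next
      case False
      show ?thesis
      proof (cases "\<exists>x\<in>E. 2 \<le> deg ?H x")
        case True
        then obtain x where x: "x \<in> E" "2 \<le> deg ?H x" by blast
        then obtain v where v: "v \<in> E" "v \<noteq> x" "v \<noteq> m x" "{x, v} \<notin> ?H" using part by metis
        show ?thesis
          by (rule exI[of _ x], rule exI[of _ v]) (use x v ar tot e in auto)
      next
        \<comment> \<open>The harmful edges form a matching of size at least two. One end of
          \<open>h\<close> is linked to an end of \<open>h'\<close> that is not its mate; this pair
          is not harmful, as it shares \<open>u\<close> with \<open>h\<close>.\<close>
        case d1: False
        obtain h h' where h: "h \<in> ?H" "h' \<in> ?H" "h \<noteq> h'"
          using False card_le_Suc0_iff_eq[OF fin(1)] by (metis One_nat_def)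
        obtain u w u' w' where uw: "h = {u, w}" "u \<noteq> w" "u \<in> E" "w \<in> E" "h' = {u', w'}" "u' \<noteq> w'" "u' \<in> E" "w' \<in> E"
          using HE[OF h(1)] HE[OF h(2)] by blast
        have uniq: "g = g'" if "g \<in> ?H" "g' \<in> ?H" "x \<in> g" "x \<in> g'" for g g' x
        proof -
          have "x \<in> E" using HE[OF that(1)] that(3) by auto
          then have "deg ?H x \<le> 1" using d1 by force
          then show ?thesis using deg_le_1_unique[OF fin(1)] that by blast
        qed
        have dis: "x \<notin> h" if "x \<in> h'" for x using uniq[OF h(1,2)] that h(3) by blast
        define v where "v = (if u' = m u then w' else u')"
        have v: "v \<in> h'" "v \<in> E" "v \<noteq> m u" using uw by (auto simp: v_def)
        have "u \<noteq> v" using dis[OF v(1)] uw by auto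
        moreover have "{u, v} \<notin> ?H"
        proof
          assume "{u, v} \<in> ?H"
          then have "{u, v} = h" using uniq[of "{u, v}" h u] h(1) uw(1) by auto
          then show False using dis[OF v(1)] by auto
        qed
        moreover have "0 < deg ?H u" "0 < deg ?H v"
          using h uw(1) v(1) deg_pos_iff[OF fin(1)] by blast+
        then have "card ?H - (deg ?H u + deg ?H v) + \<phi> \<le> (k - 1) + r"
          using e ar tot False by linarith
        ultimately show ?thesis using uw(3) v(2,3) by blast
      qed
    qed
  qed
  then obtain u v where "u \<in> E" "v \<in> E" "u \<noteq> v" "v \<noteq> m u" "{u, v} \<notin> ?H"
      "card ?H - (deg ?H u + deg ?H v) + \<phi> \<le> (k - 1) + r" by blast
  then show ?thesis using tot Q by (intro goal_ee[OF IH st E]) auto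
qed

lemma goal_step:
  assumes IH: "goal t r" and "Suc r \<le> a"
  shows "goal t (Suc r)"
proof (intro allI impI)
  fix M B I E m k
  let ?H = "hh B I E m"
  assume st: "st M B I E m" and E: "card E = 2 * k" and good: "good (Suc r) k ?H I E"
    and tot: "a * t + Suc r = k + card I + s" "kf \<le> k" and Q: "Q t B (I \<union> E)"
  have fin: "finite ?H" "finite E" "finite I" using st_finite[OF st] by auto
  show "MW (Suc r) t M B"
  proof (cases "card ?H + \<phi> \<le> k + Suc r \<and> (I = {} \<or> card I + a + 12 \<le> k)")
    case True
    show ?thesis
    proof (cases "I = {}")
      case False
      then show ?thesis using goal_isolated[OF IH st E tot assms(2) Q] True by blast
    next
      case I: True
      show ?thesis
      proof (cases "kf < k")
        case True
        then show ?thesis using goal_paths[OF IH _ E] st tot I assms(2) Q \<open>card ?H + \<phi> \<le> k + Suc r \<and> _\<close> by auto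
      next
        case False
        then have k: "k = kf" using tot by simp
        then have eq: "a * t + Suc r = a * tf + \<rho>f" using tot I fin_consts by simp
        \<comment> \<open>With remainders counted from 1 to \<open>a\<close>, the number of edges
          left determines the number of moves, so \<open>FIN\<close> applies at exactly the
          prescribed moment.\<close>
        have "t = tf"
        proof (rule ccontr)
          assume "t \<noteq> tf"
          then consider "Suc t \<le> tf" | "Suc tf \<le> t" by linarith
          then show False
          proof cases
            case 1
            then have "a * Suc t \<le> a * tf" by (rule mult_le_mono2)
            then show False using eq assms(2) fin_consts by simp
          next
            case 2
            then have "a * Suc tf \<le> a * t" by (rule mult_le_mono2)
            then show False using eq assms(2) fin_consts by simp
          qed
        qed
        then have "Suc r = \<rho>f" using eq by simp
        then show ?thesis using FIN[of M B E m] st E True I k \<open>t = tf\<close> Q by auto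
      qed
    qed
  next
    case False
    then obtain x where x: "card ?H + \<phi> \<le> k + Suc r + 1" "x \<in> E" "3 \<le> deg ?H x" "card I + a + 13 \<le> k"
      using good by (auto simp: good_def)
    obtain v where v: "v \<in> E" "v \<noteq> x" "v \<noteq> m x" "{x, v} \<notin> ?H"
      using exists_free_end[OF st x(2)] x E assms(2) by fastforce
    have "deg ?H x \<le> card ?H" by (rule deg_le_card[OF fin(1)])
    then have "card ?H - (deg ?H x + deg ?H v) + \<phi> \<le> (k - 1) + r" using x by linarith
    then show ?thesis
      by (intro goal_ee[OF IH st E x(2) v(1) _ v(3,4) tot(1) _ Q]) (use v x fin_consts(4) in auto)
  qed
qed

lemma goal_0:
  assumes IH: "goal t a"
  shows "goal (Suc t) 0"
proof (intro allI impI)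
  fix M B I E m k
  assume st: "st M B I E m" and E: "card E = 2 * k" and good: "good 0 k (hh B I E m) I E"
    and tot: "a * Suc t + 0 = k + card I + s" "kf \<le> k" and Q: "Q (Suc t) B (I \<union> E)"
  have "W (Suc t) M B" unfolding wins_Suc_iff
  proof (intro allI impI)
    fix b assume b: "b \<subseteq> X - (M \<union> B) \<and> card b \<le> a"
    note st' = st_brk[OF st conjunct1[OF b]]
    have "deg (hh B I E m) x \<le> deg (hh (B \<union> b) I E m) x" for x
      by (rule deg_mono[OF st_finite(4)[OF st'(1)] st'(2)])
    then have "good a k (hh (B \<union> b) I E m) I E"
      using good st'(4) b unfolding good_def by (fastforce intro: order_trans)
    moreover have "Q t (B \<union> b) (I \<union> E)"
      by (rule Q_brk[OF Q]) (use b st in \<open>auto simp: st_def\<close>)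
    ultimately show "MW a t M (B \<union> b)" using IH st'(1) E tot by auto
  qed
  then show "MW 0 (Suc t) M B" by (rule mwin_0)
qed

theorem late_game: "\<rho> \<le> a \<Longrightarrow> goal t \<rho>"
proof (induction t arbitrary: \<rho>)
  case 0
  then show ?case
  proof (induction \<rho>)
    case 0
    \<comment> \<open>Vacuous: no edge is left although \<open>kf + s\<close> is positive.\<close>
    show ?case using fin_consts by auto
  next
    case (Suc \<rho>)
    have "goal 0 \<rho>" by (rule Suc.IH) (use Suc.prems in simp)
    then show ?case using Suc.prems by (rule goal_step)
  qed
next
  case (Suc t)
  from Suc.prems show ?case
  proof (induction \<rho>)
    case 0
    show ?case by (rule goal_0, rule Suc.IH) simp
  next
    case (Suc \<rho>)
    have "goal (Suc t) \<rho>" by (rule Suc.IH) (use Suc.prems in simp)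
    then show ?case using Suc.prems by (rule goal_step)
  qed
qed

text \<open>The phase before \<open>goal\<close>, when the isolated vertices may still outnumber the
  paths. \<open>card I + 2 * k\<close> does not change when two isolated vertices are joined, so its
  lower bound persists until \<open>k\<close> is large compared with \<open>card I\<close>.\<close>

abbreviation sgoal :: "nat \<Rightarrow> nat \<Rightarrow> bool" where
  "sgoal t \<rho> \<equiv> (\<forall>M B I E m k. st M B I E m \<longrightarrow> card E = 2 * k \<longrightarrow> card (hh B I E m) + \<phi> \<le> k + \<rho> \<longrightarrow>
     a * t + \<rho> = k + card I + s \<longrightarrow> 5 * a + 60 \<le> card I + 2 * k \<longrightarrow> Q t B (I \<union> E) \<longrightarrow> MW \<rho> t M B)"

lemma sgoal_step:
  assumes IH: "sgoal t r" and "Suc r \<le> a"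
  shows "sgoal t (Suc r)"
proof (intro allI impI)
  fix M B I E m k
  let ?H = "hh B I E m"
  assume st: "st M B I E m" and E: "card E = 2 * k" and e: "card ?H + \<phi> \<le> k + Suc r"
    and tot: "a * t + Suc r = k + card I + s" and J: "5 * a + 60 \<le> card I + 2 * k" and Q: "Q t B (I \<union> E)"
  have fin: "finite ?H" "finite E" "finite I" using st_finite[OF st] by auto
  show "MW (Suc r) t M B"
  proof (cases "card I + a + 12 \<le> k")
    case True
    then have "good (Suc r) k ?H I E" "kf \<le> k" using e fin_consts(4) by (auto simp: good_def)
    then show ?thesis using late_game[OF assms(2), of t] st E tot Q by blast
  next
    case False
    \<comment> \<open>While \<open>k\<close> is below \<open>card I + a + 12\<close>, the bound
      \<open>J\<close> keeps \<open>card I\<close> large, and the harmful edges, at most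
      \<open>k + a\<close>, cannot cover all pairs of isolated vertices.\<close>
    then have i: "a + 13 \<le> card I" using J by simp
    have "6 * card I \<le> (card I * (card I - 1)) div 2"
    proof -
      have "card I * 12 \<le> card I * (card I - 1)" using i by (intro mult_le_mono2) simp
      then show ?thesis by linarith
    qed
    then have "card ?H < card I choose 2" using i False e assms(2) by (simp add: choose_two)
    then have "card ?H < card {h. h \<subseteq> I \<and> card h = 2}" using n_subsets[OF fin(3), of 2] by simp
    then have "\<not> {h. h \<subseteq> I \<and> card h = 2} \<subseteq> ?H" using card_mono[OF fin(1)] leD by blast
    then obtain h where h: "h \<subseteq> I" "card h = 2" "h \<notin> ?H" by blast
    then obtain u v where uv: "u \<in> I" "v \<in> I" "u \<noteq> v" "{u, v} \<notin> ?H" by (auto simp: card_2_iff)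
    show ?thesis
    proof (rule link_MW[OF st _ _ uv(3) _ uv(4)])
      let ?I = "I - {u, v}" and ?E = "E \<union> {u, v}" and ?m = "m(u := v, v := u)"
      note st' = st_ii[OF st uv]
      show "v \<noteq> m u" using st_I[OF st uv(1)] uv(3) by simp
      have "card (hh B ?I ?E ?m) \<le> card ?H"
        using st'(2) fin by (intro card_mono) auto
      then have "card (hh B ?I ?E ?m) + \<phi> \<le> Suc k + r" using e by simp
      moreover have "card ?I + 2 = card I" using uv fin i by (subst card_Diff_subset) auto
      moreover have "card ?E = 2 * Suc k" using E uv fin st_disj[OF st] by (subst card_Un_disjoint) auto
      moreover have "Q t B (?I \<union> ?E)" using Q by (rule Q_mono) (use uv in auto)
      moreover have "a * t + r = Suc k + card ?I + s" "5 * a + 60 \<le> card ?I + 2 * Suc k"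
        using tot calculation(2) J by simp_all
      ultimately show "MW r t (insert {u, v} M) B" using IH st'(1) by blast
    qed (use uv in auto)
  qed
qed

lemma sgoal_0:
  assumes IH: "sgoal t a"
  shows "sgoal (Suc t) 0"
proof (intro allI impI)
  fix M B I E m k
  assume st: "st M B I E m" and E: "card E = 2 * k" and e: "card (hh B I E m) + \<phi> \<le> k + 0"
    and tot: "a * Suc t + 0 = k + card I + s" "5 * a + 60 \<le> card I + 2 * k" and Q: "Q (Suc t) B (I \<union> E)"
  have "W (Suc t) M B" unfolding wins_Suc_iff
  proof (intro allI impI)
    fix b assume b: "b \<subseteq> X - (M \<union> B) \<and> card b \<le> a"
    note st' = st_brk[OF st conjunct1[OF b]]
    have "Q t (B \<union> b) (I \<union> E)"
      by (rule Q_brk[OF Q]) (use b st in \<open>auto simp: st_def\<close>)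
    moreover have "card (hh (B \<union> b) I E m) + \<phi> \<le> k + a" "a * t + a = k + card I + s"
      using e st'(4) b tot by auto
    ultimately show "MW a t M (B \<union> b)" using IH st'(1) E tot(2) by blast
  qed
  then show "MW 0 (Suc t) M B" by (rule mwin_0)
qed

theorem spread: "\<rho> \<le> a \<Longrightarrow> sgoal t \<rho>"
proof (induction t arbitrary: \<rho>)
  case 0
  then show ?case
  proof (induction \<rho>)
    case 0
    show ?case by auto
  next
    case (Suc \<rho>)
    have "sgoal 0 \<rho>" by (rule Suc.IH) (use Suc.prems in simp)
    then show ?case using Suc.prems by (rule sgoal_step)
  qed
next
  case (Suc t)
  from Suc.prems show ?case
  proof (induction \<rho>)
    case 0
    show ?case by (rule sgoal_0, rule Suc.IH) simp
  next
    case (Suc \<rho>)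
    have "sgoal (Suc t) \<rho>" by (rule Suc.IH) (use Suc.prems in simp)
    then show ?case using Suc.prems by (rule sgoal_step)
  qed
qed

end

section \<open>Gaining tempo\<close>

text \<open>
  A pattern lets Maker's next edge gain on Breaker: either it uses an end that meets two harmful
  edges, or it joins \<open>m u\<close> to \<open>w\<close>, whereby \<open>{u, w}\<close> becomes the pair of ends of a path and
  is no longer harmful.
\<close>

definition pattern :: "nat set \<Rightarrow> nat set \<Rightarrow> (nat \<Rightarrow> nat) \<Rightarrow> nat set set \<Rightarrow> bool" where
  "pattern I E m H \<longleftrightarrow> (\<exists>u\<in>E. 2 \<le> deg H u) \<or>
     (\<exists>u\<in>E. \<exists>w\<in>I. {u, w} \<in> H \<and> {m u, w} \<notin> H \<and> 0 < deg H (m u))"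

text \<open>A pattern of the second kind is destroyed only by claiming \<open>{m u, w}\<close>; but
  then \<open>m u\<close> meets two harmful edges, which is a pattern of the first kind.\<close>

lemma pattern_brk:
  assumes "pattern I E m H" "H \<subseteq> H'" "finite H'" "\<And>u. u \<in> E \<Longrightarrow> m u \<in> E"
  shows "pattern I E m H'"
proof -
  from assms(1) consider (1) u where "u \<in> E" "2 \<le> deg H u"
    | (2) u w where "u \<in> E" "w \<in> I" "{u, w} \<in> H" "{m u, w} \<notin> H" "0 < deg H (m u)"
    by (auto simp: pattern_def)
  then show ?thesis
  proof cases
    case 1
    then show ?thesis using deg_mono[OF assms(3,2), of u] unfolding pattern_def by (meson le_trans)
  next
    case 2
    show ?thesis
    proof (cases "{m u, w} \<in> H'")
      case True
      obtain h where "h \<in> H" "m u \<in> h"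
        using 2(5) deg_pos_iff[OF finite_subset[OF assms(2,3)]] by auto
      then have "2 \<le> deg H' (m u)" using two_le_deg[OF assms(3), of h "{m u, w}" "m u"] True 2(4) assms(2) by auto
      then show ?thesis using assms(4) 2(1) by (auto simp: pattern_def)
    next
      case False
      then show ?thesis using 2 deg_mono[OF assms(3,2), of "m u"] assms(2)
        unfolding pattern_def by (meson le_trans less_le_trans subsetD)
    qed
  qed
qed

context phase
begin

lemma card_Union_hh:
  assumes "st M B I E m"
  shows "card (\<Union>(hh B I E m)) \<le> 2 * card (hh B I E m)"
proof -
  have "card (\<Union>(hh B I E m)) \<le> (\<Sum>h\<in>hh B I E m. card h)" by (rule card_Union_le_sum_card)
  also have "\<dots> \<le> (\<Sum>h\<in>hh B I E m. 2)" by (rule sum_mono) (use hh_card2[OF assms] in simp)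
  finally show ?thesis by simp
qed

lemma clean_isolated:
  assumes st: "st M B I E m" and "finite S" "2 * card (hh B I E m) + card S < card I"
  shows "\<exists>x\<in>I. x \<notin> S \<and> x \<notin> \<Union>(hh B I E m)"
proof (rule ccontr)
  assume "\<not> ?thesis"
  then have "I \<subseteq> S \<union> \<Union>(hh B I E m)" by auto
  moreover have "finite (\<Union>(hh B I E m))" using st_finite(5)[OF st]
    by (rule finite_subset[rotated]) (auto simp: hh_def)
  ultimately have "card I \<le> card (S \<union> \<Union>(hh B I E m))" using assms(2) by (intro card_mono) auto
  also have "\<dots> \<le> card S + card (\<Union>(hh B I E m))" by (rule card_Un_le)
  finally show False using assms(3) card_Union_hh[OF st] by simp
qed

text \<open>Each edge of \<open>H0\<close> is charged to two ends: its own vertices if both are in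
  \<open>E\<close>, otherwise its vertex \<open>u\<close> in \<open>E\<close> and the mate
  \<open>m u\<close>. By \<open>uniq\<close> and \<open>clean\<close> no end is charged twice. Under
  equality every end is charged, so if the edges lie inside \<open>E\<close>, they cover it.\<close>

lemma saturated_count:
  assumes st: "st M B I E m" and H0: "H0 \<subseteq> hh B I E m" "\<And>h. h \<in> H0 \<Longrightarrow> h \<inter> E \<noteq> {}"
    and uniq: "\<And>x h h'. x \<in> h \<Longrightarrow> x \<in> h' \<Longrightarrow> h \<in> hh B I E m \<Longrightarrow> h' \<in> hh B I E m \<Longrightarrow> h = h'"
    and clean: "\<And>u w. u \<in> E \<Longrightarrow> w \<in> I \<Longrightarrow> {u, w} \<in> hh B I E m \<Longrightarrow> m u \<notin> \<Union>(hh B I E m)"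
  shows "2 * card H0 \<le> card E" and "2 * card H0 = card E \<Longrightarrow> \<Union>H0 \<subseteq> E \<Longrightarrow> E \<subseteq> \<Union>H0"
proof -
  define g where "g h = (h \<inter> E) \<union> (if h \<subseteq> E then {} else m ` (h \<inter> E))" for h
  have fin: "finite E" "finite H0" using st_finite[OF st] H0(1) finite_subset by auto
  have gE: "g h \<subseteq> E" for h using st_E[OF st] by (auto simp: g_def)
  have two: "card (g h) = 2" if h: "h \<in> H0" for h
  proof (cases "h \<subseteq> E")
    case True
    then show ?thesis using hh_card2[OF st] h H0 by (auto simp: g_def Int_absorb2)
  next
    case False
    obtain u w where "h = {u, w}" "u \<noteq> w" "u \<in> I \<union> E" "w \<in> I \<union> E" using hh_edge[OF st] h H0(1) by blast
    then obtain u w where uw: "h = {u, w}" "u \<in> E" "w \<notin> E" using False H0(2)[OF h] by auto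
    then have "g h = {u, m u}" by (auto simp: g_def)
    then show ?thesis using st_E(2)[OF st uw(2)] by simp
  qed
  have disj: "g h \<inter> g h' = {}" if hh': "h \<in> H0" "h' \<in> H0" "h \<noteq> h'" for h h'
  proof (rule ccontr)
    assume "\<not> ?thesis"
    then obtain x where x: "x \<in> g h" "x \<in> g h'" by blast
    have H: "h \<in> hh B I E m" "h' \<in> hh B I E m" using hh' H0 by auto
    have iso: "m y \<notin> \<Union>(hh B I E m)" if yf: "y \<in> f" "y \<in> E" "\<not> f \<subseteq> E" "f \<in> hh B I E m" for y f
    proof -
      obtain p q where pq: "f = {p, q}" "p \<in> I \<union> E" "q \<in> I \<union> E" using hh_edge[OF st yf(4)] by blast
      then have "\<exists>w\<in>I. f = {y, w}" using yf st_disj[OF st] by (auto simp: insert_commute)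
      then show ?thesis using clean yf by blast
    qed
    consider "x \<in> h" "x \<in> h'" | y where "x \<in> h" "y \<in> h'" "y \<in> E" "\<not> h' \<subseteq> E" "x = m y"
      | y where "x \<in> h'" "y \<in> h" "y \<in> E" "\<not> h \<subseteq> E" "x = m y"
      | y y' where "y \<in> h" "y' \<in> h'" "y \<in> E" "y' \<in> E" "m y = m y'"
      using x by (auto simp: g_def split: if_splits)
    then show False
    proof cases
      case 1
      then show False using uniq H hh'(3) by blast
    next
      case 2
      then show False using iso[of y h'] H by blast
    next
      case 3
      then show False using iso[of y h] H by blast
    next
      case 4
      then have "y = y'" using st_E(3)[OF st] by metis
      then show False using uniq H hh'(3) 4 by blast
    qed
  qed
  have c: "card (\<Union>h\<in>H0. g h) = 2 * card H0"
    using card_UN_disjoint[of H0 g] fin two disj gE finite_subset[OF gE fin(1)] by simp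
  moreover have sub: "(\<Union>h\<in>H0. g h) \<subseteq> E" using gE by blast
  ultimately show "2 * card H0 \<le> card E" using card_mono[OF fin(1) sub] by simp
  assume "2 * card H0 = card E" "\<Union>H0 \<subseteq> E"
  then have "(\<Union>h\<in>H0. g h) = E" using c sub fin card_subset_eq by metis
  moreover have "g h = h" if "h \<in> H0" for h using that \<open>\<Union>H0 \<subseteq> E\<close> by (auto simp: g_def)
  ultimately show "E \<subseteq> \<Union>H0" by auto
qed

end

context late
begin

text \<open>The deficit is measured in half units, and a pattern counts for one of them.\<close>

definition deficit :: "nat \<Rightarrow> nat \<Rightarrow> nat \<Rightarrow> nat set set \<Rightarrow> nat set \<Rightarrow> nat set \<Rightarrow> (nat \<Rightarrow> nat) \<Rightarrow> bool" where
  "deficit d \<rho> k H I E m \<longleftrightarrow> 2 * (card H + \<phi>) \<le> 2 * (k + \<rho>) + d \<and>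
     (pattern I E m H \<or> 2 * (card H + \<phi>) + 1 \<le> 2 * (k + \<rho>) + d)"

text \<open>\<open>rgoal\<close> describes the start of Maker's move, where the gain is made;
  \<open>ngoal\<close> the rest of it, where nothing must be lost. A round uses at most
  \<open>2 * a\<close> isolated vertices and adds at most \<open>a\<close> harmful edges, each
  spoiling at most two more: this is the reserve of \<open>4 * a\<close> per half unit.\<close>

abbreviation rgoal :: "nat \<Rightarrow> nat \<Rightarrow> bool" where
  "rgoal d t \<equiv> (\<forall>M B I E m k. st M B I E m \<longrightarrow> card E = 2 * k \<longrightarrow> 1 \<le> k \<longrightarrow> deficit d a k (hh B I E m) I E m \<longrightarrow>
     a * t + a = k + card I + s \<longrightarrow> 2 * card (hh B I E m) + 4 * a * (d + 1) + 5 * a + 60 \<le> card I \<longrightarrow>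
     Q t B (I \<union> E) \<longrightarrow> MW a t M B)"

abbreviation ngoal :: "nat \<Rightarrow> nat \<Rightarrow> nat \<Rightarrow> bool" where
  "ngoal d \<rho> t \<equiv> (\<forall>M B I E m k. st M B I E m \<longrightarrow> card E = 2 * k \<longrightarrow> 1 \<le> k + \<rho> \<longrightarrow> deficit d \<rho> k (hh B I E m) I E m \<longrightarrow>
     a * t + \<rho> = k + card I + s \<longrightarrow>
     2 * card (hh B I E m) + 4 * a * (d + 1) + 2 * \<rho> + 7 * a + 60 \<le> card I \<longrightarrow>
     Q t B (I \<union> E) \<longrightarrow> MW \<rho> t M B)"

text \<open>Joining two isolated vertices that meet no harmful edge keeps the lead, and it keeps any
  pattern because the vertex \<open>w\<close> of a pattern does meet one. Such links fill up the
  move; Breaker's answer preserves the pattern, too.\<close>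

lemma ngoal: "(\<And>t. rgoal d t) \<Longrightarrow> \<rho> \<le> a \<Longrightarrow> ngoal d \<rho> t"
proof (induction \<rho>)
  case 0
  show ?case
  proof (intro allI impI)
    fix M B I E m k
    assume st: "st M B I E m" and E: "card E = 2 * k" and k: "1 \<le> k + 0" and D: "deficit d 0 k (hh B I E m) I E m"
      and tot: "a * t + 0 = k + card I + s"
      and i: "2 * card (hh B I E m) + 4 * a * (d + 1) + 2 * 0 + 7 * a + 60 \<le> card I" and Q: "Q t B (I \<union> E)"
    obtain t' where t': "t = Suc t'" using tot k by (cases t) auto
    have "W (Suc t') M B" unfolding wins_Suc_iff
    proof (intro allI impI)
      fix b assume b: "b \<subseteq> X - (M \<union> B) \<and> card b \<le> a"
      note st' = st_brk[OF st conjunct1[OF b]]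
      have "Q t' (B \<union> b) (I \<union> E)"
        by (rule Q_brk) (use Q t' b st in \<open>auto simp: st_def\<close>)
      moreover have c: "card (hh (B \<union> b) I E m) \<le> card (hh B I E m) + a" using st'(4) b by simp
      moreover have "pattern I E m (hh B I E m) \<Longrightarrow> pattern I E m (hh (B \<union> b) I E m)"
        by (rule pattern_brk[OF _ st'(2) st_finite(4)[OF st'(1)]]) (use st_E[OF st] in auto)
      then have "deficit d a k (hh (B \<union> b) I E m) I E m" using D c by (auto simp: deficit_def)
      moreover have "a * t' + a = k + card I + s" using tot t' by simp
      moreover have "2 * card (hh (B \<union> b) I E m) + 4 * a * (d + 1) + 5 * a + 60 \<le> card I" using c i by simp
      ultimately show "MW a t' M (B \<union> b)" using 0(1)[of t'] st'(1) E k by (metis add_0_right)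
    qed
    then show "MW 0 t M B" unfolding t' by (rule mwin_0)
  qed
next
  case (Suc \<rho>)
  have IH: "ngoal d \<rho> t" by (rule Suc.IH) (use Suc.prems in simp_all)
  show ?case
  proof (intro allI impI)
    fix M B I E m k
    let ?H = "hh B I E m"
    assume st: "st M B I E m" and E: "card E = 2 * k" and D: "deficit d (Suc \<rho>) k ?H I E m"
      and tot: "a * t + Suc \<rho> = k + card I + s"
      and i: "2 * card ?H + 4 * a * (d + 1) + 2 * Suc \<rho> + 7 * a + 60 \<le> card I" and Q: "Q t B (I \<union> E)"
    have fin: "finite ?H" "finite E" "finite I" using st_finite[OF st] by auto
    obtain u where u: "u \<in> I" "u \<notin> \<Union>?H" using clean_isolated[OF st, of "{}"] i by auto
    obtain v where v: "v \<in> I" "v \<noteq> u" "v \<notin> \<Union>?H" using clean_isolated[OF st, of "{u}"] i by auto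
    have uv: "{u, v} \<notin> ?H" using u by blast
    let ?I = "I - {u, v}" and ?E = "E \<union> {u, v}" and ?m = "m(u := v, v := u)"
    have ne: "u \<noteq> v" using v by simp
    note st' = st_ii[OF st u(1) v(1) ne uv]
    have H: "hh B ?I ?E ?m = ?H" using st'(2,3) by auto
    show "MW (Suc \<rho>) t M B"
    proof (rule link_MW[OF st _ _ ne _ uv])
      show "v \<noteq> m u" using st_I[OF st u(1)] v by simp
      have cI: "card ?I + 2 = card I" using u v fin i by (subst card_Diff_subset) auto
      have uE: "u \<notin> E" "v \<notin> E" using u v st_disj[OF st] by auto
      then have "card ?E = 2 * Suc k" using E v fin by (subst card_Un_disjoint) auto
      moreover have "Q t B (?I \<union> ?E)" using Q by (rule Q_mono) (use u v in auto)
      moreover have "a * t + \<rho> = Suc k + card ?I + s" "1 \<le> Suc k + \<rho>" using tot cI by simp_all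
      moreover have "pattern ?I ?E ?m ?H" if "pattern I E m ?H"
      proof -
        from that consider (1) x where "x \<in> E" "2 \<le> deg ?H x"
          | (2) x w where "x \<in> E" "w \<in> I" "{x, w} \<in> ?H" "{m x, w} \<notin> ?H" "0 < deg ?H (m x)"
          by (auto simp: pattern_def)
        then show ?thesis
        proof cases
          case 1
          then show ?thesis by (auto simp: pattern_def)
        next
          case 2
          have "w \<in> \<Union>?H" using 2(3) by blast
          then have "w \<in> ?I" using 2(2) u v by auto
          moreover have "?m x = m x" using 2(1) uE by auto
          then have "{?m x, w} \<notin> ?H" "0 < deg ?H (?m x)" using 2(4,5) by simp_all
          ultimately show ?thesis using 2(1,3) unfolding pattern_def by blast
        qed
      qed
      then have "deficit d \<rho> (Suc k) (hh B ?I ?E ?m) ?I ?E ?m" using D unfolding H deficit_def by auto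
      moreover have "2 * card (hh B ?I ?E ?m) + 4 * a * (d + 1) + 2 * \<rho> + 7 * a + 60 \<le> card ?I"
        unfolding H using cI i by simp
      ultimately show "MW \<rho> t (insert {u, v} M) B" using IH st'(1) \<open>1 \<le> Suc k + \<rho>\<close> by blast
    qed (use u v in auto)
  qed
qed

lemma rgoal_if_few:
  assumes "st M B I E m" "card E = 2 * k" "card (hh B I E m) + \<phi> \<le> k + a"
    "a * t + a = k + card I + s" "5 * a + 60 \<le> card I" "Q t B (I \<union> E)"
  shows "MW a t M B"
  using spread[of a t] assms by (metis le_refl trans_le_add1)

lemma after_ei:
  assumes ng: "ngoal d (a - 1) t" and a: "0 < a" and st: "st M B I E m" and E: "card E = 2 * k"
    and uv: "u \<in> E" "v \<in> I" "{u, v} \<notin> hh B I E m"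
    and D: "deficit d (a - 1) k (hh B (I - {v}) (insert v (E - {u})) (m(m u := v, v := m u))) (I - {v}) (insert v (E - {u})) (m(m u := v, v := m u))"
    and tot: "a * t + a = k + card I + s"
    and i: "2 * card (hh B I E m) + 4 * a * (Suc d + 1) + 5 * a + 60 \<le> card I"
    and Q: "Q t B (I \<union> E)" and k: "1 \<le> k"
  shows "MW a t M B"
proof -
  let ?I = "I - {v}" and ?E = "insert v (E - {u})" and ?m = "m(m u := v, v := m u)"
  have fin: "finite (hh B I E m)" "finite E" "finite I" using st_finite[OF st] by auto
  have vE: "v \<notin> E" "u \<noteq> v" "m u \<noteq> v" using st_disj[OF st] uv st_E[OF st uv(1)] by auto
  note st' = st_ei[OF st uv]
  have "MW (Suc (a - 1)) t M B"
  proof (rule link_MW[OF st _ _ _ _ uv(3)])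
    have cI: "card ?I + 1 = card I" using uv fin by (metis Suc_eq_plus1 card_Suc_Diff1)
    have "card (hh B ?I ?E ?m) \<le> card (hh B I E m)" using st'(2) fin by (intro card_mono) auto
    then have "2 * card (hh B ?I ?E ?m) + 4 * a * (d + 1) + 2 * (a - 1) + 7 * a + 60 \<le> card ?I"
      using i cI a by simp
    moreover have "card ?E = 2 * k" using E uv(1) vE fin
      by (metis (no_types, lifting) Diff_iff card_Suc_Diff1 card_insert_disjoint finite_Diff)
    moreover have "Q t B (?I \<union> ?E)" using Q by (rule Q_mono) (use uv in auto)
    moreover have "a * t + (a - 1) = k + card ?I + s" "1 \<le> k + (a - 1)" using tot cI k a by simp_all
    ultimately show "MW (a - 1) t (insert {u, v} M) B" using ng st'(1) D by blast
  qed (use uv vE in auto)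
  then show ?thesis using a by simp
qed

lemma after_ii:
  assumes ng: "ngoal d (a - 1) t" and a: "0 < a" and st: "st M B I E m" and E: "card E = 2 * k"
    and uv: "u \<in> I" "v \<in> I" "u \<noteq> v" "{u, v} \<notin> hh B I E m"
    and D: "deficit d (a - 1) (Suc k) (hh B I E m) (I - {u, v}) (E \<union> {u, v}) (m(u := v, v := u))"
    and tot: "a * t + a = k + card I + s"
    and i: "2 * card (hh B I E m) + 4 * a * (Suc d + 1) + 5 * a + 60 \<le> card I"
    and Q: "Q t B (I \<union> E)"
  shows "MW a t M B"
proof -
  let ?I = "I - {u, v}" and ?E = "E \<union> {u, v}" and ?m = "m(u := v, v := u)"
  have fin: "finite (hh B I E m)" "finite E" "finite I" using st_finite[OF st] by auto
  note st' = st_ii[OF st uv]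
  have H: "hh B ?I ?E ?m = hh B I E m" using st'(2,3) by auto
  have "MW (Suc (a - 1)) t M B"
  proof (rule link_MW[OF st _ _ uv(3) _ uv(4)])
    show "v \<noteq> m u" using st_I[OF st uv(1)] uv by simp
    have cI: "card ?I + 2 = card I" using uv fin i by (subst card_Diff_subset) auto
    then have "2 * card (hh B ?I ?E ?m) + 4 * a * (d + 1) + 2 * (a - 1) + 7 * a + 60 \<le> card ?I"
      using i a unfolding H by simp
    moreover have "deficit d (a - 1) (Suc k) (hh B ?I ?E ?m) ?I ?E ?m" unfolding H by (rule D)
    moreover have "card ?E = 2 * Suc k" using E uv fin st_disj[OF st] by (subst card_Un_disjoint) auto
    moreover have "Q t B (?I \<union> ?E)" using Q by (rule Q_mono) (use uv in auto)
    moreover have "a * t + (a - 1) = Suc k + card ?I + s" "1 \<le> Suc k + (a - 1)" using tot cI a by simp_all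
    ultimately show "MW (a - 1) t (insert {u, v} M) B" using ng st'(1) by blast
  qed (use uv in auto)
  then show ?thesis using a by simp
qed

text \<open>A pattern is cashed in for a whole unit, that is, two half units minus the one it
  counted for. Without a pattern, a link that costs nothing creates one: otherwise Breaker's edges
  would be so spread out that only \<open>k\<close> of them fit, against
  \<open>many\<close>.\<close>

lemma gain_step:
  assumes nfl: "\<not> fl" and a: "0 < a" and ng: "ngoal d (a - 1) t" and st: "st M B I E m"
    and E: "card E = 2 * k" and k: "1 \<le> k" and D: "deficit (Suc d) a k (hh B I E m) I E m"
    and tot: "a * t + a = k + card I + s"
    and i: "2 * card (hh B I E m) + 4 * a * (Suc d + 1) + 5 * a + 60 \<le> card I"
    and Q: "Q t B (I \<union> E)" and many: "k + a < card (hh B I E m) + \<phi>" and \<phi>a: "\<phi> \<le> a"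
  shows "MW a t M B"
proof -
  let ?H = "hh B I E m"
  have fin: "finite ?H" "finite E" "finite I" using st_finite[OF st] by auto
  show ?thesis
  proof (cases "pattern I E m ?H")
    case True
    then consider (1) u where "u \<in> E" "2 \<le> deg ?H u"
      | (2) u w where "u \<in> E" "w \<in> I" "{u, w} \<in> ?H" "{m u, w} \<notin> ?H" "0 < deg ?H (m u)"
      by (auto simp: pattern_def)
    then show ?thesis
    proof cases
      case 1
      obtain v where v: "v \<in> I" "v \<notin> \<Union>?H" using clean_isolated[OF st, of "{}"] i by auto
      have uv: "{u, v} \<notin> ?H" using v by blast
      have "card (hh B (I - {v}) (insert v (E - {u})) (m(m u := v, v := m u))) \<le> card {h \<in> ?H. u \<notin> h}"
        using st_ei(2)[OF st 1(1) v(1) uv] fin by (intro card_mono) auto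
      then have "card (hh B (I - {v}) (insert v (E - {u})) (m(m u := v, v := m u))) + 2 \<le> card ?H"
        using card_remove_vertex[OF fin(1), of u] 1(2) by simp
      then have "deficit d (a - 1) k (hh B (I - {v}) (insert v (E - {u})) (m(m u := v, v := m u))) (I - {v}) (insert v (E - {u})) (m(m u := v, v := m u))"
        using D a unfolding deficit_def by auto
      then show ?thesis using after_ei[OF ng a st E 1(1) v(1) uv _ tot i Q k] by blast
    next
      case 2
      let ?u = "m u"
      have mu: "?u \<in> E" "m ?u = u" "?u \<noteq> u" "?u \<noteq> w" using st_E[OF st 2(1)] 2(2) st_disj[OF st] by auto
      let ?H' = "hh B (I - {w}) (insert w (E - {?u})) (m(m ?u := w, w := m ?u))"
      have "?H' \<subseteq> {h \<in> ?H. ?u \<notin> h} - {{u, w}}"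
        using st_ei(2)[OF st mu(1) 2(2,4)] nfl mu(2) by (auto simp: insert_commute)
      moreover have uw: "{u, w} \<in> {h \<in> ?H. ?u \<notin> h}" using 2(3) mu by auto
      have "card ?H' \<le> card ({h \<in> ?H. ?u \<notin> h} - {{u, w}})"
        by (rule card_mono) (use fin calculation in auto)
      moreover have "Suc (card ({h \<in> ?H. ?u \<notin> h} - {{u, w}})) = card {h \<in> ?H. ?u \<notin> h}"
        using uw fin by (intro card_Suc_Diff1) auto
      ultimately have "Suc (card ?H') \<le> card {h \<in> ?H. ?u \<notin> h}" by simp
      then have "card ?H' + 2 \<le> card ?H" using card_remove_vertex[OF fin(1), of ?u] 2(5) by simp
      then have "deficit d (a - 1) k ?H' (I - {w}) (insert w (E - {?u})) (m(m ?u := w, w := m ?u))"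
        using D a unfolding deficit_def by auto
      then show ?thesis using after_ei[OF ng a st E mu(1) 2(2,4) _ tot i Q k] by blast
    qed
  next
    case npat: False
    have D': "2 * (card ?H + \<phi>) + 1 \<le> 2 * (k + a) + Suc d" using D npat by (simp add: deficit_def)
    have e: "k + 1 \<le> card ?H" using many \<phi>a by simp
    show ?thesis
    proof (cases "\<exists>x\<in>I. 2 \<le> deg ?H x")
      case True
      \<comment> \<open>Made an end, \<open>x\<close> is a pattern of the first kind.\<close>
      then obtain x where x: "x \<in> I" "2 \<le> deg ?H x" by blast
      obtain v where v: "v \<in> I" "v \<noteq> x" "v \<notin> \<Union>?H" using clean_isolated[OF st, of "{x}"] i by auto
      have xv: "{x, v} \<notin> ?H" using v by blast
      have "deficit d (a - 1) (Suc k) ?H (I - {x, v}) (E \<union> {x, v}) (m(x := v, v := x))"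
        using D' a x(2) unfolding deficit_def pattern_def by auto
      then show ?thesis using after_ii[OF ng a st E x(1) v(1) v(2)[symmetric] xv _ tot i Q] by blast
    next
      case False
      have deg1: "deg ?H x \<le> 1" if "x \<in> I \<union> E" for x
        using that False npat unfolding pattern_def by (metis UnE not_less_eq_eq numeral_2_eq_2 One_nat_def)
      have uniq: "h = h'" if "x \<in> h" "x \<in> h'" "h \<in> ?H" "h' \<in> ?H" for x h h'
      proof -
        have "x \<in> I \<union> E" using that by (auto simp: hh_def)
        then show ?thesis using deg_le_1_unique[OF fin(1) deg1 that(3,1,4,2)] by simp
      qed
      \<comment> \<open>Otherwise there would be a pattern of the second kind: in a matching,
        \<open>{m u, w}\<close> is not harmful along with \<open>{u, w}\<close>.\<close>
      have clean: "m u \<notin> \<Union>?H" if "u \<in> E" "w \<in> I" "{u, w} \<in> ?H" for u w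
      proof
        assume mu: "m u \<in> \<Union>?H"
        then have "0 < deg ?H (m u)" using deg_pos_iff[OF fin(1)] by blast
        then have "{m u, w} \<in> ?H" using that npat unfolding pattern_def by blast
        then have "{m u, w} = {u, w}" using uniq[of w] that by blast
        then show False using st_E[OF st that(1)] that(2) st_disj[OF st] by (auto simp: doubleton_eq_iff)
      qed
      show ?thesis
      proof (cases "\<exists>z\<in>I. \<exists>w\<in>I. {z, w} \<in> ?H")
        case True
        then obtain z w where zw: "z \<in> I" "w \<in> I" "{z, w} \<in> ?H" by blast
        then have ne: "z \<noteq> w" using hh_card2[OF st zw(3)] by auto
        show ?thesis
        proof (cases "\<exists>x\<in>I. x \<noteq> z \<and> x \<noteq> w \<and> x \<in> \<Union>?H")
          case True
          \<comment> \<open>Joining \<open>z\<close> to \<open>x\<close> makes them mates; both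
            still meet harmful edges, and \<open>w\<close> stays isolated: a pattern of the second
            kind.\<close>
          then obtain x where x: "x \<in> I" "x \<noteq> z" "x \<noteq> w" "x \<in> \<Union>?H" by blast
          have zx: "{z, x} \<notin> ?H" using uniq[of z "{z, x}" "{z, w}"] zw x ne by (auto simp: doubleton_eq_iff)
          have xw: "{x, w} \<notin> ?H" using uniq[of w "{x, w}" "{z, w}"] zw x ne by (auto simp: doubleton_eq_iff)
          have "0 < deg ?H x" using x deg_pos_iff[OF fin(1)] by blast
          then have "pattern (I - {z, x}) (E \<union> {z, x}) (m(z := x, x := z)) ?H"
            unfolding pattern_def using zw xw x ne by (intro disjI2 bexI[of _ z] bexI[of _ w]) auto
          then have "deficit d (a - 1) (Suc k) ?H (I - {z, x}) (E \<union> {z, x}) (m(z := x, x := z))"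
            using D' a unfolding deficit_def by auto
          then show ?thesis using after_ii[OF ng a st E zw(1) x(1) x(2)[symmetric] zx _ tot i Q] by blast
        next
          case nox: False
          \<comment> \<open>The harmful edges other than \<open>{z, w}\<close> lie inside
            \<open>E\<close> and number at least \<open>k\<close>; by counting they cover every end.
            So any end \<open>u\<close> may be linked to \<open>z\<close>, paid for by the harmful
            edge at \<open>u\<close>. Its mate \<open>m u\<close>, still on a harmful edge, then
            forms a pattern with \<open>{z, w}\<close>.\<close>
          let ?K = "?H - {{z, w}}"
          have c0: "card ?K + 1 = card ?H" using card_Suc_Diff1[OF fin(1) zw(3)] by linarith
          have H0E: "h \<subseteq> E" if "h \<in> ?K" for h
          proof
            fix y assume y: "y \<in> h"
            then have "y \<in> I \<union> E" "y \<in> \<Union>?H" using that by (auto simp: hh_def)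
            moreover have "y \<noteq> z" "y \<noteq> w" using uniq[of y h "{z, w}"] y that zw by auto
            ultimately show "y \<in> E" using nox by blast
          qed
          have H0: "h \<inter> E \<noteq> {}" if "h \<in> ?K" for h
          proof -
            have "h \<noteq> {}" using hh_card2[OF st, of h] that by auto
            then show ?thesis using H0E[OF that] by blast
          qed
          note sc = saturated_count[OF st _ H0 uniq clean, of ?K]
          have "2 * card ?K \<le> card E" by (rule sc(1)) auto
          then have "2 * card ?K = card E" using c0 e E by linarith
          moreover have "\<Union>?K \<subseteq> E" using H0E by (intro Union_least) simp
          ultimately have all: "E \<subseteq> \<Union>?K" using Diff_subset by (intro sc(2))
          have "E \<noteq> {}" using E k by auto
          then obtain u where u: "u \<in> E" by blast
          have mu: "m u \<in> E" "m u \<noteq> u" using st_E[OF st u] by auto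
          obtain h h' where h: "h \<in> ?K" "u \<in> h" "h' \<in> ?K" "m u \<in> h'" using all u mu by blast
          have zE: "z \<notin> E" "w \<notin> E" using zw st_disj[OF st] by auto
          have uz: "{u, z} \<notin> ?H" using uniq[of z "{u, z}" "{z, w}"] zw u zE by (auto simp: doubleton_eq_iff)
          have muw: "{m u, w} \<notin> ?H" using uniq[of w "{m u, w}" "{z, w}"] zw mu zE by (auto simp: doubleton_eq_iff)
          let ?I = "I - {z}" and ?E = "insert z (E - {u})" and ?m = "m(m u := z, z := m u)"
          note st' = st_ei[OF st u zw(1) uz]
          have fin': "finite (hh B ?I ?E ?m)" using st_finite[OF st'(1)] by auto
          have "card (hh B ?I ?E ?m) \<le> card {h \<in> ?H. u \<notin> h}"
            using st'(2) fin by (intro card_mono) auto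
          moreover have "0 < deg ?H u" using h deg_pos_iff[OF fin(1)] by blast
          ultimately have c: "card (hh B ?I ?E ?m) + 1 \<le> card ?H"
            using card_remove_vertex[OF fin(1), of u] by simp
          have "u \<notin> h'"
          proof
            assume "u \<in> h'"
            moreover have "card h' = 2" using h hh_card2[OF st] by blast
            ultimately have "h' = {u, m u}" using h(4) mu by (metis card_2_iff doubleton_eq_iff insertE singletonD)
            then show False using hh_cross[OF st nfl, of u "m u"] h by auto
          qed
          then have h': "h' \<in> hh B ?I ?E ?m"
            using st'(3)[of h'] h H0E[OF h(3)] zE by auto
          have zw': "{z, w} \<in> hh B ?I ?E ?m"
            using st'(3)[of "{z, w}"] zw u mu zE by (auto simp: doubleton_eq_iff)
          have "0 < deg (hh B ?I ?E ?m) (m u)" using h' h(4) deg_pos_iff[OF fin'] by blast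
          then have "pattern ?I ?E ?m (hh B ?I ?E ?m)"
            unfolding pattern_def using zw zw' muw ne st'(2)
            by (intro disjI2 bexI[of _ z] bexI[of _ w]) auto
          then have "deficit d (a - 1) k (hh B ?I ?E ?m) ?I ?E ?m"
            using D' a c unfolding deficit_def by auto
          then show ?thesis using after_ei[OF ng a st E u zw(1) uz _ tot i Q k] by blast
        qed
      next
        case noiso: False
        have "h \<inter> E \<noteq> {}" if "h \<in> ?H" for h
          using hh_edge[OF st that] noiso that by blast
        then have "2 * card ?H \<le> card E" by (intro saturated_count(1)[OF st subset_refl _ uniq clean])
        then show ?thesis using e E by simp
      qed
    qed
  qed
qed

lemma rgoal: "\<not> fl \<Longrightarrow> 0 < a \<Longrightarrow> \<phi> \<le> a \<Longrightarrow> rgoal d t"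
proof (induction d arbitrary: t)
  case 0
  show ?case
  proof (intro allI impI)
    fix M B I E m k
    assume "st M B I E m" "card E = 2 * k" "deficit 0 a k (hh B I E m) I E m"
      "a * t + a = k + card I + s" "2 * card (hh B I E m) + 4 * a * (0 + 1) + 5 * a + 60 \<le> card I" "Q t B (I \<union> E)"
    then show "MW a t M B" by (intro rgoal_if_few) (auto simp: deficit_def)
  qed
next
  case (Suc d)
  have ng: "ngoal d (a - 1) t" for t by (rule ngoal) (use Suc in auto)
  show ?case
  proof (intro allI impI)
    fix M B I E m k
    assume st: "st M B I E m" and E: "card E = 2 * k" and k: "1 \<le> k"
      and D: "deficit (Suc d) a k (hh B I E m) I E m"
      and tot: "a * t + a = k + card I + s"
      and i: "2 * card (hh B I E m) + 4 * a * (Suc d + 1) + 5 * a + 60 \<le> card I" and Q: "Q t B (I \<union> E)"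
    show "MW a t M B"
    proof (cases "card (hh B I E m) + \<phi> \<le> k + a")
      case True
      then show ?thesis using rgoal_if_few[OF st E _ tot _ Q] i by simp
    next
      case False
      then show ?thesis
        by (intro gain_step[OF Suc.prems(1,2) ng st E k D tot i Q _ Suc.prems(3)]) simp
    qed
  qed
qed

text \<open>With at most \<open>c\<close> harmful edges the deficit is at most
  \<open>2 * (c + \<phi>)\<close> half units; the additional 1 makes up for the absence of a
  pattern. Sufficiently many isolated vertices remove any such deficit.\<close>

theorem recover:
  assumes "\<not> fl" "0 < a" "\<rho> \<le> a" "st M B I E m" "card E = 2 * k" "1 \<le> k + \<rho>"
    "a * t + \<rho> = k + card I + s" "card (hh B I E m) \<le> c" "Q t B (I \<union> E)"
    "2 * c + 4 * a * (2 * (c + \<phi>) + 2) + 9 * a + 60 \<le> card I" "\<phi> \<le> a"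
  shows "MW \<rho> t M B"
proof -
  have "ngoal (2 * (c + \<phi>) + 1) \<rho> t" by (rule ngoal[OF rgoal[OF assms(1,2,11)] assms(3)])
  moreover have "deficit (2 * (c + \<phi>) + 1) \<rho> k (hh B I E m) I E m" using assms(8) by (auto simp: deficit_def)
  moreover have "2 * card (hh B I E m) + 4 * a * (2 * (c + \<phi>) + 1 + 1) + 2 * \<rho> + 7 * a + 60 \<le> card I"
    using assms(3,8,10) by simp
  ultimately show ?thesis using assms(4-9) by blast
qed

end

section \<open>Maker's strategy for two or more edges per move\<close>

lemma card_blocked_le:
  assumes "finite B" "inj_on f S"
  shows "card {i \<in> S. {p, f i} \<in> B} \<le> deg B p"
  unfolding deg_def
proof (rule card_inj_on_le)
  show "inj_on (\<lambda>i. {p, f i}) {i \<in> S. {p, f i} \<in> B}"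
    using assms(2) by (auto simp: inj_on_def doubleton_eq_iff)
qed (use assms(1) in auto)

lemma deg_Un_le: "finite B \<Longrightarrow> finite b \<Longrightarrow> deg (B \<union> b) u \<le> deg B u + card b"
proof -
  assume *: "finite B" "finite b"
  have "{h \<in> B \<union> b. u \<in> h} \<subseteq> {h \<in> B. u \<in> h} \<union> b" by auto
  then have "deg (B \<union> b) u \<le> card ({h \<in> B. u \<in> h} \<union> b)"
    unfolding deg_def using * by (intro card_mono) auto
  also have "\<dots> \<le> deg B u + card b" unfolding deg_def by (rule card_Un_le)
  finally show ?thesis .
qed

text \<open>Inclusion and exclusion, as two vertices share at most one edge.\<close>

lemma three_degrees:
  assumes fin: "finite B" and two: "\<And>h. h \<in> B \<Longrightarrow> card h = 2" and ne: "p \<noteq> q" "p \<noteq> u" "q \<noteq> u"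
  shows "deg B p + deg B q + deg B u \<le> card B + 3"
proof -
  define S where "S x = {h \<in> B. x \<in> h}" for x
  have finS: "finite (S x)" for x using fin by (simp add: S_def)
  have one: "card (S x \<inter> S y) \<le> 1" if "x \<noteq> y" for x y
  proof -
    have "h = {x, y}" if h: "h \<in> S x \<inter> S y" for h
    proof -
      have "{x, y} \<subseteq> h" "card h = 2" using h two by (auto simp: S_def)
      then show ?thesis using \<open>x \<noteq> y\<close> card_subset_eq[of h "{x, y}"] card.infinite[of h] by fastforce
    qed
    then have "S x \<inter> S y \<subseteq> {{x, y}}" by blast
    then show ?thesis using card_mono[of "{{x, y}}"] by fastforce
  qed
  have "(S p \<union> S q) \<inter> S u = (S p \<inter> S u) \<union> (S q \<inter> S u)" by blast
  then have "card ((S p \<union> S q) \<inter> S u) \<le> 2"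
    using card_Un_le[of "S p \<inter> S u" "S q \<inter> S u"] one[OF ne(2)] one[OF ne(3)] by simp
  moreover have "card (S p) + card (S q) = card (S p \<union> S q) + card (S p \<inter> S q)"
    by (rule card_Un_Int[OF finS finS])
  moreover have "card (S p \<union> S q) + card (S u) = card (S p \<union> S q \<union> S u) + card ((S p \<union> S q) \<inter> S u)"
    by (rule card_Un_Int) (use finS in auto)
  moreover have "card (S p \<union> S q \<union> S u) \<le> card B"
    by (rule card_mono[OF fin]) (auto simp: S_def)
  ultimately show ?thesis using one[OF ne(1)] by (simp add: deg_def S_def)
qed

lemma realizes_singletons: "realizes M V V (\<lambda>x. x)"
proof -
  have "path_system M V ((\<lambda>x. [x]) ` V)" by (auto simp: path_system_def)
  moreover have "ends_mate ((\<lambda>x. [x]) ` V) V (\<lambda>x. x)" by (auto simp: ends_mate_def)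
  ultimately show ?thesis by (auto simp: realizes_def)
qed

section \<open>Closing two paths, and closing one path with a spare edge\<close>

context phase
begin

lemma four_ends:
  assumes "st M B I E m" "card E = 4"
  shows "\<exists>u v. E = {u, m u, v, m v} \<and> u \<in> E \<and> v \<in> E \<and> v \<noteq> u \<and> v \<noteq> m u \<and> m v \<noteq> u \<and> m v \<noteq> m u"
proof -
  obtain u where u: "u \<in> E" using assms(2) by fastforce
  have "\<not> E \<subseteq> {u, m u}"
  proof
    assume "E \<subseteq> {u, m u}"
    then have "card E \<le> card {u, m u}" by (intro card_mono) auto
    then show False using assms(2) card_insert_le_m1[of 2 "{m u}" u] by simp
  qed
  then obtain v where v: "v \<in> E" "v \<noteq> u" "v \<noteq> m u" by blast
  have m: "m u \<in> E" "m v \<in> E" "m u \<noteq> u" "m v \<noteq> v" "m v \<noteq> u" "m v \<noteq> m u"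
    using st_E[OF assms(1) u] st_E[OF assms(1) v(1)] v by metis+
  have "card {u, m u, v, m v} = 4" using v m by auto
  then have "E = {u, m u, v, m v}"
    using card_subset_eq[OF st_finite(2)[OF assms(1)], of "{u, m u, v, m v}"] assms(2) u v m by auto
  then show ?thesis using u v m by blast
qed

lemma four_ends_free:
  assumes st: "st M B I E m" and "card E = 4" "card (hh B I E m) \<le> 3"
  shows "\<exists>u\<in>E. \<exists>v\<in>E. u \<noteq> v \<and> v \<noteq> m u \<and> {u, v} \<notin> hh B I E m"
proof (rule ccontr)
  assume neg: "\<not> ?thesis"
  obtain u v where uv: "E = {u, m u, v, m v}" "u \<in> E" "v \<in> E" "v \<noteq> u" "v \<noteq> m u" "m v \<noteq> u" "m v \<noteq> m u"
    using four_ends[OF assms(1,2)] by blast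
  have m: "m u \<in> E" "m v \<in> E" "m u \<noteq> u" "m v \<noteq> v" "m (m u) = u"
    using st_E[OF st uv(2)] st_E[OF st uv(3)] by auto
  have "{{u, v}, {u, m v}, {m u, v}, {m u, m v}} \<subseteq> hh B I E m"
    using neg uv(2-7) m by (metis empty_subsetI insert_subset)
  then have "card {{u, v}, {u, m v}, {m u, v}, {m u, m v}} \<le> card (hh B I E m)"
    by (intro card_mono st_finite(4)[OF st])
  moreover have "card {{u, v}, {u, m v}, {m u, v}, {m u, m v}} = 4"
    using uv(4-7) m by (simp add: doubleton_eq_iff)
  ultimately show False using assms(3) by simp
qed

text \<open>Two pairs of edges close two paths to a Hamilton cycle. These pairs are disjoint, so one
  harmful edge spoils only one of them.\<close>

lemma close_two_paths:
  assumes st: "st M B {} E m" and U: "U = {..<n}" and E: "card E = 4" and e: "card (hh B {} E m) \<le> 1"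
  shows "MW 2 0 M B"
proof -
  obtain u v where uv: "E = {u, m u, v, m v}" "u \<in> E" "v \<in> E" "v \<noteq> u" "v \<noteq> m u" "m v \<noteq> u" "m v \<noteq> m u"
    using four_ends[OF assms(1) E] by blast
  have m: "m u \<in> E" "m v \<in> E" "m u \<noteq> u" "m v \<noteq> v" "m (m u) = u" "m (m v) = v"
    using st_E[OF st uv(2)] st_E[OF st uv(3)] by auto
  have "realizes M U {u, m u, v, m v} m" using st uv(1) by (simp add: st_def)
  then obtain xs ys where xy: "xs \<noteq> []" "ys \<noteq> []" "distinct (xs @ ys)" "walk M xs" "walk M ys"
    "set xs \<union> set ys = {..<n}" "hd xs = u" "last xs = m u" "hd ys = v" "last ys = m v"
    using realizes_two[of M U u "m u" v "m v" m] uv m U by auto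
  have "E \<subseteq> {..<n}" using st_lt[OF st] by auto
  then have "4 \<le> card {..<n}" using card_mono[of "{..<n}" E] E by simp
  then have n: "3 \<le> n" by simp
  have lt: "u < n" "v < n" "m u < n" "m v < n" using st_lt[OF st] uv(2,3) m by auto
  have go: "MW 2 0 M B" if "r \<subseteq> X - B" "card r \<le> 2" "walk (M \<union> r) zs" "distinct zs" "set zs = {..<n}" "{last zs, hd zs} \<in> M \<union> r"
    for r zs
    using hamilton_cycle_if_closed_walk[OF that(3-5) n that(6)] that(1,2) unfolding mwin_def by auto
  show ?thesis
  proof (cases "{m u, v} \<notin> hh B {} E m \<and> {m v, u} \<notin> hh B {} E m")
    case True
    then have "{m u, v} \<notin> B" "{m v, u} \<notin> B" using free_edge[OF st] uv m by auto
    then have "{{m u, v}, {m v, u}} \<subseteq> X - B" using edge_in_X lt uv(4-7) by auto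
    moreover have "walk (M \<union> {{m u, v}, {m v, u}}) (xs @ ys)"
      using xy by (auto simp: walk_append elim: walk_mono)
    ultimately show ?thesis using xy
      by (intro go[of "{{m u, v}, {m v, u}}" "xs @ ys"]) (auto simp: card_insert_if)
  next
    case False
    have "{m u, m v} \<notin> hh B {} E m \<and> {v, u} \<notin> hh B {} E m"
    proof (rule ccontr)
      assume "\<not> ?thesis"
      then obtain h h' where h: "h \<in> {{m u, v}, {m v, u}}" "h' \<in> {{m u, m v}, {v, u}}" "h \<in> hh B {} E m" "h' \<in> hh B {} E m"
        using False by blast
      moreover have "{m u, v} \<noteq> {m u, m v}" "{m u, v} \<noteq> {v, u}" "{m v, u} \<noteq> {m u, m v}" "{m v, u} \<noteq> {v, u}"
        using uv(4-7) m(3,4) by (simp_all add: doubleton_eq_iff)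
      ultimately have "h \<noteq> h'" by blast
      then have "card {h, h'} = 2" by simp
      moreover have "card {h, h'} \<le> card (hh B {} E m)" using h st_finite(4)[OF st] by (intro card_mono) auto
      ultimately show False using e by simp
    qed
    then have "{m u, m v} \<notin> B" "{v, u} \<notin> B"
      using free_edge[OF st, of "m u" "m v"] free_edge[OF st, of v u] uv m by auto
    then have "{{m u, m v}, {v, u}} \<subseteq> X - B" using edge_in_X lt uv(4-7) by auto
    moreover have "walk (M \<union> {{m u, m v}, {v, u}}) (xs @ rev ys)"
      using xy by (auto simp: walk_append hd_rev elim: walk_mono)
    ultimately show ?thesis using xy
      by (intro go[of "{{m u, m v}, {v, u}}" "xs @ rev ys"]) (auto simp: card_insert_if last_rev)
  qed
qed

text \<open>Replacing the path edge from \<open>xs ! i\<close> to \<open>xs ! Suc i\<close> by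
  \<open>{p, xs ! Suc i}\<close> and \<open>{q, xs ! i}\<close> gives a Hamilton cycle. Of
  \<open>n - 3\<close> positions \<open>i\<close>, Breaker blocks at most
  \<open>deg B p + deg B q\<close>.\<close>

lemma rotate_path:
  assumes xs: "walk M xs" "distinct xs" "set xs = {..<n}" "hd xs = p" "last xs = q"
    and B: "B \<subseteq> X" and few: "deg B p + deg B q + 3 < n"
  shows "MW 2 0 M B"
proof -
  have len: "length xs = n" using xs(2,3) distinct_card by fastforce
  have fin: "finite B" using B finite_X finite_subset by blast
  have n: "3 < n" using few by simp
  have ne: "xs \<noteq> []" using n len by auto
  have pq: "xs ! 0 = p" "xs ! (n - 1) = q" using xs(4,5) ne len by (auto simp: hd_conv_nth last_conv_nth)
  let ?S = "{1..n - 3}"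
  let ?P = "{i \<in> ?S. {p, xs ! Suc i} \<in> B}" and ?Q = "{i \<in> ?S. {q, xs ! i} \<in> B}"
  have finS: "finite (?P \<union> ?Q)" by simp
  have "inj_on (\<lambda>i. xs ! i) ?S" "inj_on (\<lambda>i. xs ! Suc i) ?S"
    using n len by (auto intro!: inj_onI simp: nth_eq_iff_index_eq[OF xs(2)])
  then have "card ?Q \<le> deg B q" "card ?P \<le> deg B p" using card_blocked_le[OF fin] by blast+
  then have "card (?P \<union> ?Q) < card ?S" using card_Un_le[of ?P ?Q] few by simp
  then have "\<not> ?S \<subseteq> ?P \<union> ?Q" by (rule contrapos_pn) (simp only: not_less card_mono[OF finS])
  then obtain i where "i \<in> ?S" "i \<notin> ?P \<union> ?Q" by blast
  then have i: "1 \<le> i" "i \<le> n - 3" "{p, xs ! Suc i} \<notin> B" "{q, xs ! i} \<notin> B" by simp_all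
  let ?r = "{{p, xs ! Suc i}, {q, xs ! i}}"
  let ?A = "take (Suc i) xs" and ?D = "drop (Suc i) xs"
  have lt: "xs ! j < n" if "j < n" for j using xs(3) len that nth_mem by blast
  have dn: "xs ! j \<noteq> xs ! l" if "j < n" "l < n" "j \<noteq> l" for j l
    using nth_eq_iff_index_eq[OF xs(2)] that len by simp
  have ii: "i < n" "Suc i < n" "i \<noteq> n - 1" using i n by auto
  have "p < n" "q < n" "xs ! i < n" "xs ! Suc i < n" "p \<noteq> xs ! Suc i" "q \<noteq> xs ! i"
    using lt[of 0] lt[of "n - 1"] lt[of i] lt[of "Suc i"] dn[of 0 "Suc i"] dn[of "n - 1" i] pq n ii by auto
  then have r: "?r \<subseteq> X - B" using i(3,4) edge_in_X by blast
  have AD: "?A \<noteq> []" "?D \<noteq> []" "xs = ?A @ ?D" using i n len by auto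
  have w: "walk M ?A" "walk M ?D" using xs(1) AD(3) walk_append by metis+
  have ends: "hd ?A = p" "last ?A = xs ! i" "hd ?D = xs ! Suc i" "last ?D = q"
    using xs(4,5) ii n len ne by (simp_all add: last_drop hd_drop_conv_nth take_Suc_conv_app_nth hd_append hd_conv_nth)
  have "walk (M \<union> ?r) (?A @ rev ?D)"
    using w AD(1,2) ends by (auto simp: walk_append hd_rev insert_commute elim: walk_mono)
  moreover have "distinct (?A @ rev ?D)" "set (?A @ rev ?D) = {..<n}"
    using xs(2,3) AD(3) by (metis distinct_append distinct_rev set_rev, metis set_append set_rev)
  moreover have "{last (?A @ rev ?D), hd (?A @ rev ?D)} \<in> M \<union> ?r"
    using AD(1,2) ends by (auto simp: last_rev insert_commute)
  ultimately have "\<exists>F\<in>hamilton_cycles n. F \<subseteq> M \<union> ?r"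
    using hamilton_cycle_if_closed_walk n by (metis less_imp_le)
  then show ?thesis unfolding mwin_def using r by (intro exI[of _ ?r]) (auto simp: card_insert_if)
qed

lemma st_initial:
  assumes "b \<subseteq> X" "U = {..<n}" "M0 = {}"
  shows "st {} b {..<n} {} (\<lambda>x. x)"
  unfolding st_def using assms(1) realizes_singletons[of "{}" "{..<n}"] by (simp add: assms(2,3))

lemma hh_initial: "b \<subseteq> X \<Longrightarrow> card (hh b I E m) \<le> card b"
  by (rule card_mono) (auto simp: hh_def finite_subset)

end

section \<open>Maker wins in time for \<open>a \<ge> 3\<close> and for \<open>a = 2\<close>\<close>

lemma wins_three:
  assumes a: "3 \<le> a" and n: "2 * a + 4 * a * (2 * (a + 3) + 2) + 9 * a + 60 \<le> n"
    and tot: "a * t + \<rho> = n" "1 \<le> \<rho>" "\<rho> \<le> a"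
  shows "wins (complete_edges n) (hamilton_cycles n) a (Suc t) {} {}"
proof -
  interpret late n a False "{..<n}" "{}" 3 0 2 2 0 "\<lambda>_ _ _. True"
  proof unfold_locales
    fix M B E m
    assume "phase.st n {..<n} {} M B {} E m" "card E = 2 * 2" "card (phase.hh False B {} E m) + 3 \<le> 2 + 2"
    then show "mwin (complete_edges n) (hamilton_cycles n) a 2 0 M B"
      by (intro phase.close_two_paths[of n "{..<n}" "{}" M B E m False]) auto
  next
    fix \<rho> t k
    assume *: "1 \<le> \<rho>" "\<rho> \<le> a" "a * t + \<rho> = k + 0" "2 < k"
    show "\<rho> + 3 \<le> k + 3 \<and> 3 + 2 \<le> k + \<rho>"
    proof (cases t)
      case (Suc t')
      then show ?thesis using * a by auto
    qed (use * in auto)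
  qed (use a in auto)
  show ?thesis unfolding wins_Suc_iff
  proof (intro allI impI)
    fix b assume b: "b \<subseteq> X - ({} \<union> {}) \<and> card b \<le> a"
    then have bX: "b \<subseteq> X" by simp
    have "card (hh b {..<n} {} (\<lambda>x. x)) \<le> a" using hh_initial[OF bX] b le_trans by blast
    then have "MW \<rho> t {} b"
      by (intro recover[OF _ _ tot(3) st_initial[OF bX], where k = 0 and c = a]) (use a n tot in auto)
    \<comment> \<open>In her first move Maker uses only \<open>\<rho>\<close> edges, so that the
      remaining number is a multiple of \<open>a\<close> and all later moves are full.\<close>
    then show "MW a t {} ({} \<union> b)" using mwin_mono[OF _ tot(3)] by simp
  qed
qed

text \<open>Three paths, two edges now and two in the last move, one of them spare. The first link
  swallows the end \<open>u\<close> of largest Breaker degree; the two ends that remain then have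
  small total degree, and \<open>rotate_path\<close> applies.\<close>

lemma fin_two:
  assumes n: "60 \<le> n" and st: "phase.st n {..<n} {} M B {} E m" and E: "card E = 6"
    and e: "card (phase.hh False B {} E m) \<le> 3" and cB: "card B \<le> n"
  shows "mwin (complete_edges n) (hamilton_cycles n) 2 2 1 M B"
proof -
  interpret phase n 2 False "{..<n}" "{}" .
  have fin: "finite E" "finite B" using st_finite[OF st] by auto
  have BX: "B \<subseteq> X" using st by (simp add: st_def)
  obtain u where u: "u \<in> E" "\<And>x. x \<in> E \<Longrightarrow> deg B x \<le> deg B u"
    using finite_ne_induct obtains_MAX[of E "deg B"] fin E
    by (metis (no_types, lifting) Max_ge card.empty finite_imageI image_eqI obtains_MAX zero_neq_numeral)
  obtain v where v: "v \<in> E" "v \<noteq> u" "v \<noteq> m u" "{u, v} \<notin> hh B {} E m"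
    using exists_free_end[OF st u(1)] E e by auto
  let ?E = "E - {u, v}" and ?M = "insert {u, v} M"
  define m1 where "m1 = m(m u := m v, m v := m u)"
  note st1 = st_ee[OF st u(1) v(1) v(2)[symmetric] v(3,4), folded m1_def]
  have "card (hh B {} ?E m1) \<le> card (hh B {} E m)"
    using st1(2) st_finite(4)[OF st] by (intro card_mono) auto
  then have e1: "card (hh B {} ?E m1) \<le> 3" using e by simp
  have E1: "card ?E = 4" using E u v fin by (subst card_Diff_subset) auto
  obtain p q where pq: "p \<in> ?E" "q \<in> ?E" "p \<noteq> q" "q \<noteq> m1 p" "{p, q} \<notin> hh B {} ?E m1"
    using four_ends_free[OF st1(1) E1 e1] by blast
  let ?E2 = "?E - {p, q}" and ?M2 = "insert {p, q} ?M"
  define m2 where "m2 = m1(m1 p := m1 q, m1 q := m1 p)"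
  note st2 = st_ee[OF st1(1) pq, folded m2_def]
  have "card ?E2 = 2" using E1 pq fin by (subst card_Diff_subset) auto
  then obtain x where x: "x \<in> ?E2" by (metis card.empty ex_in_conv zero_neq_numeral)
  let ?y = "m2 x"
  have y: "?y \<in> ?E2" "?y \<noteq> x" "m2 ?y = x" using st_E[OF st2(1) x] by auto
  have "{x, ?y} \<subseteq> ?E2" using x y(1) by blast
  moreover have "card {x, ?y} = card ?E2" using y(2) \<open>card ?E2 = 2\<close> by simp
  moreover have "finite ?E2" using fin(1) by (intro finite_Diff)
  ultimately have E2: "?E2 = {x, ?y}" by (metis card_subset_eq)
  have "W 1 ?M2 B" unfolding One_nat_def wins_Suc_iff
  proof (intro allI impI)
    fix b assume b: "b \<subseteq> X - (?M2 \<union> B) \<and> card b \<le> 2"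
    have "realizes ?M2 {..<n} {x, ?y} m2" using st2(1) E2 by (simp add: st_def)
    then obtain xs where xs: "walk ?M2 xs" "distinct xs" "set xs = {..<n}" "hd xs = x" "last xs = ?y"
      using realizes_single[of ?M2 "{..<n}" x ?y m2] y by auto
    have xy: "x \<in> E" "?y \<in> E" "x \<noteq> u" "?y \<noteq> u" using x y by auto
    \<comment> \<open>As \<open>deg B u\<close> is the largest of the three,
      \<open>deg B x + deg B ?y\<close> is at most two thirds of \<open>card B + 3\<close>.\<close>
    have "deg B x + deg B ?y + deg B u \<le> card B + 3"
      by (rule three_degrees) (use fin BX y xy in \<open>auto simp: complete_edges_def\<close>)
    moreover have "deg B x \<le> deg B u" "deg B ?y \<le> deg B u" using u(2) xy by auto
    moreover have "finite b" using b finite_X finite_subset by (metis finite_Diff)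
    then have "deg (B \<union> b) x \<le> deg B x + 2" "deg (B \<union> b) ?y \<le> deg B ?y + 2"
      using deg_Un_le[OF fin(2), of b] b by (meson add_left_mono le_trans)+
    ultimately have "deg (B \<union> b) x + deg (B \<union> b) ?y + 3 < n" using cB n by linarith
    then show "MW 2 0 ?M2 (B \<union> b)"
      by (intro rotate_path[OF xs]) (use BX b in auto)
  qed
  then have w2: "MW 0 1 ?M2 B" by (rule mwin_0)
  have w1: "MW (Suc 0) 1 ?M B" by (rule link_MW[OF st1(1) _ _ pq(3-5) w2]) (use pq in auto)
  have "MW (Suc (Suc 0)) 1 M B" by (rule link_MW[OF st _ _ v(2)[symmetric] v(3,4) w1]) (use u v in auto)
  then show ?thesis by (simp add: numeral_2_eq_2)
qed

lemma wins_two: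
  assumes n: "500 \<le> n" and tot: "2 * t + \<rho> = n + 1" "1 \<le> \<rho>" "\<rho> \<le> 2"
  shows "wins (complete_edges n) (hamilton_cycles n) 2 (Suc t) {} {}"
proof -
  interpret late n 2 False "{..<n}" "{}" 2 1 3 2 1 "\<lambda>t B _. card B + 2 * t \<le> n + 2"
  proof unfold_locales
    fix M B E m
    assume "phase.st n {..<n} {} M B {} E m" "card E = 2 * 3" "card (phase.hh False B {} E m) + 2 \<le> 3 + 2"
      "card B + 2 * 1 \<le> n + 2"
    then show "mwin (complete_edges n) (hamilton_cycles n) 2 2 1 M B"
      using n by (intro fin_two) auto
  next
    fix t :: nat and B b :: "nat set set"
    assume "card B + 2 * Suc t \<le> n + 2" "card b \<le> 2"
    then show "card (B \<union> b) + 2 * t \<le> n + 2" using card_Un_le[of B b] by simp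
  qed auto
  show ?thesis unfolding wins_Suc_iff
  proof (intro allI impI)
    fix b assume b: "b \<subseteq> X - ({} \<union> {}) \<and> card b \<le> 2"
    then have bX: "b \<subseteq> X" by simp
    have "card (hh b {..<n} {} (\<lambda>x. x)) \<le> 2" using hh_initial[OF bX] b le_trans by blast
    then have "MW \<rho> t {} b"
      by (intro recover[OF _ _ tot(3) st_initial[OF bX], where k = 0 and c = 2]) (use b n tot in auto)
    then show "MW 2 t {} ({} \<union> b)" using mwin_mono[OF _ tot(3)] by simp
  qed
qed

section \<open>Breaker's strategies\<close>

lemma maker_claimed_card:
  assumes "strategy X a \<sigma>" "strategy X a \<beta>"
  shows "card (maker_claimed \<beta> \<sigma> t) \<le> a * t"
proof -
  have "card (maker_claimed \<beta> \<sigma> t) \<le> (\<Sum>i<t. card (play \<beta> \<sigma> (2 * t) ! (2 * i + 1)))"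
    unfolding maker_claimed_def by (rule card_UN_le) simp
  also have "\<dots> \<le> (\<Sum>i<t. a)"
  proof (rule sum_mono)
    fix i assume "i \<in> {..<t}"
    then have "play \<beta> \<sigma> (2 * t) ! (2 * i + 1) = \<sigma> (play \<beta> \<sigma> (2 * i + 1))" by (subst nth_play) auto
    then show "card (play \<beta> \<sigma> (2 * t) ! (2 * i + 1)) \<le> a"
      using assms(1) by (simp add: strategy_def legal_move_def del: play.simps)
  qed
  finally show ?thesis by (simp add: mult.commute)
qed

lemma strategy_exists: "finite X \<Longrightarrow> \<exists>\<beta>. strategy X a \<beta>"
  unfolding strategy_def using legal_exists by metis

lemma not_maker_wins_if_few:
  assumes "finite X" "\<And>F. F \<in> \<F> \<Longrightarrow> finite F \<Longrightarrow> a * t < card F" "\<And>F. F \<in> \<F> \<Longrightarrow> finite F"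
  shows "\<not> maker_wins_within X \<F> a t"
proof
  assume "maker_wins_within X \<F> a t"
  then obtain \<sigma> where s: "strategy X a \<sigma>" "\<And>\<beta>. strategy X a \<beta> \<Longrightarrow> \<exists>F\<in>\<F>. F \<subseteq> maker_claimed \<beta> \<sigma> t"
    by (auto simp: maker_wins_within_def)
  obtain \<beta> where b: "strategy X a \<beta>" using strategy_exists[OF assms(1)] by blast
  obtain F where F: "F \<in> \<F>" "F \<subseteq> maker_claimed \<beta> \<sigma> t" using s(2)[OF b] by blast
  have "finite (maker_claimed \<beta> \<sigma> t)"
  proof (rule finite_subset[OF _ assms(1)])
    show "maker_claimed \<beta> \<sigma> t \<subseteq> X"
      unfolding maker_claimed_def
    proof (rule UN_least)
      fix i assume "i \<in> {..<t}"
      then have "play \<beta> \<sigma> (2 * t) ! (2 * i + 1) = \<sigma> (play \<beta> \<sigma> (2 * i + 1))" by (subst nth_play) auto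
      then show "play \<beta> \<sigma> (2 * t) ! (2 * i + 1) \<subseteq> X"
        using s(1) by (auto simp add: strategy_def legal_move_def free_def simp del: play.simps)
    qed
  qed
  then have "card F \<le> a * t"
    using card_mono[OF _ F(2)] maker_claimed_card[OF s(1) b, of t] by linarith
  then show False using assms(2,3)[OF F(1)] by simp
qed

text \<open>What counts is Breaker's answer to Maker's first \<open>s\<close> moves: he takes a set
  \<open>D\<close> that no completion within one move can avoid.\<close>

lemma not_maker_wins_if_block:
  assumes fin: "finite X"
    and block: "\<And>M. finite M \<Longrightarrow> card M \<le> a * s \<Longrightarrow> \<exists>D. finite D \<and> card D \<le> a \<and>
      (\<forall>R F. finite R \<longrightarrow> card R \<le> a \<longrightarrow> R \<inter> M = {} \<longrightarrow> R \<inter> D = {} \<longrightarrow> F \<in> \<F> \<longrightarrow> \<not> F \<subseteq> M \<union> R)"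
  shows "\<not> maker_wins_within X \<F> a (Suc s)"
proof
  assume "maker_wins_within X \<F> a (Suc s)"
  then obtain \<sigma> where s: "strategy X a \<sigma>" "\<And>\<beta>. strategy X a \<beta> \<Longrightarrow> \<exists>F\<in>\<F>. F \<subseteq> maker_claimed \<beta> \<sigma> (Suc s)"
    by (auto simp: maker_wins_within_def)
  \<comment> \<open>Meant for histories of length at least \<open>2 * s\<close>. On shorter ones the
    lookups are unspecified and Breaker makes some legal move.\<close>
  define mk where "mk h = (\<Union>i<s. h ! (2 * i + 1))" for h :: "'a set list"
  define D where "D M = (SOME D. finite D \<and> card D \<le> a \<and>
      (\<forall>R F. finite R \<longrightarrow> card R \<le> a \<longrightarrow> R \<inter> M = {} \<longrightarrow> R \<inter> D = {} \<longrightarrow> F \<in> \<F> \<longrightarrow> \<not> F \<subseteq> M \<union> R))" for M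
  have D: "finite (D M) \<and> card (D M) \<le> a \<and>
      (\<forall>R F. finite R \<longrightarrow> card R \<le> a \<longrightarrow> R \<inter> M = {} \<longrightarrow> R \<inter> D M = {} \<longrightarrow> F \<in> \<F> \<longrightarrow> \<not> F \<subseteq> M \<union> R)"
    if "finite M" "card M \<le> a * s" for M
    unfolding D_def by (rule someI_ex) (rule block[OF that])
  define ok where "ok h m \<longleftrightarrow> legal_move X a h m \<and>
      (finite (mk h) \<and> card (mk h) \<le> a * s \<longrightarrow> D (mk h) \<inter> free X h \<subseteq> m)" for h m
  have "\<exists>m. ok h m" for h
  proof (cases "finite (mk h) \<and> card (mk h) \<le> a * s")
    case True
    then have "finite (D (mk h))" "card (D (mk h)) \<le> a" using D by auto
    then have "card (D (mk h) \<inter> free X h) \<le> a" using card_mono[of "D (mk h)" "D (mk h) \<inter> free X h"] by auto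
    then show ?thesis using legal_superset[OF fin, of "D (mk h) \<inter> free X h" h a] by (auto simp: ok_def)
  next
    case False
    then show ?thesis using legal_exists[OF fin] by (auto simp: ok_def)
  qed
  then obtain \<beta> where \<beta>: "\<And>h. ok h (\<beta> h)" by metis
  then have b: "strategy X a \<beta>" by (auto simp: strategy_def ok_def)
  define h where "h = play \<beta> \<sigma> (2 * s)"
  define R where "R = \<sigma> (play \<beta> \<sigma> (2 * s + 1))"
  have h_nth: "h ! (2 * i + 1) = \<sigma> (play \<beta> \<sigma> (2 * i + 1))" if "i < s" for i
    unfolding h_def using that by (subst nth_play) auto
  have h1: "play \<beta> \<sigma> (2 * s + 1) = h @ [\<beta> h]" by (simp add: h_def)
  have big: "play \<beta> \<sigma> (2 * Suc s) ! (2 * i + 1) = \<sigma> (play \<beta> \<sigma> (2 * i + 1))" if "i < Suc s" for i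
    using that by (subst nth_play) (auto simp del: play.simps)
  have claimed: "maker_claimed \<beta> \<sigma> (Suc s) = mk h \<union> R"
  proof -
    have "maker_claimed \<beta> \<sigma> (Suc s) = (\<Union>i<Suc s. \<sigma> (play \<beta> \<sigma> (2 * i + 1)))"
      unfolding maker_claimed_def by (rule SUP_cong) (use big in \<open>auto simp del: play.simps\<close>)
    also have "\<dots> = (\<Union>i<s. \<sigma> (play \<beta> \<sigma> (2 * i + 1))) \<union> R"
      by (simp add: lessThan_Suc R_def Un_commute del: play.simps)
    also have "(\<Union>i<s. \<sigma> (play \<beta> \<sigma> (2 * i + 1))) = mk h"
      unfolding mk_def by (rule SUP_cong) (use h_nth in \<open>auto simp del: play.simps\<close>)
    finally show ?thesis .
  qed
  have mk_claimed: "mk h = maker_claimed \<beta> \<sigma> s"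
    unfolding mk_def maker_claimed_def h_def ..
  then have cM: "card (mk h) \<le> a * s" using maker_claimed_card[OF s(1) b] by simp
  have subs: "\<sigma> h' \<subseteq> X" for h' using s(1) by (auto simp: strategy_def legal_move_def free_def)
  have mkX: "mk h \<subseteq> X" unfolding mk_def by (rule UN_least) (use h_nth subs in auto)
  have finM: "finite (mk h)" using mkX fin finite_subset by blast
  have legR: "legal_move X a (h @ [\<beta> h]) R" using s(1) unfolding R_def h1 by (simp add: strategy_def)
  then have R: "R \<subseteq> X" "card R \<le> a" "R \<inter> \<Union>(set h) = {}" "R \<inter> \<beta> h = {}"
    by (auto simp: legal_move_def free_def)
  have "mk h \<subseteq> \<Union>(set h)" unfolding mk_def
  proof (rule UN_least)
    fix i assume "i \<in> {..<s}"
    then have "h ! (2 * i + 1) \<in> set h" by (intro nth_mem) (simp add: h_def)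
    then show "h ! (2 * i + 1) \<subseteq> \<Union>(set h)" by blast
  qed
  then have RM: "R \<inter> mk h = {}" using R(3) by blast
  have "D (mk h) \<inter> free X h \<subseteq> \<beta> h" using \<beta>[of h] finM cM by (simp add: ok_def)
  moreover have "R \<subseteq> free X h" using R(1,3) by (auto simp: free_def)
  ultimately have "R \<inter> D (mk h) = {}" using R(4) by blast
  moreover have "finite R" using R(1) fin finite_subset by blast
  ultimately have "\<And>F. F \<in> \<F> \<Longrightarrow> \<not> F \<subseteq> mk h \<union> R" using D[OF finM cM] R(2) RM by blast
  then show False using s(2)[OF b] claimed by auto
qed

section \<open>Hamilton cycles: rotations, degrees and cuts\<close>

lemma cycle_edges_inj:
  assumes "distinct vs" "3 \<le> length vs"
  shows "inj_on (\<lambda>i. {vs ! i, vs ! (Suc i mod length vs)}) {..<length vs}"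
proof (rule inj_onI)
  fix i j assume ij: "i \<in> {..<length vs}" "j \<in> {..<length vs}"
    "{vs ! i, vs ! (Suc i mod length vs)} = {vs ! j, vs ! (Suc j mod length vs)}"
  have lt: "Suc k mod length vs < length vs" for k using assms(2) by (intro mod_less_divisor) linarith
  have eq: "vs ! k = vs ! l \<longleftrightarrow> k = l" if "k < length vs" "l < length vs" for k l
    using nth_eq_iff_index_eq[OF assms(1) that] .
  show "i = j"
  proof (rule ccontr)
    assume "i \<noteq> j"
    then have *: "i = Suc j mod length vs" "j = Suc i mod length vs"
      using ij lt[of i] lt[of j] by (auto simp: doubleton_eq_iff eq)
    show False
    proof (cases "Suc j < length vs")
      case True
      then have i: "i = Suc j" using *(1) by simp
      show False
      proof (cases "Suc (Suc j) < length vs")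
        case True
        then have "Suc (Suc j) mod length vs = Suc (Suc j)" by (rule mod_less)
        then have "j = Suc (Suc j)" using *(2) i by metis
        then show False by linarith
      next
        case False
        then have l: "Suc (Suc j) = length vs" using \<open>Suc j < length vs\<close> by simp
        then have "Suc (Suc j) mod length vs = 0" by simp
        then have "j = 0" using *(2) i by metis
        then show False using l assms(2) by simp
      qed
    next
      case False
      then have l: "Suc j = length vs" using ij by auto
      then have "Suc j mod length vs = 0" by simp
      then have "i = 0" using *(1) by metis
      moreover have "Suc 0 mod length vs = Suc 0" using assms(2) by (intro mod_less) linarith
      ultimately have "j = Suc 0" using *(2) by metis
      then show False using l assms(2) by simp
    qed
  qed
qed

lemma card_cycle_edges:
  assumes "distinct vs" "3 \<le> length vs"
  shows "card (cycle_edges vs) = length vs"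
proof -
  have "cycle_edges vs = (\<lambda>i. {vs ! i, vs ! (Suc i mod length vs)}) ` {..<length vs}"
    by (auto simp: cycle_edges_def)
  then show ?thesis using card_image[OF cycle_edges_inj[OF assms]] by simp
qed

lemma finite_cycle_edges: "finite (cycle_edges vs)"
  by (simp add: cycle_edges_def)

lemma cycle_edges_rotate1:
  assumes "vs \<noteq> []"
  shows "cycle_edges (rotate1 vs) = cycle_edges vs"
proof -
  let ?l = "length vs"
  have l: "0 < ?l" using assms by simp
  have n: "rotate1 vs ! i = vs ! (Suc i mod ?l)" if "i < ?l" for i using nth_rotate1[OF that] .
  have "cycle_edges (rotate1 vs) = (\<lambda>i. {rotate1 vs ! i, rotate1 vs ! (Suc i mod ?l)}) ` {..<?l}"
    by (auto simp: cycle_edges_def)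
  also have "\<dots> = (\<lambda>i. {vs ! (Suc i mod ?l), vs ! (Suc (Suc i mod ?l) mod ?l)}) ` {..<?l}"
    by (rule image_cong) (use n l in auto)
  also have "\<dots> = (\<lambda>i. {vs ! i, vs ! (Suc i mod ?l)}) ` ((\<lambda>i. Suc i mod ?l) ` {..<?l})"
    by (auto simp: image_image)
  also have "(\<lambda>i. Suc i mod ?l) ` {..<?l} = {..<?l}"
  proof (rule endo_inj_surj)
    show "inj_on (\<lambda>i. Suc i mod ?l) {..<?l}"
      by (auto simp: inj_on_def mod_Suc split: if_splits)
  qed (use l in auto)
  also have "(\<lambda>i. {vs ! i, vs ! (Suc i mod ?l)}) ` {..<?l} = cycle_edges vs"
    by (auto simp: cycle_edges_def)
  finally show ?thesis .
qed

lemma cycle_edges_rotate: "vs \<noteq> [] \<Longrightarrow> cycle_edges (rotate k vs) = cycle_edges vs"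
proof (induction k)
  case (Suc k)
  have "rotate k vs \<noteq> []" using Suc.prems by simp
  from cycle_edges_rotate1[OF this] show ?case using Suc by simp
qed simp

text \<open>After a rotation \<open>v\<close> is the last vertex, so its edges are those with
  indices \<open>length vs - 2\<close> and \<open>length vs - 1\<close>.\<close>

lemma cycle_deg:
  assumes "distinct vs" "3 \<le> length vs" "v \<in> set vs"
  shows "deg (cycle_edges vs) v = 2"
proof -
  obtain i where i: "i < length vs" "v = vs ! i" using assms(3) by (auto simp: in_set_conv_nth)
  define ws where "ws = rotate (Suc i) vs"
  let ?l = "length vs"
  have ne: "vs \<noteq> []" using assms(2) by auto
  have ws: "distinct ws" "length ws = ?l" "cycle_edges ws = cycle_edges vs"
    unfolding ws_def using assms(1) cycle_edges_rotate[OF ne] by (simp_all del: rotate_Suc)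
  have last: "ws ! (?l - 1) = v"
  proof -
    have "?l - 1 < ?l" using assms(2) by simp
    then have "ws ! (?l - 1) = vs ! ((Suc i + (?l - 1)) mod ?l)" unfolding ws_def by (rule nth_rotate)
    also have "(Suc i + (?l - 1)) mod ?l = i"
    proof -
      have "Suc i + (?l - 1) = i + ?l" using assms(2) by linarith
      then show ?thesis using i(1) by simp
    qed
    finally show ?thesis using i by simp
  qed
  have idx: "ws ! j = v \<longleftrightarrow> j = ?l - 1" if "j < ?l" for j
    using nth_eq_iff_index_eq[OF ws(1), of j "?l - 1"] that ws(2) last assms(2) by auto
  have "{h \<in> cycle_edges ws. v \<in> h} = (\<lambda>i. {ws ! i, ws ! (Suc i mod ?l)}) ` {?l - 2, ?l - 1}"
  proof -
    have "v \<in> {ws ! j, ws ! (Suc j mod ?l)} \<longleftrightarrow> j \<in> {?l - 2, ?l - 1}" if "j < ?l" for j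
    proof -
      have "Suc j mod ?l < ?l" using assms(2) by (intro mod_less_divisor) linarith
      then have "v \<in> {ws ! j, ws ! (Suc j mod ?l)} \<longleftrightarrow> j = ?l - 1 \<or> Suc j mod ?l = ?l - 1"
        using idx[OF that] idx[of "Suc j mod ?l"] by auto
      also have "\<dots> \<longleftrightarrow> j \<in> {?l - 2, ?l - 1}" using that assms(2) by (auto simp: mod_Suc)
      finally show ?thesis .
    qed
    note eqv = this
    have Collect_eqI: "{j \<in> A. P j} = S" if "\<And>j. j \<in> A \<Longrightarrow> P j \<longleftrightarrow> j \<in> S" "S \<subseteq> A" for A S :: "nat set" and P
      using that by blast
    have idxs: "{j \<in> {..<?l}. v \<in> {ws ! j, ws ! (Suc j mod ?l)}} = {?l - 2, ?l - 1}"
      by (rule Collect_eqI, rule eqv) (use assms(2) in auto)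
    have "cycle_edges ws = (\<lambda>i. {ws ! i, ws ! (Suc i mod ?l)}) ` {..<?l}"
      by (auto simp: cycle_edges_def ws(2))
    moreover have "{h \<in> g ` S. v \<in> h} = g ` {j \<in> S. v \<in> g j}" for g :: "nat \<Rightarrow> 'a set" and S by blast
    ultimately show ?thesis by (simp only: idxs)
  qed
  moreover have "inj_on (\<lambda>i. {ws ! i, ws ! (Suc i mod ?l)}) {?l - 2, ?l - 1}"
    by (rule inj_on_subset[OF cycle_edges_inj[of ws, unfolded ws(2)]]) (use ws assms(2) in auto)
  moreover have "card {?l - 2, ?l - 1} = 2" using assms(2) by auto
  ultimately show ?thesis unfolding deg_def ws(3)[symmetric] by (simp only: card_image)
qed

text \<open>If no edge left \<open>W\<close>, following the cycle from \<open>w\<close> would stay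
  in \<open>W\<close> and yet reach \<open>w'\<close>.\<close>

lemma cycle_crosses:
  assumes "distinct vs" "w \<in> set vs" "w \<in> W" "w' \<in> set vs" "w' \<notin> W"
  shows "\<exists>e\<in>cycle_edges vs. e \<inter> W \<noteq> {} \<and> \<not> e \<subseteq> W"
proof (rule ccontr)
  assume neg: "\<not> ?thesis"
  let ?l = "length vs"
  have step: "vs ! (Suc j mod ?l) \<in> W" if "j < ?l" "vs ! j \<in> W" for j
    using neg that by (auto simp: cycle_edges_def)
  obtain i where i: "i < ?l" "w = vs ! i" using assms(2) by (auto simp: in_set_conv_nth)
  obtain j where j: "j < ?l" "w' = vs ! j" using assms(4) by (auto simp: in_set_conv_nth)
  have "vs ! ((i + k) mod ?l) \<in> W" for k
  proof (induction k)
    case 0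
    then show ?case using i assms(3) by simp
  next
    case (Suc k)
    have "(i + k) mod ?l < ?l" using i by (intro mod_less_divisor) auto
    from step[OF this Suc] show ?case by (simp add: mod_Suc_eq)
  qed
  from this[of "?l - i + j"] have "vs ! j \<in> W" using i j by simp
  then show False using assms(5) j by simp
qed

lemma deg_Un_disjoint: "finite A \<Longrightarrow> finite B \<Longrightarrow> A \<inter> B = {} \<Longrightarrow> deg (A \<union> B) v = deg A v + deg B v"
proof -
  assume *: "finite A" "finite B" "A \<inter> B = {}"
  have "{h \<in> A \<union> B. v \<in> h} = {h \<in> A. v \<in> h} \<union> {h \<in> B. v \<in> h}" by auto
  then show ?thesis unfolding deg_def using * by (subst card_Un_disjoint[symmetric]) auto
qed

lemma deg_singleton [simp]: "deg {x} v = (if v \<in> x then 1 else 0)"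
proof -
  have "{h \<in> {x}. v \<in> h} = (if v \<in> x then {x} else {})" by auto
  then show ?thesis by (simp add: deg_def)
qed

lemma hamilton_cyclesE:
  assumes "F \<in> hamilton_cycles n"
  obtains vs where "F = cycle_edges vs" "distinct vs" "set vs = {..<n}" "length vs = n" "3 \<le> n"
proof -
  obtain vs where vs: "F = cycle_edges vs" "distinct vs" "set vs = {..<n}" "length vs \<ge> 3"
    using assms by (auto simp: hamilton_cycles_def)
  moreover have "length vs = n" using vs(2,3) distinct_card by fastforce
  ultimately show ?thesis using that by auto
qed

lemma hamilton_card: "F \<in> hamilton_cycles n \<Longrightarrow> finite F \<and> card F = n"
  by (elim hamilton_cyclesE) (simp add: card_cycle_edges finite_cycle_edges)

lemma hamilton_deg: "F \<in> hamilton_cycles n \<Longrightarrow> v < n \<Longrightarrow> deg F v = 2"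
  by (elim hamilton_cyclesE) (simp add: cycle_deg)

lemma hamilton_edge: "F \<in> hamilton_cycles n \<Longrightarrow> h \<in> F \<Longrightarrow> h \<subseteq> {..<n} \<and> card h = 2"
proof (elim hamilton_cyclesE)
  fix vs assume vs: "F = cycle_edges vs" "distinct vs" "set vs = {..<n}" "length vs = n" "3 \<le> n" and h: "h \<in> F"
  then obtain i where i: "i < n" "h = {vs ! i, vs ! (Suc i mod n)}" by (auto simp: cycle_edges_def)
  have "Suc i mod n < n" using vs(5) by (intro mod_less_divisor) simp
  moreover have "i \<noteq> Suc i mod n" using i vs(5) by (auto simp: mod_Suc)
  ultimately show ?thesis using vs i nth_mem[of _ vs] nth_eq_iff_index_eq[OF vs(2), of i "Suc i mod n"] by auto
qed

text \<open>\<open>card F = n\<close> leaves no slack: all edges of \<open>M\<close> and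
  \<open>R\<close> are used, so \<open>M\<close> determines the degrees of \<open>R\<close>.\<close>

lemma hamilton_split:
  assumes F: "F \<in> hamilton_cycles n" "F \<subseteq> M \<union> R" and fin: "finite M" "finite R"
    and c: "card M + c \<le> n" "card R \<le> c" and disj: "R \<inter> M = {}"
  shows "F = M \<union> R" "card R = c" and "\<And>v. v < n \<Longrightarrow> deg M v + deg R v = 2"
proof -
  have "card F = n" using hamilton_card[OF F(1)] by simp
  moreover have "card F \<le> card (M \<union> R)" using F(2) fin by (intro card_mono) auto
  moreover have "card (M \<union> R) = card M + card R" using disj fin by (subst card_Un_disjoint) auto
  ultimately have *: "card R = c" "card F = card (M \<union> R)" using c by auto
  then show "F = M \<union> R" using F(2) fin by (intro card_subset_eq) auto
  then show "deg M v + deg R v = 2" if "v < n" for v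
    using hamilton_deg[OF F(1) that] deg_Un_disjoint[of M R v] disj fin by auto
  show "card R = c" by (rule *)
qed

text \<open>The last edge must consist of exactly the vertices of degree 1 in \<open>M\<close>, so
  \<open>?f\<close> is the only candidate. If \<open>?f\<close> is not an edge, nothing completes
  \<open>M\<close>.\<close>

lemma lower_one: "\<not> maker_wins_within (complete_edges n) (hamilton_cycles n) 1 n" if "3 \<le> n"
proof -
  have "\<not> maker_wins_within (complete_edges n) (hamilton_cycles n) 1 (Suc (n - 1))"
  proof (rule not_maker_wins_if_block)
    show "finite (complete_edges n)" by (rule phase.finite_X)
    fix M :: "nat set set" assume M: "finite M" "card M \<le> 1 * (n - 1)"
    let ?f = "{v. v < n \<and> deg M v = 1}"
    have "\<not> F \<subseteq> M \<union> R" if R: "finite R" "card R \<le> 1" "R \<inter> M = {}" "R \<inter> {?f} = {}" and F: "F \<in> hamilton_cycles n" for R F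
    proof
      assume sub: "F \<subseteq> M \<union> R"
      have c: "card M + 1 \<le> n" using M(2) \<open>3 \<le> n\<close> by simp
      note sp = hamilton_split[OF F sub M(1) R(1) c R(2,3)]
      obtain f where f: "R = {f}" using sp(2) by (auto simp: card_1_singleton_iff)
      have fF: "f \<subseteq> {..<n}" using hamilton_edge[OF F, of f] sp(1) f by auto
      have "deg R v = (if v \<in> f then 1 else 0)" for v by (simp add: f)
      then have "v \<in> f \<longleftrightarrow> deg M v = 1" if "v < n" for v using sp(3)[OF that] by (auto split: if_splits)
      then have "f = ?f" using fF by auto
      then show False using R(4) f by auto
    qed
    then show "\<exists>D. finite D \<and> card D \<le> 1 \<and> (\<forall>R F. finite R \<longrightarrow> card R \<le> 1 \<longrightarrow> R \<inter> M = {} \<longrightarrow> R \<inter> D = {} \<longrightarrow>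
        F \<in> hamilton_cycles n \<longrightarrow> \<not> F \<subseteq> M \<union> R)"
      by (intro exI[of _ "{?f}"]) simp
  qed
  then show ?thesis using that by simp
qed

text \<open>\<open>M\<close> consists of two segments of \<open>F0\<close>, with ends
  \<open>p\<close>, \<open>r\<close> and \<open>s\<close>, \<open>q\<close>. A completing pair has
  the degrees of \<open>R0\<close>, so \<open>p\<close> is joined to \<open>q\<close>,
  \<open>s\<close> or \<open>r\<close>. Breaker takes the first two options; the third closes a
  cycle on the vertex set \<open>W\<close> of the first segment.\<close>

lemma block_two:
  assumes F0: "F0 \<in> hamilton_cycles n" "F0 \<subseteq> M \<union> R0" and M: "finite M" "card M + 2 \<le> n"
    and R0: "finite R0" "card R0 \<le> 2" "R0 \<inter> M = {}"
  shows "\<exists>D. finite D \<and> card D \<le> 2 \<and> (\<forall>R F. finite R \<longrightarrow> card R \<le> 2 \<longrightarrow> R \<inter> M = {} \<longrightarrow> R \<inter> D = {} \<longrightarrow>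
        F \<in> hamilton_cycles n \<longrightarrow> \<not> F \<subseteq> M \<union> R)"
proof -
  note sp0 = hamilton_split[OF F0 M(1) R0(1) M(2) R0(2,3)]
  obtain f g where fg: "R0 = {f, g}" "f \<noteq> g" using sp0(2) by (auto simp: card_2_iff)
  obtain us where us: "F0 = cycle_edges us" "distinct us" "set us = {..<n}" "length us = n" "3 \<le> n"
    using F0(1) by (rule hamilton_cyclesE)
  have "f \<in> cycle_edges us" using us(1) sp0(1) fg by auto
  then obtain j where j: "j < n" "f = {us ! j, us ! (Suc j mod n)}" using us(4) by (auto simp: cycle_edges_def)
  define vs where "vs = rotate (Suc j) us"
  have ne: "us \<noteq> []" using us(4,5) by auto
  have vs: "F0 = cycle_edges vs" "distinct vs" "set vs = {..<n}" "length vs = n"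
    unfolding vs_def using us cycle_edges_rotate[OF ne] by (simp_all del: rotate_Suc)
  have vsn: "vs ! k = us ! ((Suc j + k) mod n)" if "k < n" for k
    using nth_rotate[of k us "Suc j"] that us(4) by (simp add: vs_def)
  have eq: "vs ! k = vs ! l \<longleftrightarrow> k = l" if "k < n" "l < n" for k l
    using nth_eq_iff_index_eq[OF vs(2)] that vs(4) by simp
  have f: "f = {vs ! (n - 1), vs ! 0}"
  proof -
    have "Suc j + (n - 1) = j + n" using us(5) by linarith
    then have "(Suc j + (n - 1)) mod n = j" using j(1) by simp
    then show ?thesis using vsn[of "n - 1"] vsn[of 0] j us(5) by simp
  qed
  have "g \<in> cycle_edges vs" using vs(1) sp0(1) fg by auto
  then obtain i where i: "i < n" "g = {vs ! i, vs ! (Suc i mod n)}" using vs(4) by (auto simp: cycle_edges_def)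
  have "i \<noteq> n - 1" using i(2) f fg(2) us(5) by auto
  then have i1: "Suc i < n" using i(1) by simp
  then have g: "g = {vs ! i, vs ! Suc i}" using i(2) by simp
  define p q r s where "p = vs ! 0" and "q = vs ! (n - 1)" and "r = vs ! i" and "s = vs ! Suc i"
  define W where "W = {vs ! k | k. k \<le> i}"
  have pW: "p \<in> W" "r \<in> W" by (auto simp: W_def p_def r_def)
  have qW: "q \<notin> W" "s \<notin> W" using i1 us(5) by (auto simp: W_def q_def s_def eq)
  have noM: "h \<subseteq> W \<or> h \<inter> W = {}" if "h \<in> M" for h
  proof -
    have "h \<in> cycle_edges vs" using that sp0(1) vs(1) by auto
    then obtain k where k: "k < n" "h = {vs ! k, vs ! (Suc k mod n)}" using vs(4) by (auto simp: cycle_edges_def)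
    have "h \<noteq> f" "h \<noteq> g" using that R0(3) fg by auto
    then have "k \<noteq> n - 1" "k \<noteq> i" using k f g i1 us(5) by auto
    then have "h = {vs ! k, vs ! Suc k}" "Suc k < n" using k by auto
    then show ?thesis using \<open>k \<noteq> i\<close> i1 by (cases "k < i") (auto simp: W_def eq)
  qed
  have degR0: "deg R0 v = (if v \<in> f then 1 else 0) + (if v \<in> g then 1 else 0)" for v
  proof -
    have "deg ({f} \<union> {g}) v = deg {f} v + deg {g} v" using fg(2) by (intro deg_Un_disjoint) auto
    then show ?thesis using fg(1) by (simp add: insert_commute)
  qed
  let ?D = "{f, {p, s}}"
  have "\<not> F \<subseteq> M \<union> R" if R: "finite R" "card R \<le> 2" "R \<inter> M = {}" "R \<inter> ?D = {}" and F: "F \<in> hamilton_cycles n" for R F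
  proof
    assume sub: "F \<subseteq> M \<union> R"
    note sp = hamilton_split[OF F sub M(1) R(1) M(2) R(2,3)]
    have dR: "deg R v = deg R0 v" if "v < n" for v using sp(3)[OF that] sp0(3)[OF that] by simp
    have lt: "p < n" "q < n" "r < n" "s < n"
      using vs(3,4) i1 us(5) nth_mem[of _ vs] by (auto simp: p_def q_def r_def s_def)
    have pn: "p \<noteq> q" "p \<noteq> s" "r \<noteq> q" "r \<noteq> s" using pW qW by auto
    have fp: "f = {q, p}" "g = {r, s}" using f g by (auto simp: p_def q_def r_def s_def)
    have RE: "h \<subseteq> {..<n}" "card h = 2" if "h \<in> R" for h using hamilton_edge[OF F] sp(1) that by auto
    have sup: "x \<in> {p, q, r, s}" if "h \<in> R" "x \<in> h" for h x
    proof -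
      have "0 < deg R x" using deg_pos_iff[OF R(1)] that by blast
      moreover have "x < n" using RE(1)[OF that(1)] that(2) by auto
      ultimately show ?thesis using dR[of x] degR0[of x] fp by (auto split: if_splits)
    qed
    have "0 < deg R p" using dR[OF lt(1)] degR0[of p] fp by simp
    then obtain h where h: "h \<in> R" "p \<in> h" using deg_pos_iff[OF R(1)] by auto
    obtain z where z: "h = {p, z}" "z \<noteq> p" using RE(2)[OF h(1)] h(2) by (auto simp: card_2_iff)
    have "z \<noteq> q" "z \<noteq> s" using R(4) h(1) z fp by (auto simp: insert_commute)
    then have zr: "z = r" "r \<noteq> p" using sup[OF h(1), of z] z by auto
    obtain h' where h': "R = {h, h'}" "h' \<noteq> h" using sp(2) h(1) by (auto simp: card_2_iff)
    have degR: "deg R v = (if v \<in> h then 1 else 0) + (if v \<in> h' then 1 else 0)" for v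
    proof -
      have "deg ({h} \<union> {h'}) v = deg {h} v + deg {h'} v" using h'(2) by (intro deg_Un_disjoint) auto
      then show ?thesis using h'(1) by (simp add: insert_commute)
    qed
    have "p \<notin> h'" using degR[of p] dR[OF lt(1)] degR0[of p] fp h pn zr(2) by (auto split: if_splits)
    moreover have "r \<notin> h'" using degR[of r] dR[OF lt(3)] degR0[of r] fp z zr pn by (auto split: if_splits)
    ultimately have "h' \<inter> W = {}" using sup[of h'] h' qW by auto
    moreover have "h \<subseteq> W" using z zr pW by auto
    ultimately have noF: "e \<subseteq> W \<or> e \<inter> W = {}" if "e \<in> F" for e using that sp(1) noM h'(1) by auto
    obtain ws where ws: "F = cycle_edges ws" "distinct ws" "set ws = {..<n}" using F by (rule hamilton_cyclesE)
    show False using cycle_crosses[OF ws(2), of p W q] noF pW qW lt ws by auto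
  qed
  then show ?thesis by (intro exI[of _ ?D]) (simp add: card_insert_if)
qed

lemma lower_two: "\<not> maker_wins_within (complete_edges n) (hamilton_cycles n) 2 (n div 2)" if "4 \<le> n" "even n"
proof -
  have "\<not> maker_wins_within (complete_edges n) (hamilton_cycles n) 2 (Suc (n div 2 - 1))"
  proof (rule not_maker_wins_if_block)
    show "finite (complete_edges n)" by (rule phase.finite_X)
    fix M :: "nat set set" assume M: "finite M" "card M \<le> 2 * (n div 2 - 1)"
    have c: "card M + 2 \<le> n" using M(2) that by (auto elim!: evenE)
    show "\<exists>D. finite D \<and> card D \<le> 2 \<and> (\<forall>R F. finite R \<longrightarrow> card R \<le> 2 \<longrightarrow> R \<inter> M = {} \<longrightarrow> R \<inter> D = {} \<longrightarrow>
        F \<in> hamilton_cycles n \<longrightarrow> \<not> F \<subseteq> M \<union> R)"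
    proof (cases "\<exists>R0 F0. finite R0 \<and> card R0 \<le> 2 \<and> R0 \<inter> M = {} \<and> F0 \<in> hamilton_cycles n \<and> F0 \<subseteq> M \<union> R0")
      case True
      then obtain R0 F0 where "finite R0" "card R0 \<le> 2" "R0 \<inter> M = {}" "F0 \<in> hamilton_cycles n" "F0 \<subseteq> M \<union> R0"
        by (elim exE conjE)
      then show ?thesis by (intro block_two[OF _ _ M(1) c])
    next
      case False
      then show ?thesis by (intro exI[of _ "{}"]) auto
    qed
  qed
  then show ?thesis using that by simp
qed

lemma lower_count: "a * t < n \<Longrightarrow> \<not> maker_wins_within (complete_edges n) (hamilton_cycles n) a t"
  by (rule not_maker_wins_if_few[OF phase.finite_X]) (use hamilton_card in auto)

section \<open>One edge per move: the last moves\<close>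

text \<open>Each of at most four vertices blocks at most \<open>\<tau>\<close> positions, and each
  blocked position excludes at most three values of \<open>j\<close>: hence
  \<open>12 * \<tau>\<close>.\<close>

lemma exists_clear_index:
  assumes "finite B" "distinct xs" "finite Z" "card Z \<le> 4" "\<And>z. z \<in> Z \<Longrightarrow> deg B z \<le> \<tau>" "12 * \<tau> + 8 \<le> length xs"
  shows "\<exists>j. 2 \<le> j \<and> j + 3 \<le> length xs \<and>
    (\<forall>z\<in>Z. {z, xs ! (j - 1)} \<notin> B \<and> {z, xs ! j} \<notin> B \<and> {z, xs ! Suc j} \<notin> B)"
proof -
  define N where "N = (\<Union>z\<in>Z. {i \<in> {..<length xs}. {z, xs ! i} \<in> B})"
  have finN: "finite N" using assms(3) by (auto simp: N_def)
  have "inj_on (\<lambda>i. xs ! i) {..<length xs}" using assms(2) by (simp add: inj_on_nth)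
  then have le: "card {i \<in> {..<length xs}. {z, xs ! i} \<in> B} \<le> deg B z" for z
    by (rule card_blocked_le[OF assms(1)])
  have "card N \<le> (\<Sum>z\<in>Z. card {i \<in> {..<length xs}. {z, xs ! i} \<in> B})"
    unfolding N_def by (rule card_UN_le[OF assms(3)])
  also have "\<dots> \<le> (\<Sum>z\<in>Z. \<tau>)" by (rule sum_mono) (use le assms(5) le_trans in blast)
  also have "\<dots> \<le> 4 * \<tau>" using assms(4) by simp
  finally have cN: "card N \<le> 4 * \<tau>" .
  define N3 where "N3 = N \<union> Suc ` N \<union> (\<lambda>i. i - 1) ` N"
  have fin3: "finite N3" using finN by (simp add: N3_def)
  have "card N3 \<le> card N + card (Suc ` N) + card ((\<lambda>i. i - 1) ` N)"
    unfolding N3_def by (meson card_Un_le le_trans add_le_mono1)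
  moreover have "card (Suc ` N) \<le> card N" "card ((\<lambda>i. i - 1) ` N) \<le> card N"
    using card_image_le[OF finN] by blast+
  ultimately have "card N3 \<le> 12 * \<tau>" using cN by linarith
  then have "card N3 < card {2..length xs - 3}" using assms(6) by simp
  then have "\<not> {2..length xs - 3} \<subseteq> N3" by (rule contrapos_pn) (simp only: not_less card_mono[OF fin3])
  then obtain j where "j \<in> {2..length xs - 3}" "j \<notin> N3" by blast
  then have "2 \<le> j" "j \<le> length xs - 3" "j \<notin> N3" by simp_all
  then have j: "2 \<le> j" "j + 3 \<le> length xs" "j \<notin> N3" using assms(6) by linarith+
  have "j \<notin> N" using j(3) by (simp add: N3_def)
  moreover have "j - 1 \<notin> N"
  proof
    assume "j - 1 \<in> N"
    then have "Suc (j - 1) \<in> N3" by (simp add: N3_def)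
    then show False using j by simp
  qed
  moreover have "Suc j \<notin> N"
  proof
    assume "Suc j \<in> N"
    then have "Suc j - 1 \<in> N3" unfolding N3_def by blast
    then show False using j by simp
  qed
  ultimately show ?thesis using j(1,2) by (intro exI[of _ j]) (auto simp: N_def)
qed

lemma split_at:
  assumes "distinct xs" "1 \<le> j" "Suc j < length xs"
  shows "\<exists>A D. xs = A @ [xs ! j] @ D \<and> A \<noteq> [] \<and> D \<noteq> [] \<and> last A = xs ! (j - 1) \<and> hd D = xs ! Suc j
    \<and> length A = j \<and> length D = length xs - Suc j"
proof -
  have "xs = take j xs @ [xs ! j] @ drop (Suc j) xs" using assms(3) by (simp add: Cons_nth_drop_Suc)
  moreover have "last (take j xs) = xs ! (j - 1)"
    using assms(2,3) by (subst last_conv_nth) auto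
  ultimately show ?thesis using assms(2,3)
    by (intro exI[of _ "take j xs"] exI[of _ "drop (Suc j) xs"]) (auto simp: hd_drop_conv_nth)
qed

text \<open>After \<open>e1\<close> both \<open>e2\<close> and \<open>e3\<close> win, and Breaker
  can claim only one.\<close>

lemma two_threats:
  assumes "{e1, e2, e3} \<subseteq> complete_edges n - B" "e2 \<noteq> e3"
    and "\<exists>F\<in>hamilton_cycles n. F \<subseteq> M \<union> {e1, e2}" "\<exists>F\<in>hamilton_cycles n. F \<subseteq> M \<union> {e1, e3}"
  shows "mwin (complete_edges n) (hamilton_cycles n) 1 1 1 M B"
proof -
  let ?X = "complete_edges n" and ?F = "hamilton_cycles n"
  have "wins ?X ?F 1 (Suc 0) (insert e1 M) B" unfolding wins_Suc_iff
  proof (intro allI impI)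
    fix b assume b: "b \<subseteq> ?X - (insert e1 M \<union> B) \<and> card b \<le> 1"
    have finb: "finite b" using b phase.finite_X[of n] finite_subset by (metis finite_Diff)
    have "e2 \<notin> b \<or> e3 \<notin> b"
    proof (rule ccontr)
      assume "\<not> ?thesis"
      then have "{e2, e3} \<subseteq> b" by simp
      then have "card {e2, e3} \<le> card b" using finb by (intro card_mono)
      then show False using b assms(2) by simp
    qed
    then obtain e where e: "e \<in> {e2, e3}" "e \<notin> b" by blast
    then have "\<exists>F\<in>?F. F \<subseteq> insert e (insert e1 M)" using assms(3,4)
      by (metis (no_types, lifting) Un_insert_right insert_commute insertE singletonD sup_bot_right)
    then have "mwin ?X ?F 1 0 0 (insert e (insert e1 M)) (B \<union> b)" by (intro mwin_0) simp
    then have "mwin ?X ?F 1 (Suc 0) 0 (insert e1 M) (B \<union> b)"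
      by (rule mwin_insert) (use e assms(1) in auto)
    then show "mwin ?X ?F 1 1 0 (insert e1 M) (B \<union> b)" by simp
  qed
  then have "mwin ?X ?F 1 0 (Suc 0) (insert e1 M) B" by (rule mwin_0)
  then have "mwin ?X ?F 1 (Suc 0) (Suc 0) M B" by (rule mwin_insert) (use assms(1) in auto)
  then show ?thesis by simp
qed

text \<open>Once \<open>hd ys\<close> is joined to a vertex \<open>c\<close> of the cycle, joining
  \<open>last ys\<close> to either neighbour of \<open>c\<close> wins, and the cycle edge between
  them is the wasted one. Breaker moves first, whence the \<open>+ 1\<close> at the degrees.\<close>

lemma closed_finish:
  assumes cs: "walk M cs" "{last cs, hd cs} \<in> M" and ys: "walk M ys" "ys \<noteq> []"
    and dist: "distinct (ys @ cs)" and all: "set ys \<union> set cs = {..<n}" and B: "B \<subseteq> complete_edges n"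
    and d: "deg B (hd ys) + 1 \<le> \<tau>" "deg B (last ys) + 1 \<le> \<tau>" and len: "12 * \<tau> + 8 \<le> length cs"
  shows "wins (complete_edges n) (hamilton_cycles n) 1 2 M B"
proof -
  interpret phase n 1 False "{}" "{}" .
  let ?q = "hd ys" and ?r = "last ys"
  have finB: "finite B" using B finite_X finite_subset by blast
  have "W (Suc 1) M B" unfolding wins_Suc_iff
  proof (intro allI impI)
    fix b assume b: "b \<subseteq> X - (M \<union> B) \<and> card b \<le> 1"
    let ?B = "B \<union> b"
    have finb: "finite b" using b finite_X finite_subset by (metis finite_Diff)
    have d': "deg ?B z \<le> \<tau>" if "z \<in> {?q, ?r}" for z
      using deg_Un_le[OF finB finb, of z] b d that by auto
    obtain j where j: "2 \<le> j" "j + 3 \<le> length cs"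
      "\<forall>z\<in>{?q, ?r}. {z, cs ! (j - 1)} \<notin> ?B \<and> {z, cs ! j} \<notin> ?B \<and> {z, cs ! Suc j} \<notin> ?B"
    proof -
      have "card {?q, ?r} \<le> 4" by (simp add: card_insert_if)
      then show ?thesis
        using exists_clear_index[of ?B cs "{?q, ?r}" \<tau>, OF _ _ _ _ d' len] finB finb dist that by auto
    qed
    define c where "c = cs ! j"
    obtain A D where AD: "cs = A @ [c] @ D" "A \<noteq> []" "D \<noteq> []" "last A = cs ! (j - 1)" "hd D = cs ! Suc j"
      using split_at[of cs j] dist j by (auto simp: c_def)
    let ?e1 = "{?q, c}" and ?e2 = "{?r, last A}" and ?e3 = "{?r, hd D}"
    have w: "walk M A" "walk M D" "{last A, c} \<in> M" "{c, hd D} \<in> M" "{last D, hd A} \<in> M"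
      using cs AD(1-3) by (auto simp: walk_append walk_Cons)
    have mem: "?q \<in> set ys" "?r \<in> set ys" "last A \<in> set cs" "hd D \<in> set cs" "c \<in> set cs"
      using AD(1) last_in_set[OF AD(2)] hd_in_set[OF AD(3)] ys(2) by auto
    have ne: "last A \<noteq> hd D"
    proof
      assume e: "last A = hd D"
      have "last A \<in> set A \<inter> set D" using last_in_set[OF AD(2)] hd_in_set[OF AD(3)] e by simp
      moreover have "set A \<inter> set D = {}" using dist AD(1) by auto
      ultimately show False by blast
    qed
    have disj: "set ys \<inter> set cs = {}" using dist by auto
    have lt: "x < n" if "x \<in> set ys \<union> set cs" for x using all that by auto
    have inX: "{y, z} \<in> X" if "y \<in> set ys" "z \<in> set cs" for y z
      using lt[of y] lt[of z] that disj by (intro edge_in_X) auto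
    have n3: "3 \<le> n"
    proof -
      have "card (set cs) \<le> card {..<n}" using all by (intro card_mono) auto
      then show ?thesis using dist len distinct_card[of cs] by auto
    qed
    have sub: "{?e1, ?e2, ?e3} \<subseteq> X - ?B" using inX mem j(3) AD(4,5) by (auto simp: c_def)
    have 1: "\<exists>F\<in>hamilton_cycles n. F \<subseteq> M \<union> {?e1, ?e2}"
    proof (rule hamilton_cycle_if_closed_walk[of _ "c # ys @ rev (D @ A)"])
      show "walk (M \<union> {?e1, ?e2}) (c # ys @ rev (D @ A))"
        using w ys AD(2,3) by (auto simp: walk_append walk_Cons hd_rev last_rev insert_commute elim!: walk_mono)
    qed (use dist all n3 w AD ys in \<open>auto simp: last_rev insert_commute\<close>)
    have 2: "\<exists>F\<in>hamilton_cycles n. F \<subseteq> M \<union> {?e1, ?e3}"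
    proof (rule hamilton_cycle_if_closed_walk[of _ "c # ys @ D @ A"])
      show "walk (M \<union> {?e1, ?e3}) (c # ys @ D @ A)"
        using w ys AD(2,3) by (auto simp: walk_append walk_Cons insert_commute elim!: walk_mono)
    qed (use dist all n3 w AD ys in \<open>auto simp: insert_commute\<close>)
    show "MW 1 1 M ?B"
      by (rule two_threats[OF sub _ 1 2]) (use ne in \<open>auto simp: doubleton_eq_iff\<close>)
  qed
  then show ?thesis by (simp add: numeral_2_eq_2)
qed

text \<open>With \<open>p\<close> hung on \<open>c\<close>, each of the disjoint sets
  \<open>?S1\<close>, \<open>?S2\<close>, \<open>?S3\<close> consists of an edge and two partners,
  either of which completes a cycle with it. The pairs at \<open>x\<close> and \<open>y\<close> in
  them are clear, so Breaker's present edges hit at most one set and his next edge one more; the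
  third is a double threat. The wasted edge is \<open>{x, c}\<close>, \<open>{c, y}\<close> or
  \<open>{p, c}\<close>.\<close>

lemma spider:
  assumes L: "walk M L" and R: "walk M R" "2 \<le> length R"
    and dist: "distinct (L @ R)" and all: "set L \<union> set R = {..<n}"
    and B: "B \<subseteq> complete_edges n" and live: "card {h \<in> B. h \<subseteq> {hd L, last L, hd R, last R}} \<le> 1"
    and d: "\<And>z. z \<in> {hd L, last L, hd R, last R} \<Longrightarrow> deg B z \<le> \<tau>" and len: "12 * \<tau> + 8 \<le> length L"
  shows "mwin (complete_edges n) (hamilton_cycles n) 1 1 2 M B"
proof -
  interpret phase n 1 True "{}" "{}" .
  define q q' p p' where "q = hd L" and "q' = last L" and "p = hd R" and "p' = last R"
  have finB: "finite B" using B finite_X finite_subset by blast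
  have Rne: "R \<noteq> []" using R by auto
  obtain j where j: "2 \<le> j" "j + 3 \<le> length L"
    "\<forall>z\<in>{q, q', p, p'}. {z, L ! (j - 1)} \<notin> B \<and> {z, L ! j} \<notin> B \<and> {z, L ! Suc j} \<notin> B"
  proof -
    have "card {q, q', p, p'} \<le> 4" by (simp add: card_insert_if)
    then show ?thesis using exists_clear_index[of B L "{q, q', p, p'}" \<tau>] finB dist d len that
      by (auto simp: q_def q'_def p_def p'_def)
  qed
  define c where "c = L ! j"
  obtain A D where AD: "L = A @ [c] @ D" "A \<noteq> []" "D \<noteq> []" "last A = L ! (j - 1)" "hd D = L ! Suc j"
    "length A = j" "length D = length L - Suc j"
    using split_at[of L j] dist j by (auto simp: c_def)
  define x y where "x = last A" and "y = hd D"
  have w: "walk M A" "walk M D" "{x, c} \<in> M" "{c, y} \<in> M"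
    using L AD(1-3) by (auto simp: walk_append walk_Cons x_def y_def)
  have A: "hd A = q" "last A = x" and D: "hd D = y" "last D = q'" and Re: "hd R = p" "last R = p'"
    using AD by (auto simp: q_def q'_def x_def y_def p_def p'_def)
  obtain A' where A': "A = q # A'" "A' \<noteq> []" using A AD(2,6) j(1) by (cases A) fastforce+
  obtain D' where D': "D = D' @ [q']" "D' \<noteq> []"
    using D AD(3,7) j(2) by (cases D rule: rev_cases) fastforce+
  obtain R' where R': "R = p # R'" "R' \<noteq> []" using Re R by (cases R) fastforce+
  have dset: "x \<in> set A'" "y \<in> set D'" "p' \<in> set R'" using A(2) A' D(1) D' Re(2) R' by auto
  have ds: "distinct [q, q', p, p', x, y, c]"
    using dist dset unfolding AD(1) A'(1) D'(1) R'(1) by auto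
  have allA: "set A \<union> {c} \<union> set D \<union> set R = {..<n}" using all AD(1) by auto
  have lt: "z < n" if "z \<in> {q, q', p, p', x, y, c}" for z
    using that dset allA unfolding A'(1) D'(1) R'(1) by auto
  have inX: "{u, v} \<in> X" if "u \<in> {q, q', p, p', x, y, c}" "v \<in> {q, q', p, p', x, y, c}" "u \<noteq> v" for u v
    using lt[OF that(1)] lt[OF that(2)] that(3) by (rule edge_in_X)
  have n3: "3 \<le> n"
  proof -
    have "card (set L) \<le> card {..<n}" using all by (intro card_mono) auto
    then show ?thesis using dist len distinct_card[of L] by auto
  qed
  let ?M = "insert {p, c} M"
  let ?S1 = "{{q, q'}, {p', x}, {p', y}}" and ?S2 = "{{p', q'}, {q, p}, {q, y}}" and ?S3 = "{{p', q}, {q', p}, {q', x}}"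
  have nB: "{p', x} \<notin> B" "{p', y} \<notin> B" "{q, y} \<notin> B" "{q', x} \<notin> B" "{p, c} \<notin> B"
    using j(3) AD(4,5) by (auto simp: x_def y_def c_def)
  define K where "K = {h \<in> B. h \<subseteq> {q, q', p, p'}}"
  have K: "card K \<le> 1" "finite K" using live finB by (auto simp: K_def q_def q'_def p_def p'_def)
  have inK: "h \<in> K" if "h \<in> ?S1 \<union> ?S2 \<union> ?S3" "h \<in> B" for h
    using that nB by (auto simp: K_def)
  have dj: "?S1 \<inter> ?S2 = {}" "?S1 \<inter> ?S3 = {}" "?S2 \<inter> ?S3 = {}"
    using ds by (auto simp: doubleton_eq_iff)
  have hc: "\<exists>F\<in>hamilton_cycles n. F \<subseteq> ?M \<union> {e, e'}"
    if "walk (?M \<union> {e, e'}) (c # zs)" "distinct (c # zs)" "set (c # zs) = {..<n}" "{last (c # zs), c} \<in> ?M \<union> {e, e'}" for e e' zs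
    using hamilton_cycle_if_closed_walk[OF that(1-3) n3] that(4) by simp
  have distA: "distinct (A @ [c] @ D @ R)" using dist AD(1) by simp
  note facts = w R(1) AD(2,3) Rne A D Re
  have "W (Suc 1) ?M B" unfolding wins_Suc_iff
  proof (intro allI impI)
    fix b assume b: "b \<subseteq> X - (?M \<union> B) \<and> card b \<le> 1"
    have finb: "finite b" using b finite_X finite_subset by (metis finite_Diff)
    have one: "h = h'" if "h \<in> b" "h' \<in> b" for h h'
      using b finb that card_le_Suc0_iff_eq[OF finb] by auto
    have oneK: "h = h'" if "h \<in> K" "h' \<in> K" for h h'
      using K that card_le_Suc0_iff_eq[OF K(2)] by auto
    consider "?S1 \<inter> (B \<union> b) = {}" | "?S2 \<inter> (B \<union> b) = {}" | "?S3 \<inter> (B \<union> b) = {}"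
    proof -
      have False if "h1 \<in> ?S1" "h2 \<in> ?S2" "h3 \<in> ?S3" "{h1, h2, h3} \<subseteq> B \<union> b" for h1 h2 h3
      proof -
        note dj' = dj[unfolded disjoint_iff_not_equal, rule_format]
        note ne = dj'(1)[OF that(1,2)] dj'(2)[OF that(1,3)] dj'(3)[OF that(2,3)]
        have k: "h1 \<in> B \<Longrightarrow> h1 \<in> K" "h2 \<in> B \<Longrightarrow> h2 \<in> K" "h3 \<in> B \<Longrightarrow> h3 \<in> K"
          using inK[of h1] inK[of h2] inK[of h3] that(1-3) by (simp_all only: Un_iff simp_thms)
        have bb: "\<not> (h \<in> b \<and> h' \<in> b)" if "h \<noteq> h'" for h h' using one[of h h'] that by argo
        have "\<not> (h1 \<in> B \<and> h2 \<in> B)" using k(1,2) oneK[of h1 h2] ne(1) by argo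
        moreover have "\<not> (h1 \<in> B \<and> h3 \<in> B)" using k(1,3) oneK[of h1 h3] ne(2) by argo
        moreover have "\<not> (h2 \<in> B \<and> h3 \<in> B)" using k(2,3) oneK[of h2 h3] ne(3) by argo
        moreover have "h1 \<in> B \<or> h1 \<in> b" "h2 \<in> B \<or> h2 \<in> b" "h3 \<in> B \<or> h3 \<in> b" using that(4) by (simp_all only: insert_subset Un_iff)
        ultimately show False using bb[OF ne(1)] bb[OF ne(2)] bb[OF ne(3)] by argo
      qed
      note no = this
      have "?S1 \<inter> (B \<union> b) = {} \<or> ?S2 \<inter> (B \<union> b) = {} \<or> ?S3 \<inter> (B \<union> b) = {}"
      proof (rule ccontr)
        assume "\<not> ?thesis"
        then have "?S1 \<inter> (B \<union> b) \<noteq> {}" "?S2 \<inter> (B \<union> b) \<noteq> {}" "?S3 \<inter> (B \<union> b) \<noteq> {}"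
          by (simp_all only: de_Morgan_disj simp_thms not_False_eq_True)
        then obtain h1 h2 h3 where "h1 \<in> ?S1 \<inter> (B \<union> b)" "h2 \<in> ?S2 \<inter> (B \<union> b)" "h3 \<in> ?S3 \<inter> (B \<union> b)"
          by (metis all_not_in_conv)
        then have "h1 \<in> ?S1" "h2 \<in> ?S2" "h3 \<in> ?S3" "{h1, h2, h3} \<subseteq> B \<union> b"
          by (simp_all only: Int_iff insert_subset empty_subsetI simp_thms)
        then show False by (rule no)
      qed
      then show ?thesis using that by (elim disjE)
    qed
    then show "MW 1 1 ?M (B \<union> b)"
    proof cases
      case 1
      have 2: "\<exists>F\<in>hamilton_cycles n. F \<subseteq> ?M \<union> {{q, q'}, {p', x}}"
        by (rule hc[of _ _ "D @ A @ rev R"])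
          (use facts distA allA in \<open>auto simp: walk_append walk_Cons hd_rev last_rev insert_commute elim!: walk_mono\<close>)
      have 3: "\<exists>F\<in>hamilton_cycles n. F \<subseteq> ?M \<union> {{q, q'}, {p', y}}"
        by (rule hc[of _ _ "rev A @ rev D @ rev R"])
          (use facts distA allA in \<open>auto simp: walk_append walk_Cons hd_rev last_rev insert_commute elim!: walk_mono\<close>)
      have "?S1 \<subseteq> X - (B \<union> b)" using 1 inX ds by auto
      then show ?thesis by (rule two_threats[OF _ _ 2 3]) (use ds in \<open>simp add: doubleton_eq_iff\<close>)
    next
      case 2
      have 3: "\<exists>F\<in>hamilton_cycles n. F \<subseteq> ?M \<union> {{p', q'}, {q, p}}"
        by (rule hc[of _ _ "D @ rev R @ A"])
          (use facts distA allA in \<open>auto simp: walk_append walk_Cons hd_rev last_rev insert_commute elim!: walk_mono\<close>)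
      have 4: "\<exists>F\<in>hamilton_cycles n. F \<subseteq> ?M \<union> {{p', q'}, {q, y}}"
        by (rule hc[of _ _ "R @ rev D @ A"])
          (use facts distA allA in \<open>auto simp: walk_append walk_Cons hd_rev last_rev insert_commute elim!: walk_mono\<close>)
      have "?S2 \<subseteq> X - (B \<union> b)" using 2 inX ds by auto
      then show ?thesis by (rule two_threats[OF _ _ 3 4]) (use ds in \<open>simp add: doubleton_eq_iff\<close>)
    next
      case 3
      have 4: "\<exists>F\<in>hamilton_cycles n. F \<subseteq> ?M \<union> {{p', q}, {q', p}}"
        by (rule hc[of _ _ "rev A @ rev R @ rev D"])
          (use facts distA allA in \<open>auto simp: walk_append walk_Cons hd_rev last_rev insert_commute elim!: walk_mono\<close>)
      have 5: "\<exists>F\<in>hamilton_cycles n. F \<subseteq> ?M \<union> {{p', q}, {q', x}}"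
        by (rule hc[of _ _ "R @ A @ rev D"])
          (use facts distA allA in \<open>auto simp: walk_append walk_Cons hd_rev last_rev insert_commute elim!: walk_mono\<close>)
      have "?S3 \<subseteq> X - (B \<union> b)" using 3 inX ds by auto
      then show ?thesis by (rule two_threats[OF _ _ 4 5]) (use ds in \<open>simp add: doubleton_eq_iff\<close>)
    qed
  qed
  then have "MW 0 2 ?M B" by (intro mwin_0) (simp add: numeral_2_eq_2)
  then have "MW (Suc 0) 2 M B" by (rule mwin_insert) (use nB inX ds in auto)
  then show ?thesis by simp
qed

section \<open>One edge per move: the strategy\<close>

text \<open>
  Since Breaker claims one edge per move, a vertex that is not bad with \<open>t\<close> moves to go will have
  degree at most \<open>\<tau>\<close> in Breaker's graph until the end.
\<close>

definition bad :: "nat \<Rightarrow> nat \<Rightarrow> 'v set set \<Rightarrow> 'v set \<Rightarrow> 'v set" where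
  "bad \<tau> t B V = {v \<in> V. \<tau> < deg B v + t}"

lemma bad_mono: "V \<subseteq> V' \<Longrightarrow> bad \<tau> t B V \<subseteq> bad \<tau> t B V'"
  by (auto simp: bad_def)

text \<open>In each round a degree grows by at most one while one move fewer remains, so no vertex
  turns bad.\<close>

lemma bad_brk:
  assumes "finite B" "finite b" "card b \<le> 1" "V \<subseteq> V'"
  shows "bad \<tau> t (B \<union> b) V \<subseteq> bad \<tau> (Suc t) B V'"
proof
  fix v assume v: "v \<in> bad \<tau> t (B \<union> b) V"
  have "deg (B \<union> b) v \<le> deg B v + 1" using deg_Un_le[OF assms(1,2), of v] assms(3) by linarith
  then show "v \<in> bad \<tau> (Suc t) B V'" using v assms(4) by (auto simp: bad_def)
qed

lemma deg_brk:
  assumes "B \<subseteq> complete_edges n" "b \<subseteq> complete_edges n - B" "card b \<le> 1"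
  shows "deg (B \<union> b) v \<le> deg B v + 1"
proof -
  have "finite B" by (rule finite_subset[OF assms(1) phase.finite_X])
  moreover have "finite b" by (rule finite_subset[OF assms(2) finite_Diff[OF phase.finite_X]])
  ultimately show ?thesis using deg_Un_le[of B b v] assms(3) by linarith
qed

text \<open>Turns explicitly given paths and isolated vertices into a position of the general
  game.\<close>

lemma realizes_lists:
  assumes "path_system M U P" "ends_mate P V m" "I \<inter> U = {}" "\<And>x. x \<in> I \<Longrightarrow> m x = x"
  shows "realizes M (I \<union> U) (I \<union> V) m"
proof -
  let ?P = "(\<lambda>x. [x]) ` I \<union> P"
  have sub: "set xs \<subseteq> U" if "xs \<in> P" for xs using assms(1) that by (auto simp: path_system_def)
  have "path_system M (I \<union> U) ?P"
    unfolding path_system_def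
  proof (intro conjI ballI impI)
    fix xs assume "xs \<in> ?P"
    then show "xs \<noteq> []" "distinct xs" "walk M xs" using assms(1) by (auto simp: path_system_def)
  next
    fix xs ys assume "xs \<in> ?P" "ys \<in> ?P" "xs \<noteq> ys"
    then show "set xs \<inter> set ys = {}"
      using assms(1,3) sub[of xs] sub[of ys] by (auto simp: path_system_def) blast+
  next
    show "(\<Union>xs\<in>?P. set xs) = I \<union> U" using assms(1) by (auto simp: path_system_def)
  qed
  moreover have "ends_mate ?P (I \<union> V) m" using assms(2,4) by (auto simp: ends_mate_def)
  ultimately show ?thesis by (auto simp: realizes_def)
qed

section \<open>The game after the long path has been closed to a cycle\<close>

locale closed =
  fixes n :: nat and U :: "nat set" and M0 :: "nat set set" and cs :: "nat list" and \<tau> :: nat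
  assumes cs: "walk M0 cs" "{last cs, hd cs} \<in> M0" "distinct cs" "set cs \<inter> U = {}" "U \<union> set cs = {..<n}"
    and len: "12 * \<tau> + 8 \<le> length cs"

text \<open>The endgame starts with two paths, one edge at hand and two moves to come. At most two
  of the four pairs between the paths are harmful, so they can be joined to one path, which is then
  inserted into the cycle.\<close>

sublocale closed \<subseteq> late n 1 False U M0 1 1 2 1 2 "\<lambda>t B V. \<forall>v\<in>V. deg B v + t \<le> \<tau>"
proof unfold_locales
  fix M B E m
  assume st: "phase.st n U M0 M B {} E m" and E: "card E = 2 * 2"
    and e: "card (phase.hh False B {} E m) + 1 \<le> 2 + 1" and Q: "\<forall>v\<in>E. deg B v + 2 \<le> \<tau>"
  interpret phase n 1 False U M0 .
  have fin: "finite E" using st_finite[OF st] by auto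
  obtain p q where pq: "p \<in> E" "q \<in> E" "p \<noteq> q" "q \<noteq> m p" "{p, q} \<notin> hh B {} E m"
    using four_ends_free[OF st] E e by auto
  define m2 where "m2 = m(m p := m q, m q := m p)"
  let ?E2 = "E - {p, q}" and ?M2 = "insert {p, q} M"
  note st2 = st_ee[OF st pq, folded m2_def]
  have c2: "card ?E2 = 2" using E pq fin by (subst card_Diff_subset) auto
  then obtain x where x: "x \<in> ?E2" by (metis card.empty ex_in_conv zero_neq_numeral)
  let ?y = "m2 x"
  have y: "?y \<in> ?E2" "?y \<noteq> x" "m2 ?y = x" using st_E[OF st2(1) x] by auto
  have "{x, ?y} \<subseteq> ?E2" using x y(1) by blast
  moreover have "card {x, ?y} = card ?E2" using y(2) c2 by simp
  moreover have "finite ?E2" using fin by (intro finite_Diff)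
  ultimately have E2: "?E2 = {x, ?y}" by (metis card_subset_eq)
  have "realizes ?M2 U {x, ?y} m2" using st2(1) E2 by (simp add: st_def)
  then obtain ys where ys: "ys \<noteq> []" "walk ?M2 ys" "distinct ys" "set ys = U" "hd ys = x" "last ys = ?y"
    using realizes_single[of ?M2 U x ?y m2] y by auto
  have M0: "M0 \<subseteq> ?M2" using st by (auto simp: st_def)
  have "W 2 ?M2 B"
  proof (rule closed_finish[of _ cs ys _ _ \<tau>])
    show "walk ?M2 cs" using cs(1) M0 by (rule walk_mono)
    show "{last cs, hd cs} \<in> ?M2" using cs(2) M0 by blast
    show "B \<subseteq> X" using st by (simp add: st_def)
    show "deg B (hd ys) + 1 \<le> \<tau>" "deg B (last ys) + 1 \<le> \<tau>" using Q x y(1) ys(5,6) by force+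
  qed (use ys cs len in auto)
  then have w: "MW 0 2 ?M2 B" by (rule mwin_0)
  have "MW (Suc 0) 2 M B" by (rule link_MW[OF st _ _ pq(3-5) w]) (use pq in auto)
  then show "MW 1 2 M B" by simp
next
  fix t :: nat and B b :: "nat set set" and V :: "nat set"
  assume Q: "\<forall>v\<in>V. deg B v + Suc t \<le> \<tau>" and fin: "B \<subseteq> complete_edges n" "b \<subseteq> complete_edges n - B" "card b \<le> 1"
  show "\<forall>v\<in>V. deg (B \<union> b) v + t \<le> \<tau>"
  proof
    fix v assume "v \<in> V"
    then show "deg (B \<union> b) v + t \<le> \<tau>" using deg_brk[OF fin, of v] Q by fastforce
  qed
qed auto

context closed
begin

text \<open>Maker first ignores the lead and removes bad vertices from the ends. A bad isolated
  vertex counts twice: joined to a good vertex it is a bad end, and only a second link makes it an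
  inner vertex. Each move costs at most two isolated vertices and one new harmful edge.\<close>

lemma blind:
  assumes "st M B I E m" "card E = 2 * k" "t = k + card I"
    "2 * card (bad \<tau> t B I) + card (bad \<tau> t B E) \<le> \<mu>"
    "10 * (card (hh B I E m) + \<mu>) + 2 * \<mu> + 85 \<le> card I"
  shows "MW 1 t M B"
  using assms
proof (induction \<mu> arbitrary: M B I E m k t)
  case (0 M B I E m k t)
  note st = 0(1)
  have fin: "finite I" "finite E" using st_finite[OF st] by auto
  have "finite (bad \<tau> t B I)" "finite (bad \<tau> t B E)" using fin by (auto simp: bad_def)
  then have "bad \<tau> t B I = {}" "bad \<tau> t B E = {}" using 0(4) by auto
  then have "\<forall>v\<in>I \<union> E. deg B v + t \<le> \<tau>" by (auto simp: bad_def not_less)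
  \<comment> \<open>For \<open>a = 1\<close> and \<open>\<phi> = 1\<close>, \<open>recover\<close>
    asks for \<open>10 * c + 85\<close> isolated vertices.\<close>
  then show ?case
    by (intro recover[OF _ _ _ st 0(2), where c = "card (hh B I E m)"]) (use 0 in auto)
next
  case (Suc \<mu> M B I E m k t)
  note st = Suc.prems(1)
  have fin: "finite I" "finite E" "finite B" "finite (hh B I E m)" using st_finite[OF st] by auto
  have finb: "finite (bad \<tau> t B I)" "finite (bad \<tau> t B E)" using fin by (auto simp: bad_def)
  have "t \<noteq> 0" using Suc.prems(3,5) by linarith
  then obtain t' where t': "t = Suc t'" by (metis not0_implies_Suc)
  obtain w where w: "w \<in> I" "w \<notin> bad \<tau> t B I" "w \<notin> \<Union>(hh B I E m)"
    using clean_isolated[OF st finb(1)] Suc.prems(4,5) by auto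
  then have wgood: "w \<notin> bad \<tau> t B V" for V by (auto simp: bad_def)
  show ?case
  proof (cases "bad \<tau> t B E = {}")
    case False
    then obtain u where u: "u \<in> bad \<tau> t B E" by blast
    then have uE: "u \<in> E" by (auto simp: bad_def)
    have uw: "{u, w} \<notin> hh B I E m" using w by blast
    let ?I = "I - {w}" and ?E = "insert w (E - {u})" and ?m = "m(m u := w, w := m u)" and ?M = "insert {u, w} M"
    note st' = st_ei[OF st uE w(1) uw]
    have wE: "w \<notin> E" "u \<noteq> w" "m u \<noteq> w" using w st_disj[OF st] uE st_E[OF st uE] by auto
    have cI: "card ?I + 1 = card I" using card_Suc_Diff1[OF fin(1) w(1)] by linarith
    have cE: "card ?E = 2 * k" using Suc.prems(2) uE wE fin
      by (metis (no_types, lifting) Diff_iff card_Suc_Diff1 card_insert_disjoint finite_Diff)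
    have "W (Suc t') ?M B" unfolding wins_Suc_iff
    proof (intro allI impI)
      fix b assume b: "b \<subseteq> X - (?M \<union> B) \<and> card b \<le> 1"
      have fb: "finite b" using b finite_X finite_subset by (metis finite_Diff)
      note st2 = st_brk[OF st'(1) conjunct1[OF b]]
      have "card (hh B ?I ?E ?m) \<le> card (hh B I E m)" using st'(2) fin by (intro card_mono) auto
      then have e: "card (hh (B \<union> b) ?I ?E ?m) \<le> card (hh B I E m) + 1" using st2(4) b by linarith
      have "bad \<tau> t' (B \<union> b) ?I \<subseteq> bad \<tau> t B I"
        unfolding t' by (rule bad_brk) (use fin fb b in auto)
      then have 1: "card (bad \<tau> t' (B \<union> b) ?I) \<le> card (bad \<tau> t B I)" using finb by (intro card_mono)
      have "bad \<tau> t' (B \<union> b) ?E \<subseteq> bad \<tau> t B ?E"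
        unfolding t' by (rule bad_brk) (use fin fb b in auto)
      also have "\<dots> \<subseteq> bad \<tau> t B E - {u}" using wgood wE by (auto simp: bad_def)
      finally have "card (bad \<tau> t' (B \<union> b) ?E) \<le> card (bad \<tau> t B E - {u})" using finb by (intro card_mono) auto
      also have "\<dots> + 1 = card (bad \<tau> t B E)" using card_Suc_Diff1[OF finb(2) u] by linarith
      finally have 2: "card (bad \<tau> t' (B \<union> b) ?E) + 1 \<le> card (bad \<tau> t B E)" by simp
      have ar: "10 * (e' + \<mu>) + 2 * \<mu> + 85 \<le> i'"
        if "e' \<le> e + 1" "10 * (e + Suc \<mu>) + 2 * Suc \<mu> + 85 \<le> i" "i' + 1 = i" for e e' i i' :: nat
        using that by simp
      show "MW 1 t' ?M (B \<union> b)"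
        by (rule Suc.IH[OF st2(1) cE _ _ ar[OF e Suc.prems(5) cI]]) ((use Suc.prems(3-5) cI 1 2 t' in linarith)+)
    qed
    then have wn: "MW 0 t ?M B" unfolding t' by (rule mwin_0)
    have "MW (Suc 0) t M B" by (rule link_MW[OF st _ _ wE(2) _ uw wn]) (use uE w wE in auto)
    then show ?thesis by simp
  next
    case noE: True
    then have noE': "card (bad \<tau> t B E) = 0" by simp
    show ?thesis
    proof (cases "bad \<tau> t B I = {}")
      case True
      then show ?thesis using Suc.IH[OF st Suc.prems(2,3)] noE Suc.prems(5) by simp
    next
      case False
      then obtain u where u: "u \<in> bad \<tau> t B I" by blast
      then have uI: "u \<in> I" "u \<noteq> w" using w by (auto simp: bad_def)
      have uw: "{u, w} \<notin> hh B I E m" using w by blast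
      let ?I = "I - {u, w}" and ?E = "E \<union> {u, w}" and ?m = "m(u := w, w := u)" and ?M = "insert {u, w} M"
      note st' = st_ii[OF st uI(1) w(1) uI(2) uw]
      have uwE: "u \<notin> E" "w \<notin> E" using uI w st_disj[OF st] by auto
      have cI: "card ?I + 2 = card I" using uI w fin Suc.prems(5) by (subst card_Diff_subset) auto
      have cE: "card ?E = 2 * Suc k" using Suc.prems(2) uwE uI fin by (subst card_Un_disjoint) auto
      have "W (Suc t') ?M B" unfolding wins_Suc_iff
      proof (intro allI impI)
        fix b assume b: "b \<subseteq> X - (?M \<union> B) \<and> card b \<le> 1"
        have fb: "finite b" using b finite_X finite_subset by (metis finite_Diff)
        note st2 = st_brk[OF st'(1) conjunct1[OF b]]
        have "card (hh B ?I ?E ?m) \<le> card (hh B I E m)" using st'(2) fin by (intro card_mono) auto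
        then have e: "card (hh (B \<union> b) ?I ?E ?m) \<le> card (hh B I E m) + 1" using st2(4) b by linarith
        have "bad \<tau> t' (B \<union> b) ?I \<subseteq> bad \<tau> t B ?I"
          unfolding t' by (rule bad_brk) (use fin fb b in auto)
        also have "\<dots> \<subseteq> bad \<tau> t B I - {u}" by (auto simp: bad_def)
        finally have "card (bad \<tau> t' (B \<union> b) ?I) \<le> card (bad \<tau> t B I - {u})" using finb by (intro card_mono) auto
        also have "\<dots> + 1 = card (bad \<tau> t B I)" using card_Suc_Diff1[OF finb(1) u] by linarith
        finally have 1: "card (bad \<tau> t' (B \<union> b) ?I) + 1 \<le> card (bad \<tau> t B I)" by simp
        have "bad \<tau> t' (B \<union> b) ?E \<subseteq> bad \<tau> t B ?E"
          unfolding t' by (rule bad_brk) (use fin fb b in auto)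
        also have "\<dots> \<subseteq> {u}" using wgood[of ?E] noE by (auto simp: bad_def)
        finally have 2: "card (bad \<tau> t' (B \<union> b) ?E) \<le> 1" using card_mono[of "{u}"] by fastforce
        have ar: "10 * (e' + \<mu>) + 2 * \<mu> + 85 \<le> i'"
          if "e' \<le> e + 1" "10 * (e + Suc \<mu>) + 2 * Suc \<mu> + 85 \<le> i" "i' + 2 = i" for e e' i i' :: nat
          using that by simp
        show "MW 1 t' ?M (B \<union> b)"
          by (rule Suc.IH[OF st2(1) cE _ _ ar[OF e Suc.prems(5) cI]]) ((use Suc.prems(3-5) cI 1 2 e t' noE' in linarith)+)
      qed
      then have wn: "MW 0 t ?M B" unfolding t' by (rule mwin_0)
      have "MW (Suc 0) t M B"
        by (rule link_MW[OF st _ _ uI(2) _ uw wn]) (use uI w st_I[OF st uI(1)] in auto)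
      then show ?thesis by simp
    qed
  qed
qed

end

text \<open>By \<open>big\<close> the longer of two covering paths has the length that
  \<open>spider\<close> wants. By \<open>big2\<close> the sum of Breaker's degrees leaves room for
  at most 100 bad vertices near the end.\<close>

locale single =
  fixes n \<tau> :: nat
  assumes big: "24 * \<tau> + 40000 \<le> n" and big2: "2 * n + 2 < 101 * (\<tau> - 5001)"
begin

text \<open>\<open>fl\<close> is set because \<open>spider\<close> may also join the two ends of one
  path. It tolerates a single harmful edge, which is what demands a lead of 2.\<close>

lemma open_late: "late n 1 True {..<n} {} 2 1 2 1 2 (\<lambda>t B V. \<forall>v\<in>V. deg B v + t \<le> \<tau>)"
proof unfold_locales
  fix M B E m
  assume st: "phase.st n {..<n} {} M B {} E m" and E: "card E = 2 * 2"
    and e: "card (phase.hh True B {} E m) + 2 \<le> 2 + 1" and Q: "\<forall>v\<in>E. deg B v + 2 \<le> \<tau>"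
  interpret phase n 1 True "{..<n}" "{}" .
  obtain u v where uv: "E = {u, m u, v, m v}" "u \<in> E" "v \<in> E" "v \<noteq> u" "v \<noteq> m u" "m v \<noteq> u" "m v \<noteq> m u"
    using four_ends[OF st] E by auto
  have m: "m u \<in> E" "m v \<in> E" "m u \<noteq> u" "m v \<noteq> v" "m (m u) = u" "m (m v) = v"
    using st_E[OF st uv(2)] st_E[OF st uv(3)] by auto
  have "realizes M {..<n} {u, m u, v, m v} m" using st uv(1) by (simp add: st_def)
  then obtain xs ys where xy: "xs \<noteq> []" "ys \<noteq> []" "distinct (xs @ ys)" "walk M xs" "walk M ys"
    "set xs \<union> set ys = {..<n}" "hd xs = u" "last xs = m u" "hd ys = v" "last ys = m v"
    using realizes_two[of M "{..<n}" u "m u" v "m v" m] uv m by auto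
  have hh: "hh B {} E m = {h \<in> B. h \<subseteq> E}" by (simp add: hh_def)
  have BX: "B \<subseteq> X" using st by (simp add: st_def)
  have two: "2 \<le> length xs" "2 \<le> length ys"
  proof -
    have "length zs \<ge> 2" if "zs \<noteq> []" "hd zs \<noteq> last zs" for zs :: "nat list"
      using that by (cases zs; cases "tl zs") auto
    then show "2 \<le> length xs" "2 \<le> length ys" using xy m by metis+
  qed
  have "length xs + length ys = n" using xy(3,6) distinct_card[OF xy(3)] by simp
  then consider "12 * \<tau> + 8 \<le> length xs" | "12 * \<tau> + 8 \<le> length ys" using big by linarith
  then show "MW 1 2 M B"
  proof cases
    case 1
    have "{hd xs, last xs, hd ys, last ys} = E" using uv(1) xy by auto
    then show ?thesis using 1 xy two BX e Q unfolding hh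
      by (intro spider[of M xs ys _ _ \<tau>]) auto
  next
    case 2
    have "{hd ys, last ys, hd xs, last xs} = E" using uv(1) xy by auto
    then show ?thesis using 2 xy two BX e Q unfolding hh
      by (intro spider[of M ys xs _ _ \<tau>]) auto
  qed
next
  fix t :: nat and B b :: "nat set set" and V :: "nat set"
  assume Q: "\<forall>v\<in>V. deg B v + Suc t \<le> \<tau>" and fin: "B \<subseteq> complete_edges n" "b \<subseteq> complete_edges n - B" "card b \<le> 1"
  show "\<forall>v\<in>V. deg (B \<union> b) v + t \<le> \<tau>"
  proof
    fix v assume "v \<in> V"
    then show "deg (B \<union> b) v + t \<le> \<tau>" using deg_brk[OF fin, of v] Q by fastforce
  qed
qed auto

end

section \<open>The long path and the live edges\<close>

definition lv :: "'v set set \<Rightarrow> 'v set \<Rightarrow> 'v set set" where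
  "lv B V = {h \<in> B. h \<subseteq> V}"

lemma lv_I: "{x, y} \<in> B \<Longrightarrow> x \<in> V \<Longrightarrow> y \<in> V \<Longrightarrow> {x, y} \<in> lv B V"
  by (simp add: lv_def)

text \<open>The handshake lemma, by double counting.\<close>

lemma sum_deg:
  assumes "B \<subseteq> complete_edges n"
  shows "(\<Sum>v<n. deg B v) = 2 * card B"
proof -
  have fin: "finite B" by (rule finite_subset[OF assms phase.finite_X])
  have "(\<Sum>v<n. deg B v) = (\<Sum>v<n. \<Sum>h\<in>B. if v \<in> h then 1 else 0)"
    using fin by (simp add: deg_def sum.If_cases Int_def)
  also have "\<dots> = (\<Sum>h\<in>B. \<Sum>v<n. if v \<in> h then 1 else 0)" by (rule sum.swap)
  also have "\<dots> = (\<Sum>h\<in>B. 2)"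
  proof (rule sum.cong[OF refl])
    fix h assume "h \<in> B"
    then have h: "h \<subseteq> {..<n}" "card h = 2" using assms by (auto simp: complete_edges_def)
    then have "{..<n} \<inter> h = h" by blast
    then show "(\<Sum>v<n. if v \<in> h then 1 else 0) = (2::nat)" using h by (simp add: sum.If_cases)
  qed
  finally show ?thesis by simp
qed

context single
begin

abbreviation "X \<equiv> complete_edges n"
abbreviation "W \<equiv> wins X (hamilton_cycles n) 1"
abbreviation "MW \<equiv> mwin X (hamilton_cycles n) 1"

text \<open>
  A long path \<open>L\<close>, isolated vertices \<open>I\<close>, and possibly a single further edge, as the list \<open>R\<close> of its
  ends; \<open>R = []\<close> if there is none.
\<close>

definition line :: "nat set set \<Rightarrow> nat set set \<Rightarrow> nat list \<Rightarrow> nat set \<Rightarrow> nat list \<Rightarrow> bool" where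
  "line M B L I R \<longleftrightarrow> walk M L \<and> distinct L \<and> 2 \<le> length L \<and> walk M R \<and> distinct R \<and> length R \<in> {0, 2} \<and>
     set L \<union> I \<union> set R = {..<n} \<and> set L \<inter> I = {} \<and> set L \<inter> set R = {} \<and> I \<inter> set R = {} \<and> M \<inter> B = {} \<and> B \<subseteq> X"

abbreviation live :: "nat list \<Rightarrow> nat set \<Rightarrow> nat list \<Rightarrow> nat set" where
  "live L I R \<equiv> {hd L, last L} \<union> I \<union> set R"

text \<open>With the edge about to be claimed, \<open>t\<close> moves allow for all merges, the
  closing edge and one spare edge. Once the second path exists, no live vertex may be bad.\<close>

definition ok :: "nat set set \<Rightarrow> nat set set \<Rightarrow> nat list \<Rightarrow> nat set \<Rightarrow> nat list \<Rightarrow> nat \<Rightarrow> bool" where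
  "ok M B L I R t \<longleftrightarrow> line M B L I R \<and> t = card I + (if R = [] then 1 else 2) \<and>
     card (bad \<tau> t B {..<n}) \<le> 100 \<and> card I \<le> 5000 \<and> (R \<noteq> [] \<longrightarrow> bad \<tau> t B (live L I R) = {})"

context
  fixes M B L I R
  assumes ln: "line M B L I R"
begin

lemma line_ne: "L \<noteq> []" "hd L \<noteq> last L" "hd L \<in> set L" "last L \<in> set L"
proof -
  have L: "distinct L" "2 \<le> length L" using ln by (auto simp: line_def)
  then show "L \<noteq> []" by auto
  then show "hd L \<in> set L" "last L \<in> set L" by auto
  show "hd L \<noteq> last L" using L by (cases L; cases "tl L") auto
qed

lemma line_ends: "hd L \<notin> I" "last L \<notin> I" "hd L \<notin> set R" "last L \<notin> set R"
  using ln line_ne(3,4) by (auto simp: line_def)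

lemma line_finite: "finite B" "finite I"
proof -
  show "finite B" using ln phase.finite_X[of n] finite_subset unfolding line_def by metis
  have "I \<subseteq> {..<n}" using ln by (auto simp: line_def)
  then show "finite I" by (rule finite_subset) simp
qed

lemma line_lt: "x \<in> live L I R \<Longrightarrow> x < n"
  using ln line_ne(3,4) by (auto simp: line_def)

lemma line_edge: "h \<in> B \<Longrightarrow> card h = 2"
  using ln by (auto simp: line_def complete_edges_def)

lemma line_rev: "line M B (rev L) I R"
  using ln by (auto simp: line_def)

lemma line_length: "length L + card I + length R = n"
proof -
  have "card (set L \<union> I \<union> set R) = card (set L) + card I + card (set R)"
    using ln line_finite card_Un_disjoint[of "set L \<union> I" "set R"] card_Un_disjoint[of "set L" I]
    by (simp add: line_def Int_Un_distrib2)
  then show ?thesis using ln by (simp add: line_def distinct_card)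
qed

lemma lv_finite: "finite (lv B V)" using line_finite by (simp add: lv_def)

lemma line_ext:
  assumes x: "x \<in> I" "{last L, x} \<notin> B" and b: "b \<subseteq> X - (insert {last L, x} M \<union> B)"
  shows "line (insert {last L, x} M) (B \<union> b) (L @ [x]) (I - {x}) R"
proof -
  have "walk (insert {last L, x} M) (L @ [x])" "walk (insert {last L, x} M) R"
    using ln by (auto simp: line_def walk_append elim: walk_mono)
  moreover have "x \<notin> set L" "x \<notin> set R" using ln x by (auto simp: line_def)
  moreover have "insert {last L, x} M \<inter> (B \<union> b) = {}" using ln x b by (auto simp: line_def)
  moreover have "B \<union> b \<subseteq> X" using ln b by (auto simp: line_def)
  ultimately show ?thesis using ln x unfolding line_def by auto
qed

lemma lv_ext:
  assumes x: "x \<in> I"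
  shows "lv (B \<union> b) (live (L @ [x]) (I - {x}) R) \<subseteq> {h \<in> lv B (live L I R). last L \<notin> h} \<union> b"
proof
  fix h assume h: "h \<in> lv (B \<union> b) (live (L @ [x]) (I - {x}) R)"
  then have h': "h \<in> B \<union> b" "h \<subseteq> {hd L, x} \<union> (I - {x}) \<union> set R" using line_ne(1) by (auto simp: lv_def)
  then have "h \<subseteq> live L I R" "last L \<notin> h"
    using x line_ends line_ne(2) by auto
  then show "h \<in> {h \<in> lv B (live L I R). last L \<notin> h} \<union> b" using h'(1) by (auto simp: lv_def)
qed

lemma ext_edge: "x \<in> I \<Longrightarrow> {last L, x} \<notin> B \<Longrightarrow> {last L, x} \<in> X - B"
  using phase.edge_in_X[of "last L" n x] line_lt[of x] line_lt[of "last L"] line_ends(2) by auto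

lemma ext_MW: "x \<in> I \<Longrightarrow> {last L, x} \<notin> B \<Longrightarrow> W t (insert {last L, x} M) B \<Longrightarrow> MW 1 t M B"
  using mwin_insert[OF mwin_0[where \<rho> = 0] ext_edge] by auto

lemma small_Union: "card (lv B V) \<le> c \<Longrightarrow> card (\<Union>(lv B V)) \<le> 2 * c"
proof -
  assume c: "card (lv B V) \<le> c"
  have "card (\<Union>(lv B V)) \<le> (\<Sum>h\<in>lv B V. card h)" by (rule card_Union_le_sum_card)
  also have "\<dots> \<le> (\<Sum>h\<in>lv B V. 2)" by (rule sum_mono) (use line_edge in \<open>simp add: lv_def\<close>)
  finally show ?thesis using c by simp
qed

lemma clean_vertex:
  assumes "card (lv B (live L I R)) \<le> 2" "5 \<le> card I"
  shows "\<exists>x\<in>I. x \<notin> \<Union>(lv B (live L I R)) \<and> {last L, x} \<notin> B"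
proof -
  have "\<Union>(lv B (live L I R)) \<subseteq> live L I R" by (auto simp: lv_def)
  moreover have "finite (live L I R)" using line_finite by simp
  ultimately have "finite (\<Union>(lv B (live L I R)))" by (rule finite_subset)
  moreover have "card (\<Union>(lv B (live L I R))) < card I" using small_Union[OF assms(1)] assms(2) by simp
  ultimately have "\<not> I \<subseteq> \<Union>(lv B (live L I R))" by (metis card_mono leD)
  then obtain x where x: "x \<in> I" "x \<notin> \<Union>(lv B (live L I R))" by blast
  have "{last L, x} \<notin> B"
  proof
    assume "{last L, x} \<in> B"
    then have "{last L, x} \<in> lv B (live L I R)" using x by (intro lv_I) auto
    then show False using x(2) by blast
  qed
  then show ?thesis using x by blast
qed

end

text \<open>The part of the mate map contributed by \<open>R\<close>.\<close>

definition side :: "nat list \<Rightarrow> nat \<Rightarrow> nat" where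
  "side R z = (if z \<in> set R then if z = hd R then last R else hd R else z)"

lemma two_list:
  assumes "line M B L I R" "R \<noteq> []"
  obtains d d' where "R = [d, d']" "d \<noteq> d'" "{d, d'} \<in> M"
proof -
  have "length R = 2" "distinct R" "walk M R" using assms by (auto simp: line_def)
  then obtain d d' where "R = [d, d']" by (auto simp: length_Suc_conv numeral_2_eq_2)
  then show ?thesis using that \<open>distinct R\<close> \<open>walk M R\<close> by (auto simp: walk_Cons)
qed

text \<open>
  Once \<open>L\<close> is closed to a cycle, the position on \<open>I \<union> set R\<close> is one of the locale \<open>closed\<close>.
\<close>

lemma line_close:
  assumes ln: "line M B L I R" and own: "{hd L, last L} \<notin> B"
    and lv: "card (lv B (live L I R)) \<le> 2" and t: "t = card I + (if R = [] then 1 else 2)"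
    and bad: "card (bad \<tau> t B {..<n}) \<le> 100" and i: "3725 \<le> card I" "card I \<le> 5000"
  shows "MW 1 t M B"
proof -
  let ?e = "{hd L, last L}" and ?M = "insert {hd L, last L} M"
  have "t \<noteq> 0" using t by (simp split: if_splits)
  then obtain t' where t': "t = Suc t'" using not0_implies_Suc by blast
  have eX: "?e \<in> X - B" using line_lt[OF ln, of "hd L"] line_lt[OF ln, of "last L"] line_ne(2)[OF ln] own
    by (auto simp: complete_edges_def)
  have fin: "finite B" "finite I" using line_finite[OF ln] by auto
  have "W (Suc t') ?M B" unfolding wins_Suc_iff
  proof (intro allI impI)
    fix b assume b: "b \<subseteq> X - (?M \<union> B) \<and> card b \<le> 1"
    have fb: "finite b" using b phase.finite_X[of n] finite_subset by (metis finite_Diff)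
    interpret c: closed n "I \<union> set R" ?M L \<tau>
    proof
      show "walk ?M L" "distinct L" using ln by (auto simp: line_def elim: walk_mono)
      show "{last L, hd L} \<in> ?M" by (auto simp: insert_commute)
      show "set L \<inter> (I \<union> set R) = {}" "I \<union> set R \<union> set L = {..<n}" using ln by (auto simp: line_def)
      have "length R \<le> 2" using ln by (auto simp: line_def)
      then show "12 * \<tau> + 8 \<le> length L" using line_length[OF ln] i big by linarith
    qed
    have real: "realizes ?M (I \<union> set R) (I \<union> set R) (side R)"
    proof (cases "R = []")
      case True
      then show ?thesis using realizes_singletons[of ?M I] by (simp add: side_def[abs_def])
    next
      case False
      then obtain d d' where R: "R = [d, d']" "d \<noteq> d'" "{d, d'} \<in> M" using two_list[OF ln] by blast
      have "path_system ?M (set R) {R}" using R by (auto simp: path_system_def walk_Cons)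
      moreover have "ends_mate {R} (set R) (side R)" using R by (auto simp: ends_mate_def side_def)
      ultimately show ?thesis using ln by (intro realizes_lists[of _ _ "{R}"]) (auto simp: line_def side_def)
    qed
    have sR: "side R z \<in> set R \<and> side R z \<noteq> z \<and> side R (side R z) = z" if "z \<in> set R" for z
    proof -
      have "R \<noteq> []" using that by auto
      then obtain d d' where R: "R = [d, d']" "d \<noteq> d'" using two_list[OF ln] by blast
      then show ?thesis using that by (auto simp: side_def)
    qed
    have sI: "side R z = z" if "z \<in> I" for z using that ln by (auto simp: side_def line_def)
    have "?M \<inter> (B \<union> b) = {}" "B \<union> b \<subseteq> X" "I \<union> set R \<subseteq> {..<n}" using ln own b by (auto simp: line_def)
    then have st: "c.st ?M (B \<union> b) I (set R) (side R)"
      unfolding c.st_def using real sR sI by auto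
    have cR: "card (set R) = 2 * (if R = [] then 0 else 1)" using ln by (auto simp: line_def distinct_card)
    have "c.hh (B \<union> b) I (set R) (side R) \<subseteq> lv B (live L I R) \<union> b"
      unfolding c.hh_def lv_def by auto
    then have "card (c.hh (B \<union> b) I (set R) (side R)) \<le> card (lv B (live L I R) \<union> b)"
      using lv_finite[OF ln] fb by (intro card_mono) auto
    also have "\<dots> \<le> 3" using card_Un_le[of "lv B (live L I R)" b] lv b by linarith
    finally have hh: "card (c.hh (B \<union> b) I (set R) (side R)) \<le> 3" .
    have fbad: "finite (bad \<tau> t B {..<n})" by (simp add: bad_def)
    have bd: "card (bad \<tau> t' (B \<union> b) V) \<le> 100" if "V \<subseteq> {..<n}" for V
    proof -
      have "bad \<tau> t' (B \<union> b) V \<subseteq> bad \<tau> t B {..<n}"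
        unfolding t' by (rule bad_brk) (use fin fb b that in auto)
      then show ?thesis using card_mono[OF fbad] bad by (meson le_trans)
    qed
    show "MW 1 t' ?M (B \<union> b)"
    \<comment> \<open>\<open>300 = 2 * 100 + 100\<close> bounds the weight of the bad vertices. With
      three harmful edges, namely two live ones and Breaker's reply, \<open>blind\<close> asks for
      3715 isolated vertices.\<close>
    proof (rule c.blind[OF st cR, where \<mu> = 300])
      show "t' = (if R = [] then 0 else 1) + card I" using t t' by auto
      show "2 * card (bad \<tau> t' (B \<union> b) I) + card (bad \<tau> t' (B \<union> b) (set R)) \<le> 300"
      proof -
        have "I \<subseteq> {..<n}" "set R \<subseteq> {..<n}" using ln by (auto simp: line_def)
        from bd[OF this(1)] bd[OF this(2)] show ?thesis by linarith
      qed
      show "10 * (card (c.hh (B \<union> b) I (set R) (side R)) + 300) + 2 * 300 + 85 \<le> card I"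
        using mult_le_mono2[OF hh, of 10] i(1) unfolding add_mult_distrib2 by simp
    qed
  qed
  then have "MW 0 t ?M B" unfolding t' by (rule mwin_0)
  then have "MW (Suc 0) t M B" by (rule mwin_insert[OF _ eX])
  then show ?thesis by simp
qed

lemma ok_close:
  "ok M B L I R t \<Longrightarrow> {hd L, last L} \<notin> B \<Longrightarrow> card (lv B (live L I R)) \<le> 2 \<Longrightarrow> 3725 \<le> card I \<Longrightarrow> MW 1 t M B"
  unfolding ok_def by (rule line_close) auto

lemma ok_line: "ok M B L I R t \<Longrightarrow> line M B L I R" by (simp add: ok_def)

lemma ok_rev: "ok M B L I R t \<Longrightarrow> ok M B (rev L) I R t"
  unfolding ok_def using line_rev line_ne(1) by (auto simp: hd_rev last_rev insert_commute)

lemma live_rev: "L \<noteq> [] \<Longrightarrow> live (rev L) I R = live L I R"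
  by (auto simp: hd_rev last_rev)

lemma ok_extend:
  assumes ok: "ok M B L I R t" and x: "x \<in> I" "{last L, x} \<notin> B"
    and nxt: "\<And>t' b. t = Suc t' \<Longrightarrow> finite b \<Longrightarrow> card b \<le> 1 \<Longrightarrow> b \<inter> B = {} \<Longrightarrow>
      ok (insert {last L, x} M) (B \<union> b) (L @ [x]) (I - {x}) R t' \<Longrightarrow>
      lv (B \<union> b) (live (L @ [x]) (I - {x}) R) \<subseteq> {h \<in> lv B (live L I R). last L \<notin> h} \<union> b \<Longrightarrow>
      card (I - {x}) + 1 = card I \<Longrightarrow>
      MW 1 t' (insert {last L, x} M) (B \<union> b)"
  shows "MW 1 t M B"
proof -
  have ln: "line M B L I R" using ok by (rule ok_line)
  have fin: "finite B" "finite I" using line_finite[OF ln] by auto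
  have "t \<noteq> 0" using ok by (simp add: ok_def split: if_splits)
  then obtain t' where t': "t = Suc t'" using not0_implies_Suc by blast
  let ?M = "insert {last L, x} M"
  have "W (Suc t') ?M B" unfolding wins_Suc_iff
  proof (intro allI impI)
    fix b assume b: "b \<subseteq> X - (?M \<union> B) \<and> card b \<le> 1"
    have fb: "finite b" using b phase.finite_X[of n] finite_subset by (metis finite_Diff)
    have cI: "card (I - {x}) + 1 = card I" using card_Suc_Diff1[OF fin(2) x(1)] by linarith
    have br: "bad \<tau> t' (B \<union> b) V \<subseteq> bad \<tau> t B V'" if "V \<subseteq> V'" for V V'
      unfolding t' by (rule bad_brk) (use fin fb b that in auto)
    have "card (bad \<tau> t' (B \<union> b) {..<n}) \<le> card (bad \<tau> t B {..<n})"
      by (rule card_mono[OF _ br]) (auto simp: bad_def)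
    moreover have "bad \<tau> t' (B \<union> b) (live (L @ [x]) (I - {x}) R) \<subseteq> bad \<tau> t B (live L I R)"
      by (rule br) (use x line_ne(1)[OF ln] in auto)
    moreover have "line ?M (B \<union> b) (L @ [x]) (I - {x}) R"
      by (rule line_ext[OF ln x]) (use b in auto)
    ultimately have "ok ?M (B \<union> b) (L @ [x]) (I - {x}) R t'"
      using ok cI t' unfolding ok_def by auto
    then show "MW 1 t' ?M (B \<union> b)"
      by (intro nxt[OF t' fb _ _ _ lv_ext[OF ln x(1)] cI]) (use b in auto)
  qed
  then show ?thesis unfolding t' by (rule ext_MW[OF ln x])
qed

text \<open>
  Maker wins if at least \<open>i\<close> vertices are isolated and Breaker has at most \<open>f\<close> live edges (\<open>FS\<close>), or
  two live edges sharing an end of \<open>L\<close> (\<open>FE\<close>). In the latter case she removes both by extending \<open>L\<close>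
  there. Breaker keeps his position only by joining the ends of \<open>L\<close> in each of his moves, as Maker
  closes the cycle otherwise; she uses this to reduce the number of live edges.
\<close>

definition FS :: "nat \<Rightarrow> nat list \<Rightarrow> nat \<Rightarrow> bool" where
  "FS i R f \<longleftrightarrow> (\<forall>M B L I t. ok M B L I R t \<longrightarrow> i \<le> card I \<longrightarrow> card (lv B (live L I R)) \<le> f \<longrightarrow> MW 1 t M B)"

definition FE :: "nat \<Rightarrow> nat list \<Rightarrow> bool" where
  "FE i R \<longleftrightarrow> (\<forall>M B L I t. ok M B L I R t \<longrightarrow> i \<le> card I \<longrightarrow> card (lv B (live L I R)) \<le> 2 \<longrightarrow>
     (\<exists>r\<in>{hd L, last L}. \<forall>h\<in>lv B (live L I R). r \<in> h) \<longrightarrow> MW 1 t M B)"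

lemma FE_if_FS:
  assumes FS: "FS i R 1" and i: "5 \<le> i"
  shows "FE (Suc i) R"
proof -
  have last: "MW 1 t M B" if ok: "ok M B L I R t" and ci: "Suc i \<le> card I" and cl: "card (lv B (live L I R)) \<le> 2"
    and r: "\<forall>h\<in>lv B (live L I R). last L \<in> h" for M B L I t
  proof -
    obtain x where x: "x \<in> I" "{last L, x} \<notin> B"
      using clean_vertex[OF ok_line[OF ok] cl] ci i by auto
    show ?thesis
    proof (rule ok_extend[OF ok x])
      fix t' b assume b: "finite b" "card b \<le> 1"
        and ok': "ok (insert {last L, x} M) (B \<union> b) (L @ [x]) (I - {x}) R t'"
        and lv: "lv (B \<union> b) (live (L @ [x]) (I - {x}) R) \<subseteq> {h \<in> lv B (live L I R). last L \<notin> h} \<union> b"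
        and cI: "card (I - {x}) + 1 = card I"
      have "lv (B \<union> b) (live (L @ [x]) (I - {x}) R) \<subseteq> b" using lv r by blast
      then have "card (lv (B \<union> b) (live (L @ [x]) (I - {x}) R)) \<le> 1"
        using card_mono[OF b(1)] b(2) by (meson le_trans)
      moreover have "i \<le> card (I - {x})" using cI ci by linarith
      ultimately show "MW 1 t' (insert {last L, x} M) (B \<union> b)"
        using FS ok' unfolding FS_def by blast
    qed
  qed
  show ?thesis unfolding FE_def
  proof (intro allI impI)
    fix M B L I t assume ok: "ok M B L I R t" and ci: "Suc i \<le> card I" and lv: "card (lv B (live L I R)) \<le> 2"
      and "\<exists>r\<in>{hd L, last L}. \<forall>h\<in>lv B (live L I R). r \<in> h"
    then consider "\<forall>h\<in>lv B (live L I R). last L \<in> h" | "\<forall>h\<in>lv B (live L I R). hd L \<in> h" by blast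
    then show "MW 1 t M B"
    proof cases
      case 1
      then show ?thesis using last[OF ok ci lv] by blast
    next
      case 2
      have ne: "L \<noteq> []" by (rule line_ne(1)[OF ok_line[OF ok]])
      have "\<forall>h\<in>lv B (live (rev L) I R). last (rev L) \<in> h" unfolding live_rev[OF ne] unfolding last_rev by (rule 2)
      moreover have "card (lv B (live (rev L) I R)) \<le> 2" unfolding live_rev[OF ne] by (rule lv)
      ultimately show ?thesis by (intro last[OF ok_rev[OF ok] ci])
    qed
  qed
qed

text \<open>If Breaker does not own \<open>{hd L, last L}\<close>, Maker closes. A second live edge
  away from both ends has an isolated vertex \<open>x\<close>; extending \<open>L\<close> to
  \<open>x\<close> leaves this edge at the new end, and Breaker has to reply
  \<open>{hd L, x}\<close>, so that both live edges meet \<open>x\<close>.\<close>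

lemma FS_if_FE:
  assumes FE: "FE i R" and i: "3725 \<le> i"
  shows "FS (Suc i) R 2"
  unfolding FS_def
proof (intro allI impI)
  fix M B L I t
  let ?V = "live L I R" and ?own = "{hd L, last L}"
  assume ok: "ok M B L I R t" and ci: "Suc i \<le> card I" and lv: "card (lv B ?V) \<le> 2"
  have ln: "line M B L I R" using ok by (rule ok_line)
  have FE': "MW 1 t M B" if "\<exists>r\<in>{hd L, last L}. \<forall>h\<in>lv B ?V. r \<in> h"
    using FE ok ci lv that unfolding FE_def by (meson Suc_leD)
  show "MW 1 t M B"
  proof (cases "?own \<in> B")
    case False
    then show ?thesis using ok_close[OF ok False lv] ci i by simp
  next
    case True
    then have own: "?own \<in> lv B ?V" by (intro lv_I) auto
    show ?thesis
    proof (cases "\<exists>g\<in>lv B ?V. last L \<notin> g \<and> hd L \<notin> g")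
      case False
      show ?thesis
      proof (cases "\<exists>g\<in>lv B ?V. last L \<notin> g")
        case nl: True
        then obtain g where g: "g \<in> lv B ?V" "last L \<notin> g" by blast
        then have "hd L \<in> g" using False by blast
        have "g \<noteq> ?own" using g by auto
        then have "lv B ?V = {g, ?own}"
          using card_seteq[OF lv_finite[OF ln], of "{g, ?own}"] g own lv by auto
        then show ?thesis using FE' \<open>hd L \<in> g\<close> by auto
      qed (use FE' in auto)
    next
      case True
      then obtain g where g: "g \<in> lv B ?V" "last L \<notin> g" "hd L \<notin> g" by blast
      then have "g \<noteq> ?own" by auto
      then have lvg: "lv B ?V = {g, ?own}"
        using card_seteq[OF lv_finite[OF ln], of "{g, ?own}"] g(1) own lv by auto
      have gB: "g \<in> B" "g \<subseteq> I \<union> set R" using g by (auto simp: lv_def)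
      \<comment> \<open>The only pair inside \<open>R\<close> is an edge of Maker.\<close>
      have "\<not> g \<subseteq> set R"
      proof
        assume sub: "g \<subseteq> set R"
        have c2: "card g = 2" using line_edge[OF ln gB(1)] .
        then have "R \<noteq> []" using sub by auto
        then obtain d d' where R: "R = [d, d']" "d \<noteq> d'" "{d, d'} \<in> M" using two_list[OF ln] by blast
        have "g = {d, d'}" using card_seteq[of "{d, d'}" g] sub c2 R by auto
        then show False using R(3) gB(1) ln by (auto simp: line_def)
      qed
      then obtain x where x: "x \<in> g" "x \<in> I" using gB(2) by blast
      have xL: "x \<noteq> last L" "x \<noteq> hd L" using g x by auto
      have lx: "{last L, x} \<notin> B"
      proof
        assume "{last L, x} \<in> B"
        then have "{last L, x} \<in> lv B ?V" using x by (intro lv_I) auto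
        then show False using lvg g(2) xL line_ne(2)[OF ln] by (auto simp: doubleton_eq_iff)
      qed
      have hx: "{hd L, x} \<notin> B"
      proof
        assume "{hd L, x} \<in> B"
        then have "{hd L, x} \<in> lv B ?V" using x by (intro lv_I) auto
        then show False using lvg g(3) xL line_ne(2)[OF ln] by (auto simp: doubleton_eq_iff)
      qed
      show ?thesis
      proof (rule ok_extend[OF ok x(2) lx])
        fix t' b assume b: "finite b" "card b \<le> 1"
          and ok': "ok (insert {last L, x} M) (B \<union> b) (L @ [x]) (I - {x}) R t'"
          and lv': "lv (B \<union> b) (live (L @ [x]) (I - {x}) R) \<subseteq> {h \<in> lv B ?V. last L \<notin> h} \<union> b"
          and cI: "card (I - {x}) + 1 = card I"
        have sub: "lv (B \<union> b) (live (L @ [x]) (I - {x}) R) \<subseteq> insert g b" using lv' lvg by auto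
        have "card (lv (B \<union> b) (live (L @ [x]) (I - {x}) R)) \<le> card (insert g b)"
          using sub b(1) by (intro card_mono) auto
        also have "\<dots> \<le> 2" using b(2) card_insert_le_m1[of 2 b g] by simp
        finally have c2: "card (lv (B \<union> b) (live (L @ [x]) (I - {x}) R)) \<le> 2" .
        have ends: "hd (L @ [x]) = hd L" "last (L @ [x]) = x" using line_ne(1)[OF ln] by auto
        have ci': "i \<le> card (I - {x})" using cI ci by linarith
        show "MW 1 t' (insert {last L, x} M) (B \<union> b)"
        proof (cases "{hd L, x} \<in> b")
          case False
          then have "{hd (L @ [x]), last (L @ [x])} \<notin> B \<union> b" using hx ends by simp
          then show ?thesis using ok_close[OF ok' _ c2] ci' i by simp
        next
          case True
          then have "b = {{hd L, x}}" using b card_le_Suc0_iff_eq[OF b(1)] by auto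
          then have "\<forall>h\<in>lv (B \<union> b) (live (L @ [x]) (I - {x}) R). last (L @ [x]) \<in> h"
            using sub x(1) ends by auto
          then have "\<exists>r\<in>{hd (L @ [x]), last (L @ [x])}. \<forall>h\<in>lv (B \<union> b) (live (L @ [x]) (I - {x}) R). r \<in> h"
            by (metis insertI1 insertI2)
          then show ?thesis using FE ok' ci' c2 unfolding FE_def by (meson le_trans)
        qed
      qed
    qed
  qed
qed

lemma lv_own:
  assumes "line M B L I R" "{hd L, last L} \<in> B" "card (lv B (live L I R)) \<le> 1"
  shows "lv B (live L I R) = {{hd L, last L}}" and "x \<in> I \<Longrightarrow> y \<in> live L I R \<Longrightarrow> {y, x} \<notin> B"
proof -
  have "{hd L, last L} \<in> lv B (live L I R)" using assms(2) by (intro lv_I) auto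
  then show eq: "lv B (live L I R) = {{hd L, last L}}"
    using card_seteq[OF lv_finite[OF assms(1)], of "{{hd L, last L}}"] assms(3) by auto
  show "{y, x} \<notin> B" if "x \<in> I" "y \<in> live L I R"
  proof
    assume "{y, x} \<in> B"
    then have "{y, x} \<in> lv B (live L I R)" using that by (intro lv_I) auto
    then have "x \<in> {hd L, last L}" using eq by auto
    then show False using line_ends[OF assms(1)] that(1) by auto
  qed
qed

text \<open>The only live edge joins the ends of \<open>L\<close>, so extending \<open>L\<close> by
  any isolated vertex leaves none. Two nontrivial paths, no harmful edge and Breaker to move: this
  is the lead of 2 that the open endgame requires.\<close>

lemma FS_pair:
  assumes R: "R \<noteq> []"
  shows "FS 3726 R 1"
  unfolding FS_def
proof (intro allI impI)
  fix M B L I t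
  assume ok: "ok M B L I R t" and ci: "3726 \<le> card I" and lv: "card (lv B (live L I R)) \<le> 1"
  have ln: "line M B L I R" using ok by (rule ok_line)
  have fin: "finite I" using line_finite[OF ln] by auto
  show "MW 1 t M B"
  proof (cases "{hd L, last L} \<in> B")
    case False
    then show ?thesis using ok_close[OF ok False] lv ci by simp
  next
    case True
    note own = lv_own[OF ln True lv]
    have "I \<noteq> {}" using ci by auto
    then obtain x where x: "x \<in> I" by blast
    have lx: "{last L, x} \<notin> B" by (rule own(2)[OF x]) auto
    let ?M = "insert {last L, x} M" and ?I = "I - {x}" and ?E = "{hd L, x} \<union> set R"
    obtain d d' where Rd: "R = [d, d']" "d \<noteq> d'" "{d, d'} \<in> M" using two_list[OF ln R] by blast
    have nR: "x \<notin> set R" "hd L \<notin> set R" "x \<noteq> hd L" "d \<notin> I" "d' \<notin> I" "x \<noteq> d" "x \<noteq> d'" "hd L \<noteq> d" "hd L \<noteq> d'"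
      using ln x Rd line_ends[OF ln] by (auto simp: line_def)
    define m where "m z = (if z = hd L then x else if z = x then hd L else side R z)" for z
    have md: "m (hd L) = x" "m x = hd L" "m d = d'" "m d' = d"
      using nR Rd by (auto simp: m_def side_def)
    interpret o: late n 1 True "{..<n}" "{}" 2 1 2 1 2 "\<lambda>t B V. \<forall>v\<in>V. deg B v + t \<le> \<tau>" by (rule open_late)
    have ln': "line ?M (B \<union> {}) (L @ [x]) ?I R" by (rule line_ext[OF ln x lx]) simp
    have hl: "hd (L @ [x]) = hd L" "last (L @ [x]) = x" using line_ne(1)[OF ln] by auto
    have "path_system ?M (set (L @ [x]) \<union> set R) {L @ [x], R}"
      using ln' R line_ne(1)[OF ln] unfolding path_system_def line_def by auto
    moreover have "ends_mate {L @ [x], R} ?E m"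
      using hl md Rd unfolding ends_mate_def by auto
    moreover have "?I \<inter> (set (L @ [x]) \<union> set R) = {}" using ln' by (auto simp: line_def)
    moreover have mI: "m z = z" if "z \<in> ?I" for z
    proof -
      have "z \<noteq> hd L" "z \<noteq> x" "z \<notin> set R" using that Rd(1) nR(4,5) line_ends(1)[OF ln] by auto
      then show ?thesis by (simp add: m_def side_def)
    qed
    ultimately have "realizes ?M (?I \<union> (set (L @ [x]) \<union> set R)) (?I \<union> ?E) m" by (rule realizes_lists)
    moreover have "?I \<union> (set (L @ [x]) \<union> set R) = {..<n}" using ln' by (auto simp: line_def)
    ultimately have real: "realizes ?M {..<n} (?I \<union> ?E) m" by simp
    have E: "?E = {hd L, x, d, d'}" using Rd by auto
    have "z < n" if "z \<in> ?I \<union> ?E" for z using line_lt[OF ln, of z] that x by auto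
    then have "?I \<union> ?E \<subseteq> {..<n}" by blast
    moreover have "\<forall>z\<in>?E. m z \<in> ?E \<and> m z \<noteq> z \<and> m (m z) = z" unfolding E using md nR Rd by auto
    moreover have "?M \<inter> B = {}" "B \<subseteq> X" using ln' by (auto simp: line_def)
    ultimately have st: "o.st ?M B ?I ?E m"
      unfolding o.st_def using real mI by auto
    have "h \<notin> o.hh B ?I ?E m" for h
    proof
      assume h: "h \<in> o.hh B ?I ?E m"
      then have hB: "h \<in> B" "h \<subseteq> ?I \<union> ?E" by (auto simp: o.hh_def)
      then have "h \<in> lv B (live L I R)" using x by (auto simp: lv_def)
      then have "last L \<in> h" using own(1) by auto
      then show False using hB(2) line_ends[OF ln] line_ne(2)[OF ln] x by auto
    qed
    then have hh: "o.hh B ?I ?E m = {}" by blast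
    have bd: "bad \<tau> t B (live L I R) = {}" and t: "t = card I + 2" using ok R by (auto simp: ok_def)
    have Q: "\<forall>v\<in>?I \<union> ?E. deg B v + t \<le> \<tau>"
    proof
      fix v assume "v \<in> ?I \<union> ?E"
      then have "v \<in> live L I R" using x by auto
      then show "deg B v + t \<le> \<tau>" using bd by (auto simp: bad_def not_less)
    qed
    have cI: "card ?I + 1 = card I" using card_Suc_Diff1[OF fin x] by linarith
    have c4: "card ?E = 2 * 2" unfolding E using nR Rd by simp
    have "card (o.hh B ?I ?E m) + 2 \<le> 2 + 0" "1 * t + 0 = 2 + card ?I + 1" "5 * 1 + 60 \<le> card ?I + 2 * 2"
      using hh t cI ci by auto
    then have "o.MW 0 t ?M B"
      using o.spread[of 0 t] st c4 Q by (metis (no_types, lifting) zero_le)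
    then have "MW (Suc 0) t M B" by (rule mwin_insert[OF _ ext_edge[OF ln x lx]])
    then show ?thesis by simp
  qed
qed

lemma FS_pair_two: "R \<noteq> [] \<Longrightarrow> FS 3728 R 2"
  using FS_if_FE[OF FE_if_FS[OF FS_pair]] by simp

text \<open>While there is no second path, Maker swallows bad vertices: a bad isolated vertex
  becomes an end, a bad end becomes inner, whence the weights in \<open>\<mu>\<close>. Breaker must
  answer each extension by joining the ends of \<open>L\<close>, so at most one edge stays live.
  When no bad vertex is left, \<open>R\<close> is created.\<close>

lemma FS_path:
  assumes "ok M B L I [] t" "2 * card (bad \<tau> t B I) + card (bad \<tau> t B {hd L, last L}) \<le> \<mu>"
    "3900 + \<mu> \<le> card I" "card (lv B (live L I [])) \<le> 1"
  shows "MW 1 t M B"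
  using assms
proof (induction \<mu> arbitrary: M B L I t rule: less_induct)
  case (less \<mu> M B L I t)
  note ok = less.prems(1)
  have ln: "line M B L I []" using ok by (rule ok_line)
  have fin: "finite I" "finite B" using line_finite[OF ln] by auto
  have finb: "finite (bad \<tau> t B I)" "finite (bad \<tau> t B {hd L, last L})" using fin by (auto simp: bad_def)
  show ?case
  proof (cases "{hd L, last L} \<in> B")
    case False
    then show ?thesis using ok_close[OF ok False] less.prems by simp
  next
    case True
    note own = lv_own[OF ln True less.prems(4)]
    have ext: "MW 1 t M B"
      if ok2: "ok M B K I [] t" and K: "{hd K, last K} = {hd L, last L}" and x: "x \<in> I"
        and \<mu>': "\<mu>' < \<mu>"
        and red: "\<And>t' (b :: nat set set). t = Suc t' \<Longrightarrow> finite b \<Longrightarrow> card b \<le> 1 \<Longrightarrow>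
          2 * card (bad \<tau> t' (B \<union> b) (I - {x})) + card (bad \<tau> t' (B \<union> b) {hd K, x}) \<le> \<mu>'"
      for K x \<mu>'
    proof -
      have lk: "line M B K I []" using ok2 by (rule ok_line)
      have lv2: "live K I [] = live L I []" using K by auto
      have "{last K, x} \<notin> B" by (rule own(2)[OF x]) (use K in auto)
      then show ?thesis
      proof (rule ok_extend[OF ok2 x])
        fix t' b assume t': "t = Suc t'" and b: "finite b" "card b \<le> 1"
          and ok': "ok (insert {last K, x} M) (B \<union> b) (K @ [x]) (I - {x}) [] t'"
          and lv: "lv (B \<union> b) (live (K @ [x]) (I - {x}) []) \<subseteq> {h \<in> lv B (live K I []). last K \<notin> h} \<union> b"
          and cI: "card (I - {x}) + 1 = card I"
        have "last K \<in> {hd L, last L}" using K by blast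
        then have "lv (B \<union> b) (live (K @ [x]) (I - {x}) []) \<subseteq> b" using lv unfolding lv2 own(1) by auto
        then have "card (lv (B \<union> b) (live (K @ [x]) (I - {x}) [])) \<le> 1"
          using card_mono[OF b(1)] b(2) by (meson le_trans)
        moreover have "hd (K @ [x]) = hd K" "last (K @ [x]) = x" using line_ne(1)[OF lk] by auto
        ultimately show "MW 1 t' (insert {last K, x} M) (B \<union> b)"
          by (intro less.IH[OF \<mu>' ok']) (use red[OF t' b] cI less.prems(3) \<mu>' in auto)
      qed
    qed
    show ?thesis
    proof (cases "bad \<tau> t B I = {}")
      case False
      then obtain x where x: "x \<in> bad \<tau> t B I" by blast
      then have xI: "x \<in> I" by (auto simp: bad_def)
      show ?thesis
      proof (rule ext[OF ok refl xI, of "\<mu> - 1"])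
        have c1: "card (bad \<tau> t B I - {x}) + 1 = card (bad \<tau> t B I)"
          using card_Suc_Diff1[OF finb(1) x] by linarith
        then show "\<mu> - 1 < \<mu>" using less.prems(2) by linarith
        fix t' and b :: "nat set set" assume t': "t = Suc t'" and b: "finite b" "card b \<le> 1"
        have "bad \<tau> t' (B \<union> b) (I - {x}) \<subseteq> bad \<tau> t B (I - {x})"
          unfolding t' by (rule bad_brk[OF fin(2) b]) simp
        also have "\<dots> \<subseteq> bad \<tau> t B I - {x}" by (auto simp: bad_def)
        finally have 1: "card (bad \<tau> t' (B \<union> b) (I - {x})) \<le> card (bad \<tau> t B I - {x})"
          using finb by (intro card_mono) auto
        have "bad \<tau> t' (B \<union> b) {hd L, x} \<subseteq> bad \<tau> t B {hd L, x}"
          unfolding t' by (rule bad_brk[OF fin(2) b]) simp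
        also have "\<dots> \<subseteq> insert x (bad \<tau> t B {hd L, last L})" by (auto simp: bad_def)
        finally have "card (bad \<tau> t' (B \<union> b) {hd L, x}) \<le> card (insert x (bad \<tau> t B {hd L, last L}))"
          using finb by (intro card_mono) auto
        also have "\<dots> \<le> card (bad \<tau> t B {hd L, last L}) + 1" using finb by (simp add: card_insert_if)
        finally have 2: "card (bad \<tau> t' (B \<union> b) {hd L, x}) \<le> card (bad \<tau> t B {hd L, last L}) + 1" .
        show "2 * card (bad \<tau> t' (B \<union> b) (I - {x})) + card (bad \<tau> t' (B \<union> b) {hd L, x}) \<le> \<mu> - 1"
          using 1 2 c1 less.prems(2) by linarith
      qed
    next
      case noI: True
      have "I \<noteq> {}" using less.prems(3) by auto
      then obtain x where xI: "x \<in> I" by blast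
      show ?thesis
      proof (cases "bad \<tau> t B {hd L, last L} = {}")
        case False
        obtain K where K: "ok M B K I [] t" "{hd K, last K} = {hd L, last L}" "last K \<in> bad \<tau> t B {hd L, last L}"
        proof (cases "last L \<in> bad \<tau> t B {hd L, last L}")
          case True
          then show ?thesis using that[of L] ok by blast
        next
          case nl: False
          then have "hd L \<in> bad \<tau> t B {hd L, last L}" using False by (auto simp: bad_def)
          then show ?thesis using that[of "rev L"] ok_rev[OF ok] line_ne(1)[OF ln]
            by (auto simp: hd_rev last_rev insert_commute)
        qed
        have lk: "line M B K I []" using K(1) by (rule ok_line)
        have c1: "card (bad \<tau> t B {hd L, last L} - {last K}) + 1 = card (bad \<tau> t B {hd L, last L})"
          using card_Suc_Diff1[OF finb(2) K(3)] by linarith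
        show ?thesis
        proof (rule ext[OF K(1,2) xI, of "\<mu> - 1"])
          show "\<mu> - 1 < \<mu>" using c1 less.prems(2) by linarith
          fix t' and b :: "nat set set" assume t': "t = Suc t'" and b: "finite b" "card b \<le> 1"
          have "bad \<tau> t' (B \<union> b) (I - {x}) \<subseteq> bad \<tau> t B I"
            unfolding t' by (rule bad_brk[OF fin(2) b]) auto
          then have 1: "bad \<tau> t' (B \<union> b) (I - {x}) = {}" using noI by auto
          have "bad \<tau> t' (B \<union> b) {hd K, x} \<subseteq> bad \<tau> t B {hd K, x}"
            unfolding t' by (rule bad_brk[OF fin(2) b]) simp
          also have "\<dots> \<subseteq> bad \<tau> t B {hd K, last K} - {last K}"
            using noI xI line_ne(2)[OF lk] by (auto simp: bad_def)
          finally have "card (bad \<tau> t' (B \<union> b) {hd K, x}) \<le> card (bad \<tau> t B {hd L, last L} - {last K})"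
            using finb unfolding K(2) by (intro card_mono) auto
          then show "2 * card (bad \<tau> t' (B \<union> b) (I - {x})) + card (bad \<tau> t' (B \<union> b) {hd K, x}) \<le> \<mu> - 1"
            using 1 c1 less.prems(2) by simp
        qed
      next
        case noE: True
        have "\<not> I \<subseteq> {x}" using card_mono[of "{x}" I] less.prems(3) by auto
        then obtain y where yI: "y \<in> I" "y \<noteq> x" by blast
        have xy: "{x, y} \<notin> B" by (rule own(2)[OF yI(1)]) (use xI in auto)
        have xyX: "{x, y} \<in> X - B" using xy yI xI line_lt[OF ln] by (auto simp: complete_edges_def)
        let ?M = "insert {x, y} M" and ?I = "I - {x, y}"
        have "t \<noteq> 0" using ok by (simp add: ok_def)
        then obtain t' where t': "t = Suc t'" using not0_implies_Suc by blast
        have cI: "card ?I + 2 = card I" using xI yI fin less.prems(3) by (subst card_Diff_subset) auto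
        have liveI: "live L ?I [x, y] = live L I []" using xI yI by auto
        have "W (Suc t') ?M B" unfolding wins_Suc_iff
        proof (intro allI impI)
          fix b assume b: "b \<subseteq> X - (?M \<union> B) \<and> card b \<le> 1"
          have fb: "finite b" using b phase.finite_X[of n] finite_subset by (metis finite_Diff)
          have cb: "card b \<le> 1" using b by simp
          have br: "bad \<tau> t' (B \<union> b) V \<subseteq> bad \<tau> t B V" for V
            unfolding t' by (rule bad_brk[OF fin(2) fb cb]) simp
          have "card (bad \<tau> t' (B \<union> b) {..<n}) \<le> card (bad \<tau> t B {..<n})"
            by (rule card_mono[OF _ br]) (auto simp: bad_def)
          moreover have "bad \<tau> t B (live L I []) = bad \<tau> t B {hd L, last L} \<union> bad \<tau> t B I"
            by (auto simp: bad_def)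
          then have "bad \<tau> t' (B \<union> b) (live L ?I [x, y]) = {}"
            using br[of "live L I []"] noI noE unfolding liveI by auto
          moreover have "line ?M (B \<union> b) L ?I [x, y]"
          proof -
            have "walk ?M L" "walk ?M [x, y]" using ln by (auto simp: line_def walk_Cons elim: walk_mono)
            moreover have "x \<notin> set L" "y \<notin> set L" using ln xI yI by (auto simp: line_def)
            moreover have "?M \<inter> (B \<union> b) = {}" "B \<union> b \<subseteq> X" using ln xy b by (auto simp: line_def)
            ultimately show ?thesis using ln xI yI unfolding line_def by auto
          qed
          ultimately have ok': "ok ?M (B \<union> b) L ?I [x, y] t'"
            using ok cI t' unfolding ok_def by auto
          \<comment> \<open>No vertex stops being live: the old live edge and Breaker's reply may
            both count.\<close>
          have "lv (B \<union> b) (live L ?I [x, y]) \<subseteq> lv B (live L I []) \<union> b" unfolding liveI by (auto simp: lv_def)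
          then have "card (lv (B \<union> b) (live L ?I [x, y])) \<le> card (lv B (live L I []) \<union> b)"
            using lv_finite[OF ln] fb by (intro card_mono) auto
          also have "\<dots> \<le> 2" using card_Un_le[of "lv B (live L I [])" b] less.prems(4) cb by linarith
          finally have c2: "card (lv (B \<union> b) (live L ?I [x, y])) \<le> 2" .
          have "3728 \<le> card ?I" using cI less.prems(3) by linarith
          then show "MW 1 t' ?M (B \<union> b)"
            using FS_pair_two[of "[x, y]"] ok' c2 unfolding FS_def by blast
        qed
        then have "MW 0 t ?M B" unfolding t' by (rule mwin_0)
        then have "MW (Suc 0) t M B" by (rule mwin_insert[OF _ xyX])
        then show ?thesis by simp
      qed
    qed
  qed
qed

lemma FS_path_two: "FS 4104 [] 2"
proof -
  have "FS 4102 [] 1" unfolding FS_def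
  proof (intro allI impI)
    fix M B L I t
    assume ok: "ok M B L I [] t" and ci: "4102 \<le> card I" and lv: "card (lv B (live L I [])) \<le> 1"
    have ln: "line M B L I []" using ok by (rule ok_line)
    have "bad \<tau> t B I \<subseteq> bad \<tau> t B {..<n}" by (rule bad_mono) (use ln in \<open>auto simp: line_def\<close>)
    then have "card (bad \<tau> t B I) \<le> card (bad \<tau> t B {..<n})"
      by (rule card_mono[rotated]) (simp add: bad_def)
    then have 1: "card (bad \<tau> t B I) \<le> 100" using ok unfolding ok_def by linarith
    have "bad \<tau> t B {hd L, last L} \<subseteq> {hd L, last L}" by (auto simp: bad_def)
    then have "card (bad \<tau> t B {hd L, last L}) \<le> card {hd L, last L}" by (intro card_mono) auto
    also have "\<dots> \<le> 2" by (simp add: card_insert_if)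
    finally have 2: "card (bad \<tau> t B {hd L, last L}) \<le> 2" .
    \<comment> \<open>\<open>202 = 2 * 100 + 2\<close> accounts for 100 bad isolated vertices and
      two bad ends.\<close>
    show "MW 1 t M B" by (rule FS_path[OF ok, of 202]) (use 1 2 ci lv in auto)
  qed
  from FS_if_FE[OF FE_if_FS[OF this]] show ?thesis by simp
qed

text \<open>With at most 5001 moves to go, a bad vertex has degree at least
  \<open>\<tau> - 5001\<close>; 101 of them would exceed the sum of all degrees, which is at most
  \<open>2 * n + 2\<close>.\<close>

lemma few_bad:
  assumes "B \<subseteq> X" "card B + t \<le> n + 1" "t \<le> 5001"
  shows "card (bad \<tau> t B {..<n}) \<le> 100"
proof -
  let ?S = "bad \<tau> t B {..<n}"
  have S: "finite ?S" "?S \<subseteq> {..<n}" by (auto simp: bad_def)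
  have "card ?S * (\<tau> - 5001) \<le> (\<Sum>v\<in>?S. deg B v)"
  proof -
    have "(\<Sum>v\<in>?S. \<tau> - 5001) \<le> (\<Sum>v\<in>?S. deg B v)"
      by (rule sum_mono) (use assms(3) in \<open>auto simp: bad_def\<close>)
    then show ?thesis by simp
  qed
  also have "\<dots> \<le> (\<Sum>v<n. deg B v)" using S by (intro sum_mono2) auto
  also have "\<dots> = 2 * card B" by (rule sum_deg[OF assms(1)])
  finally have *: "card ?S * (\<tau> - 5001) \<le> 2 * n + 2" using assms(2) by linarith
  show ?thesis
  proof (rule ccontr)
    assume "\<not> ?thesis"
    then have "101 * (\<tau> - 5001) \<le> card ?S * (\<tau> - 5001)" by (intro mult_le_mono1) simp
    then show False using * big2 by linarith
  qed
qed

text \<open>\<open>H\<close> holds the live edge at the end to be extended, \<open>G\<close>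
  Breaker's reply. The extension removes \<open>H\<close>, and the new vertex is chosen on the edge
  in \<open>G\<close> unless that edge meets \<open>hd L\<close>. So the survivor meets an end
  again, possibly after reversing \<open>L\<close>.\<close>

lemma grow_path:
  assumes "line M B L I []" "t = card I + 1" "card B + t \<le> n + 1" "4200 \<le> card I"
    "lv B (live L I []) \<subseteq> H \<union> G" "finite H" "finite G" "card H \<le> 1" "card G \<le> 1" "\<forall>h\<in>H. last L \<in> h"
  shows "MW 1 t M B"
  using assms
proof (induction "card I" arbitrary: M B L I t H G rule: less_induct)
  case (less I M B L t H G)
  note ln = less.prems(1)
  have fin: "finite I" "finite B" using line_finite[OF ln] by auto
  let ?V = "live L I []"
  have lv2: "card (lv B ?V) \<le> 2"
    using card_mono[OF _ less.prems(5)] card_Un_le[of H G] less.prems(6-9) by fastforce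
  show ?case
  proof (cases "card I \<le> 5000")
    case True
    have "card (bad \<tau> t B {..<n}) \<le> 100"
      by (rule few_bad) (use ln less.prems True in \<open>auto simp: line_def\<close>)
    then have "ok M B L I [] t" using ln less.prems(2) True by (simp add: ok_def)
    then show ?thesis using FS_path_two lv2 less.prems(4) unfolding FS_def by force
  next
    case False
    have one: "g = g'" if "g \<in> G" "g' \<in> G" for g g'
      using that less.prems(9) card_le_Suc0_iff_eq[OF less.prems(7)] by auto
    have oneH: "g = g'" if "g \<in> H" "g' \<in> H" for g g'
      using that less.prems(8) card_le_Suc0_iff_eq[OF less.prems(6)] by auto
    obtain x where x: "x \<in> I" "{last L, x} \<notin> B"
      "\<And>g. g \<in> lv B ?V \<Longrightarrow> last L \<notin> g \<Longrightarrow> hd L \<notin> g \<Longrightarrow> x \<in> g"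
    proof (cases "\<exists>g\<in>lv B ?V. last L \<notin> g \<and> hd L \<notin> g")
      case True
      then obtain g where g: "g \<in> lv B ?V" "last L \<notin> g" "hd L \<notin> g" by blast
      have gG: "g \<in> G" using g less.prems(5,10) by blast
      have "card g = 2" using line_edge[OF ln, of g] g(1) by (simp add: lv_def)
      then obtain y z where yz: "g = {y, z}" "y \<noteq> z" by (auto simp: card_2_iff)
      have I: "y \<in> I" "z \<in> I" using g yz by (auto simp: lv_def)
      \<comment> \<open>Only the edge of \<open>H\<close> can join \<open>last L\<close> to a vertex
        of \<open>g\<close>, so \<open>y\<close> or \<open>z\<close> is available.\<close>
      have "{last L, y} \<notin> B \<or> {last L, z} \<notin> B"
      proof (rule ccontr)
        assume "\<not> ?thesis"
        then have 1: "{last L, y} \<in> lv B ?V" "{last L, z} \<in> lv B ?V" using I by (auto intro!: lv_I)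
        moreover have "{last L, y} \<notin> G" "{last L, z} \<notin> G" using one[OF gG] g(2) by blast+
        ultimately have "{last L, y} = {last L, z}" using less.prems(5) oneH by blast
        then show False using yz(2) by (auto simp: doubleton_eq_iff)
      qed
      then obtain x where x: "x \<in> g" "{last L, x} \<notin> B" using yz by auto
      show ?thesis
      proof (rule that[of x])
        fix g' assume "g' \<in> lv B ?V" "last L \<notin> g'" "hd L \<notin> g'"
        then have "g' \<in> G" using less.prems(5,10) by blast
        then show "x \<in> g'" using one[OF gG] x(1) by blast
      qed (use x yz I in auto)
    next
      case none: False
      obtain x where "x \<in> I" "{last L, x} \<notin> B" using clean_vertex[OF ln lv2] less.prems(4) by auto
      then show ?thesis using that none by blast
    qed
    let ?M = "insert {last L, x} M"
    obtain t' where t': "t = Suc t'" using less.prems(2) by (cases t) auto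
    have cI: "card (I - {x}) + 1 = card I" using card_Suc_Diff1[OF fin(1) x(1)] by linarith
    have hl: "hd (L @ [x]) = hd L" "last (L @ [x]) = x" using line_ne(1)[OF ln] by auto
    have "W (Suc t') ?M B" unfolding wins_Suc_iff
    proof (intro allI impI)
      fix b assume b: "b \<subseteq> X - (?M \<union> B) \<and> card b \<le> 1"
      have fb: "finite b" using b phase.finite_X[of n] finite_subset by (metis finite_Diff)
      have cb: "card b \<le> 1" using b by simp
      have ln': "line ?M (B \<union> b) (L @ [x]) (I - {x}) []"
        by (rule line_ext[OF ln x(1,2)]) (use b in auto)
      define G' where "G' = {h \<in> lv B ?V. last L \<notin> h}"
      have G'G: "G' \<subseteq> G" using less.prems(5,10) by (auto simp: G'_def)
      have finG: "finite G'" "card G' \<le> 1"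
        using G'G less.prems(7,9) finite_subset card_mono le_trans by metis+
      have lv': "lv (B \<union> b) (live (L @ [x]) (I - {x}) []) \<subseteq> G' \<union> b"
        unfolding G'_def by (rule lv_ext[OF ln x(1)])
      have t1: "t' = card (I - {x}) + 1" "card (I - {x}) < card I" "4200 \<le> card (I - {x})"
        using less.prems(2,4) t' cI False by auto
      have t2: "card (B \<union> b) + t' \<le> n + 1" using card_Un_le[of B b] less.prems(3) cb t' by linarith
      show "MW 1 t' ?M (B \<union> b)"
      proof (cases "\<forall>g\<in>G'. x \<in> g")
        case True
        then show ?thesis
          by (intro less.hyps[OF t1(2) ln' t1(1) t2 t1(3) lv' finG(1) fb finG(2) cb]) (simp add: hl)
      next
        case nx: False
        then obtain g where g: "g \<in> G'" "x \<notin> g" by blast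
        then have "hd L \<in> g" using x(3)[of g] by (auto simp: G'_def)
        then have all: "\<forall>h\<in>G'. hd L \<in> h" using g(1) G'G one by blast
        have ne: "L @ [x] \<noteq> []" by simp
        have lvr: "lv (B \<union> b) (live (rev (L @ [x])) (I - {x}) []) \<subseteq> G' \<union> b"
          unfolding live_rev[OF ne] by (rule lv')
        have "\<forall>h\<in>G'. last (rev (L @ [x])) \<in> h" unfolding last_rev hl(1) by (rule all)
        then show ?thesis
          by (rule less.hyps[OF t1(2) line_rev[OF ln'] t1(1) t2 t1(3) lvr finG(1) fb finG(2) cb])
      qed
    qed
    then show ?thesis unfolding t' by (rule ext_MW[OF ln x(1,2)])
  qed
qed

theorem wins_one: "W (Suc n) {} {}"
  unfolding wins_Suc_iff
proof (intro allI impI)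
  fix b assume b: "b \<subseteq> X - ({} \<union> {}) \<and> card b \<le> 1"
  have fb: "finite b" using b phase.finite_X[of n] finite_subset by (metis finite_Diff)
  have n: "40000 \<le> n" using big by simp
  \<comment> \<open>Maker's first edge starts at a vertex of Breaker's first edge, so that
    \<open>H = b\<close> satisfies the invariant.\<close>
  obtain w x where wx: "w < n" "x < n" "w \<noteq> x" "{w, x} \<notin> b" "\<forall>h\<in>b. x \<in> h"
  proof (cases "b = {}")
    case True
    then show ?thesis using that[of 0 1] n by auto
  next
    case False
    then have "card b = 1" using b fb by (simp add: le_Suc_eq)
    then obtain g where g: "b = {g}" by (rule card_1_singletonE)
    then have gX: "g \<in> X" using b by blast
    obtain y z where yz: "g = {y, z}" "y \<noteq> z" "y < n" "z < n" using phase.X_edge[OF gX] by auto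
    have "\<not> {..<n} \<subseteq> {y, z}" using card_mono[of "{y, z}" "{..<n}"] n yz(2) by auto
    then obtain w where "w < n" "w \<notin> {y, z}" by auto
    then show ?thesis using that[of w y] yz g by (auto simp: doubleton_eq_iff)
  qed
  let ?M = "{{w, x}}" and ?I = "{..<n} - {w, x}"
  obtain n' where n': "n = Suc n'" using n by (cases n) auto
  have cI: "card ?I + 2 = n" using wx n by (subst card_Diff_subset) auto
  have "W (Suc n') ?M b" unfolding wins_Suc_iff
  proof (intro allI impI)
    fix b2 assume b2: "b2 \<subseteq> X - (?M \<union> b) \<and> card b2 \<le> 1"
    have fb2: "finite b2" using b2 phase.finite_X[of n] finite_subset by (metis finite_Diff)
    have ln: "line ?M (b \<union> b2) [w, x] ?I []"
      using wx b b2 unfolding line_def by (auto simp: walk_Cons)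
    show "MW 1 n' ?M (b \<union> b2)"
    proof (rule grow_path[OF ln])
      show "n' = card ?I + 1" "4200 \<le> card ?I" using cI n' n by auto
      show "card (b \<union> b2) + n' \<le> n + 1" using card_Un_le[of b b2] b b2 n' by linarith
      show "lv (b \<union> b2) (live [w, x] ?I []) \<subseteq> b \<union> b2" by (auto simp: lv_def)
      show "\<forall>h\<in>b. last [w, x] \<in> h" using wx(5) by simp
    qed (use fb fb2 b b2 in auto)
  qed
  then have "MW 0 n ?M b" unfolding n' by (rule mwin_0)
  then have "MW (Suc 0) n {} b" by (rule mwin_insert) (use wx in \<open>auto simp: complete_edges_def\<close>)
  then show "MW 1 n {} ({} \<union> b)" by simp
qed

end

section \<open>Upper and lower bounds combined\<close>

lemma tau_eqI:
  assumes "maker_wins_within X F a t" "\<And>s. s < t \<Longrightarrow> \<not> maker_wins_within X F a s"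
  shows "tau X F a = enat t"
  unfolding tau_def
proof (rule antisym)
  show "Inf (enat ` {t. maker_wins_within X F a t}) \<le> enat t"
    by (rule Inf_lower) (use assms(1) in blast)
  show "enat t \<le> Inf (enat ` {t. maker_wins_within X F a t})"
    by (rule Inf_greatest) (use assms(2) in \<open>auto simp flip: not_less\<close>)
qed

text \<open>This form matches the split of \<open>n\<close> into \<open>a * q\<close> and a
  remainder between 1 and \<open>a\<close>, the size of Maker's first move.\<close>

lemma ceiling_div:
  assumes "0 < a" "1 \<le> n"
  shows "nat \<lceil>real n / real a\<rceil> = Suc ((n - 1) div a)"
proof -
  let ?q = "(n - 1) div a"
  have "a * ?q + (n - 1) mod a = n - 1" "(n - 1) mod a < a" using assms by auto
  then have "a * ?q < n" "n \<le> a * Suc ?q" using assms(2) unfolding mult_Suc_right by linarith+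
  then have "real (a * ?q) < real n" "real n \<le> real (a * Suc ?q)" by (simp_all only: of_nat_less_iff of_nat_le_iff)
  then have "real ?q < real n / real a" "real n / real a \<le> real ?q + 1"
    using assms(1) by (simp_all add: field_simps)
  then have "\<lceil>real n / real a\<rceil> = int ?q + 1" by (intro ceiling_unique) simp_all
  then show ?thesis by simp
qed

lemma tau_wins:
  assumes "wins (complete_edges n) (hamilton_cycles n) a t {} {}"
    "\<And>s. s < t \<Longrightarrow> \<not> maker_wins_within (complete_edges n) (hamilton_cycles n) a s"
  shows "tau (complete_edges n) (hamilton_cycles n) a = enat t"
  by (rule tau_eqI[OF maker_wins_within_if_wins[OF phase.finite_X assms(1)] assms(2)])

theorem theorem1p2:
  fixes a :: nat
  assumes "a > 0"
  shows "\<exists>n0. \<forall>n\<ge>n0.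
    tau (complete_edges n) (hamilton_cycles n) a =
      (if a = 1 \<or> (a = 2 \<and> even n) then enat (n div a + 1)
       else enat (nat \<lceil>real n / real a\<rceil>))"
proof (intro exI allI impI)
  fix n assume n: "1000000 + (2 * a + 4 * a * (2 * (a + 3) + 2) + 9 * a + 60) \<le> n"
  consider "a = 1" | "a = 2" "even n" | "a = 2" "odd n" | "3 \<le> a" using assms by linarith
  then show "tau (complete_edges n) (hamilton_cycles n) a =
      (if a = 1 \<or> (a = 2 \<and> even n) then enat (n div a + 1)
       else enat (nat \<lceil>real n / real a\<rceil>))"
  proof cases
    case 1
    \<comment> \<open>The divisor 40 works since \<open>24 / 40 < 1\<close> and
      \<open>101 / 40 > 2\<close>; the additive constants in \<open>big\<close> and
      \<open>big2\<close> are absorbed by \<open>n \<ge> 1000000\<close>.\<close>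
    interpret single n "n div 40" by standard (use n in linarith)+
    have "tau (complete_edges n) (hamilton_cycles n) 1 = enat (Suc n)"
    proof (rule tau_wins[OF wins_one])
      fix s assume "s < Suc n"
      then show "\<not> maker_wins_within (complete_edges n) (hamilton_cycles n) 1 s"
        using lower_one[of n] lower_count[of 1 s n] n by (cases "s = n") auto
    qed
    then show ?thesis using 1 by simp
  next
    case 2
    have "tau (complete_edges n) (hamilton_cycles n) 2 = enat (Suc (n div 2))"
    proof (rule tau_wins)
      show "wins (complete_edges n) (hamilton_cycles n) 2 (Suc (n div 2)) {} {}"
        by (rule wins_two[where \<rho> = 1]) (use 2 n in auto)
      fix s assume "s < Suc (n div 2)"
      then show "\<not> maker_wins_within (complete_edges n) (hamilton_cycles n) 2 s"
        using lower_two[of n] lower_count[of 2 s n] 2 n by (cases "s = n div 2") auto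
    qed
    then show ?thesis using 2 by simp
  next
    case 3
    have val: "nat \<lceil>real n / real a\<rceil> = Suc ((n - 1) div 2)" using ceiling_div[of a n] 3 n by simp
    have "tau (complete_edges n) (hamilton_cycles n) 2 = enat (Suc ((n - 1) div 2))"
    proof (rule tau_wins)
      show "wins (complete_edges n) (hamilton_cycles n) 2 (Suc ((n - 1) div 2)) {} {}"
        by (rule wins_two[where \<rho> = 2]) (use 3 n in auto)
      fix s assume "s < Suc ((n - 1) div 2)"
      then have "2 * s < n" using n by linarith
      then show "\<not> maker_wins_within (complete_edges n) (hamilton_cycles n) 2 s" by (rule lower_count)
    qed
    then show ?thesis using 3 val by simp
  next
    case 4
    let ?q = "(n - 1) div a" and ?r = "(n - 1) mod a"
    have qr: "a * ?q + (?r + 1) = n" "?r + 1 \<le> a" using n mod_less_divisor[OF assms, of "n - 1"] by auto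
    have "tau (complete_edges n) (hamilton_cycles n) a = enat (Suc ?q)"
    proof (rule tau_wins)
      show "wins (complete_edges n) (hamilton_cycles n) a (Suc ?q) {} {}"
        by (rule wins_three[OF 4 _ qr(1) _ qr(2)]) (use n in simp_all)
      fix s assume "s < Suc ?q"
      then have "a * s \<le> a * ?q" by simp
      then have "a * s < n" using qr(1) by linarith
      then show "\<not> maker_wins_within (complete_edges n) (hamilton_cycles n) a s" by (rule lower_count)
    qed
    then show ?thesis using 4 ceiling_div[OF assms, of n] n by simp
  qed
qed

end
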